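(* Let $\mathrm{Pe}\in\mathbb{R}$ and $D_e>0$. Let $f_0\in L^\infty(\Upsilon)$ be non-negative (and periodic) with $\rho_0(x)=\int_0^{2\pi}f_0(x,\theta)\,d\theta\in[0,1]$ for a.e. $x\in\Omega$, and let $f$ be the unique (global-in-time) weak solution of $$\partial_t f+\mathrm{Pe}\,\mathrm{div}\big((1-\rho)f\,\mathbf e(\theta)\big)=D_e\Delta f+\partial_\theta^2 f$$ with initial data $f_0$. Then there holds the global-in-time estimate $$\|f\|_{L^\infty((0,\infty)\times\Upsilon)}\le C(\mathrm{Pe},D_e,\|f_0\|_{L^\infty(\Upsilon)}),$$ where the finite constant $C$ depends only on $\mathrm{Pe}$, $D_e$ and $\|f_0\|_{L^\infty(\Upsilon)}$.
   Context: $\Omega=(0,2\pi)^2$, $\Upsilon=\Omega\times(0,2\pi)=(0,2\pi)^3$, $\Upsilon_T=(0,T)\times\Upsilon$, $\Omega_T=(0,T)\times\Omega$, $\xi=(x,\theta)$ with $x\in\Omega$, $\theta\in(0,2\pi)$; $\mathbf e(\theta)=(\cos\theta,\sin\theta)$; $\mathrm{div},\nabla,\Delta$ act on $x$ only. The subscript "per" denotes spaces of functions on $\mathbb{R}^d$ that are $2\pi$-periodic in each coordinate, with norm taken over the periodic cell. Weak solution on $(0,T)$: given non-negative $f_0\in L^2_{\mathrm{per}}(\Upsilon)$ with $\rho_0=\int_0^{2\pi}f_0\,d\theta\in[0,1]$ a.e., a weak solution is a function $f\in C([0,T];L^2_{\mathrm{per}}(\Upsilon))\cap L^2(0,T;H^1_{\mathrm{per}}(\Upsilon))$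 with $\partial_t f\in L^2(0,T;(H^1_{\mathrm{per}})'(\Upsilon))$ such that for all $\varphi\in L^2(0,T;H^1_{\mathrm{per}}(\Upsilon))$ $$\langle\partial_t f,\varphi\rangle=\mathrm{Pe}\int_{\Upsilon_T}(1-\rho)f\,\mathbf e(\theta)\cdot\nabla\varphi\,d\xi\,dt-D_e\int_{\Upsilon_T}\nabla f\cdot\nabla\varphi\,d\xi\,dt-\int_{\Upsilon_T}\partial_\theta f\,\partial_\theta\varphi\,d\xi\,dt,$$ $\lim_{t\to0^+}f(t)=f_0$ in $L^2_{\mathrm{per}}(\Upsilon)$, and $\rho(t,x)=\int_0^{2\pi}f(t,x,\theta)\,d\theta$ satisfies $0\le\rho\le1$ a.e. in $\Omega_T$. It is known that for such $f_0$ and every $T>0$ there is a unique weak solution; the weak solutions for different $T$ agree and define the global-in-time solution on $(0,\infty)$. *)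

theory Defs
  imports "HOL-Analysis.Analysis" "HOL-Probability.Essential_Supremum"
begin

text \<open>A point \<open>\<xi> = (x, \<theta>)\<close> consists of \<open>x \<in> \<real> \<times> \<real>\<close> and \<open>\<theta> \<in> \<real>\<close>. For a gradient \<open>g\<close> with respect to
  \<open>\<xi>\<close>, \<open>fst g\<close> is therefore the \<open>x\<close>-gradient and \<open>snd g\<close> the \<open>\<theta>\<close>-derivative.

  Elements of \<open>L\<^sup>p\<close>-type spaces are represented by Borel functions, and all notions below depend only
  on the class modulo null sets. Time-dependent functions are represented by jointly Borel
  functions, so that \<open>L\<^sup>2(0,T;L\<^sup>2)\<close> is \<open>L\<^sup>2\<close> of the space-time cylinder.\<close>

type_synonym point = "(real \<times> real) \<times> real"

definition Omega :: "(real \<times> real) set" where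
  "Omega = {0<..<2 * pi} \<times> {0<..<2 * pi}"

definition Upsilon :: "point set" where
  "Upsilon = Omega \<times> {0<..<2 * pi}"

definition e_dir :: "real \<Rightarrow> real \<times> real" where
  "e_dir \<theta> = (cos \<theta>, sin \<theta>)"


subsection \<open>Smooth functions\<close>

definition partial_deriv :: "'a \<Rightarrow> ('a::euclidean_space \<Rightarrow> real) \<Rightarrow> 'a \<Rightarrow> real" where
  "partial_deriv i \<psi> x = frechet_derivative \<psi> (at x) i"

primrec times_cont_diff :: "nat \<Rightarrow> ('a::euclidean_space \<Rightarrow> real) \<Rightarrow> bool" where
  "times_cont_diff 0 \<psi> \<longleftrightarrow> continuous_on UNIV \<psi>"
| "times_cont_diff (Suc k) \<psi> \<longleftrightarrow>
     (\<forall>x. \<psi> differentiable (at x)) \<and> (\<forall>i\<in>Basis. times_cont_diff k (partial_deriv i \<psi>))"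

definition smooth :: "('a::euclidean_space \<Rightarrow> real) \<Rightarrow> bool" where
  "smooth \<psi> \<longleftrightarrow> (\<forall>k. times_cont_diff k \<psi>)"

definition smooth_per :: "(point \<Rightarrow> real) set" where
  "smooth_per = {\<psi>. smooth \<psi> \<and> (\<forall>i\<in>Basis. \<forall>\<xi>. \<psi> (\<xi> + (2 * pi) *\<^sub>R i) = \<psi> \<xi>)}"

definition smooth_cpt :: "real set \<Rightarrow> (real \<Rightarrow> real) set" where
  "smooth_cpt I = {\<psi>. smooth \<psi> \<and> (\<exists>K. compact K \<and> K \<subseteq> I \<and> (\<forall>t. t \<notin> K \<longrightarrow> \<psi> t = 0))}"


subsection \<open>Periodic function spaces\<close>

definition periodic_ae :: "(point \<Rightarrow> 'b) \<Rightarrow> bool" where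
  "periodic_ae u \<longleftrightarrow> (\<forall>i\<in>Basis. AE \<xi> in lborel. u (\<xi> + (2 * pi) *\<^sub>R i) = u \<xi>)"

definition L2_per :: "(point \<Rightarrow> 'b::euclidean_space) set" where
  "L2_per = {u. u \<in> borel_measurable lborel \<and> periodic_ae u \<and>
     set_integrable lborel Upsilon (\<lambda>\<xi>. (norm (u \<xi>))\<^sup>2)}"

definition L2_norm :: "(point \<Rightarrow> 'b::euclidean_space) \<Rightarrow> real" where
  "L2_norm u = sqrt (LINT \<xi>:Upsilon|lborel. (norm (u \<xi>))\<^sup>2)"

definition Linf_norm :: "'a::euclidean_space set \<Rightarrow> ('a \<Rightarrow> real) \<Rightarrow> ennreal" where
  "Linf_norm A u = esssup (restrict_space lborel A) (\<lambda>x. ennreal \<bar>u x\<bar>)"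

definition Linf_per :: "(point \<Rightarrow> real) set" where
  "Linf_per = {u. u \<in> borel_measurable lborel \<and> periodic_ae u \<and> Linf_norm Upsilon u < \<infinity>}"

text \<open>\<open>u \<in> H\<^sup>1\<^sub>p\<^sub>e\<^sub>r\<close> with weak gradient \<open>g\<close>, in the sense of distributions on the torus.\<close>

definition H1_grad :: "(point \<Rightarrow> real) \<Rightarrow> (point \<Rightarrow> point) \<Rightarrow> bool" where
  "H1_grad u g \<longleftrightarrow> u \<in> L2_per \<and> g \<in> L2_per \<and>
     (\<forall>\<psi>\<in>smooth_per. \<forall>i\<in>Basis.
        (LINT \<xi>:Upsilon|lborel. u \<xi> * partial_deriv i \<psi> \<xi>) =
        - (LINT \<xi>:Upsilon|lborel. (g \<xi> \<bullet> i) * \<psi> \<xi>))"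

definition H1_per :: "(point \<Rightarrow> real) set" where
  "H1_per = {u. \<exists>g. H1_grad u g}"

text \<open>The \<open>H\<^sup>1\<close> norm of \<open>u\<close>, where \<open>g\<close> is the (a.e. unique) weak gradient of \<open>u\<close>.\<close>

definition H1_norm :: "(point \<Rightarrow> real) \<Rightarrow> (point \<Rightarrow> point) \<Rightarrow> real" where
  "H1_norm u g = sqrt ((L2_norm u)\<^sup>2 + (L2_norm g)\<^sup>2)"

definition H1_functional :: "((point \<Rightarrow> real) \<Rightarrow> real) \<Rightarrow> bool" where
  "H1_functional L \<longleftrightarrow> (\<forall>u\<in>H1_per. \<forall>v\<in>H1_per. \<forall>a b.
     L (\<lambda>\<xi>. a * u \<xi> + b * v \<xi>) = a * L u + b * L v)"

definition H1_dual_norm :: "((point \<Rightarrow> real) \<Rightarrow> real) \<Rightarrow> ennreal" where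
  "H1_dual_norm L = (SUP (u, g)\<in>{(u, g). H1_grad u g \<and> H1_norm u g \<le> 1}. ennreal \<bar>L u\<bar>)"

definition H1_dual :: "((point \<Rightarrow> real) \<Rightarrow> real) set" where
  "H1_dual = {L. H1_functional L \<and> H1_dual_norm L < \<infinity>}"


subsection \<open>Time-dependent functions\<close>

definition C_L2 :: "real \<Rightarrow> (real \<Rightarrow> point \<Rightarrow> real) \<Rightarrow> bool" where
  "C_L2 T u \<longleftrightarrow> (\<forall>t\<in>{0..T}. u t \<in> L2_per \<and>
     ((\<lambda>s. L2_norm (\<lambda>\<xi>. u s \<xi> - u t \<xi>)) \<longlongrightarrow> 0) (at t within {0..T}))"

text \<open>\<open>u \<in> L\<^sup>2(0,T;H\<^sup>1\<^sub>p\<^sub>e\<^sub>r)\<close> with weak gradient \<open>G t\<close> at almost every time \<open>t\<close>.\<close>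

definition L2_H1_grad ::
  "real \<Rightarrow> (real \<Rightarrow> point \<Rightarrow> real) \<Rightarrow> (real \<Rightarrow> point \<Rightarrow> point) \<Rightarrow> bool" where
  "L2_H1_grad T u G \<longleftrightarrow>
     (\<lambda>(t, \<xi>). u t \<xi>) \<in> borel_measurable (restrict_space lborel ({0<..<T} \<times> UNIV)) \<and>
     (\<lambda>(t, \<xi>). G t \<xi>) \<in> borel_measurable (restrict_space lborel ({0<..<T} \<times> UNIV)) \<and>
     (AE t in lborel. t \<in> {0<..<T} \<longrightarrow> H1_grad (u t) (G t)) \<and>
     set_integrable lborel ({0<..<T} \<times> Upsilon) (\<lambda>(t, \<xi>). (u t \<xi>)\<^sup>2 + (norm (G t \<xi>))\<^sup>2)"

text \<open>Weak measurability suffices in \<open>L\<^sup>2(0,T;(H\<^sup>1\<^sub>p\<^sub>e\<^sub>r)')\<close> by Pettis' theorem, as \<open>(H\<^sup>1\<^sub>p\<^sub>e\<^sub>r)'\<close> is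
  separable and \<open>H\<^sup>1\<^sub>p\<^sub>e\<^sub>r\<close> is reflexive. The completed measure is used for the time variable because
  a functional \<open>F t\<close> is unconstrained outside \<open>H1_per\<close> and for \<open>t\<close> in a null set.\<close>

definition L2_H1_dual :: "real \<Rightarrow> (real \<Rightarrow> (point \<Rightarrow> real) \<Rightarrow> real) \<Rightarrow> bool" where
  "L2_H1_dual T F \<longleftrightarrow>
     (AE t in lebesgue_on {0<..<T}. F t \<in> H1_dual) \<and>
     (\<forall>v\<in>H1_per. (\<lambda>t. F t v) \<in> borel_measurable (lebesgue_on {0<..<T})) \<and>
     (\<integral>\<^sup>+ t. (H1_dual_norm (F t))\<^sup>2 \<partial>lebesgue_on {0<..<T}) < \<infinity>"

text \<open>\<open>F = \<partial>\<^sub>t u\<close> as a vector-valued distribution on \<open>(0,T)\<close>, where \<open>L\<^sup>2\<^sub>p\<^sub>e\<^sub>r\<close> is embedded in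
  \<open>(H\<^sup>1\<^sub>p\<^sub>e\<^sub>r)'\<close> through the \<open>L\<^sup>2\<close> inner product.\<close>

definition is_time_deriv ::
  "real \<Rightarrow> (real \<Rightarrow> point \<Rightarrow> real) \<Rightarrow> (real \<Rightarrow> (point \<Rightarrow> real) \<Rightarrow> real) \<Rightarrow> bool" where
  "is_time_deriv T u F \<longleftrightarrow>
     (\<forall>\<psi>\<in>smooth_cpt {0<..<T}. \<forall>v\<in>H1_per.
        (LINT t|lebesgue_on {0<..<T}. deriv \<psi> t * (LINT \<xi>:Upsilon|lborel. u t \<xi> * v \<xi>)) =
        - (LINT t|lebesgue_on {0<..<T}. \<psi> t * F t v))"


subsection \<open>Weak solutions\<close>

definition angular_int :: "(point \<Rightarrow> real) \<Rightarrow> real \<times> real \<Rightarrow> real" where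
  "angular_int u x = (LINT \<theta>:{0<..<2 * pi}|lborel. u (x, \<theta>))"

definition weak_solution ::
  "real \<Rightarrow> real \<Rightarrow> (point \<Rightarrow> real) \<Rightarrow> real \<Rightarrow> (real \<Rightarrow> point \<Rightarrow> real) \<Rightarrow> bool" where
  "weak_solution Pe De f0 T f \<longleftrightarrow>
     (let \<rho> = (\<lambda>t. angular_int (f t)) in
      C_L2 T f \<and>
      (\<exists>G F. L2_H1_grad T f G \<and> L2_H1_dual T F \<and> is_time_deriv T f F \<and>
        (\<forall>\<phi> \<Phi>. L2_H1_grad T \<phi> \<Phi> \<longrightarrow>
           (LINT t|lebesgue_on {0<..<T}. F t (\<phi> t)) =
             Pe * set_lebesgue_integral lborel ({0<..<T} \<times> Upsilon)
               (\<lambda>(t, x, \<theta>). (1 - \<rho> t x) * f t (x, \<theta>) * (e_dir \<theta> \<bullet> fst (\<Phi> t (x, \<theta>))))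
             - De * set_lebesgue_integral lborel ({0<..<T} \<times> Upsilon)
               (\<lambda>(t, \<xi>). fst (G t \<xi>) \<bullet> fst (\<Phi> t \<xi>))
             - set_lebesgue_integral lborel ({0<..<T} \<times> Upsilon)
               (\<lambda>(t, \<xi>). snd (G t \<xi>) * snd (\<Phi> t \<xi>)))) \<and>
      ((\<lambda>t. L2_norm (\<lambda>\<xi>. f t \<xi> - f0 \<xi>)) \<longlongrightarrow> 0) (at_right 0) \<and>
      (AE p in lborel. p \<in> {0<..<T} \<times> Omega \<longrightarrow>
         0 \<le> \<rho> (fst p) (snd p) \<and> \<rho> (fst p) (snd p) \<le> 1))"

definition global_weak_solution ::
  "real \<Rightarrow> real \<Rightarrow> (point \<Rightarrow> real) \<Rightarrow> (real \<Rightarrow> point \<Rightarrow> real) \<Rightarrow> bool" where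
  "global_weak_solution Pe De f0 f \<longleftrightarrow> (\<forall>T>0. weak_solution Pe De f0 T f)"

end

theory Submission
  imports Defs "HOL-Probability.Probability" "HOL-Computational_Algebra.Polynomial"
begin

text \<open>
  Let \<open>f\<^sub>n\<close> be the Fejer means of \<open>f\<close> in \<open>\<xi>\<close>. Their finitely many Fourier coefficients are
  continuously differentiable in time, and they solve the equation with flux \<open>((1 - \<rho>) f e(\<theta>))\<^sub>n\<close>.

  Non-negativity of \<open>f\<close> follows by testing with the negative part. As \<open>0 \<le> 1 - \<rho> \<le> 1\<close> and the
  Fejer kernel is non-negative, each component of the flux is then bounded by \<open>f\<^sub>n\<close>, so
  its sup norm is at most \<open>M = sup f\<^sub>n\<close>. On the other hand \<open>\<integral> f\<^sub>n d\<theta> \<le> 1\<close>, so that averaging over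
  \<open>\<theta>\<close> against a Gaussian of variance \<open>2\<tau> \<le> 2\<close> yields at most \<open>2 / \<surd>\<tau>\<close>. Both bounds together give
  \<open>\<surd>(2 M / \<surd>\<tau>)\<close>, and the \<open>x\<close>-gradient of the heat kernel contributes a further factor \<open>1 / \<surd>\<tau>\<close>. The
  product is integrable on \<open>(0, 1)\<close>, so Duhamel's formula on a time interval of length at most one
  gives \<open>M \<le> max \<parallel>f\<^sub>0\<parallel> 2 + C \<surd>M\<close>. Since \<open>M\<close> is finite for each \<open>n\<close>, it is bounded uniformly in \<open>n\<close>.\<close>

section \<open>The periodic cell\<close>

text \<open>With the bound \<open>M\<close> alone the inequality for \<open>M\<close> would be
  linear, to be absorbed only on time intervals short against De / Pe^2; with the angular bound
  alone the singularity would be 1/\<tau>, which is not integrable. The geometric mean has the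
  integrable singularity \<tau>^(-3/4) and is sublinear in \<open>M\<close>, so it is absorbed for
  every \<open>Pe\<close> on intervals of length one. Uniformity in time comes from where these
  intervals start: for t > 1 it is t - 1, and the heat flow over a unit of time turns an angular
  mass of at most one into a bound by 2, whatever the size of f(t - 1). The delicate point of
  non-negativity is that averaging does not respect the sign: the mean of the flux is controlled by
  the mean of |f|, not by |f_n|. Testing the equation for f_n with its negative part thus leaves an
  error that contains the negative part of f itself, and Gronwall's inequality applies only after n
  has gone to infinity.\<close>

abbreviation period_box :: "point set" where
  "period_box \<equiv> cbox ((0, 0), 0) ((2 * pi, 2 * pi), 2 * pi)"

definition cell :: "point measure" where
  "cell = restrict_space lborel Upsilon"

definition angle :: "real measure" where
  "angle = restrict_space lborel {0<..<2 * pi}"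

lemma Upsilon_eq_box: "Upsilon = box ((0, 0), 0) ((2 * pi, 2 * pi), 2 * pi)"
proof (rule set_eqI)
  fix \<xi> :: point
  show "\<xi> \<in> Upsilon \<longleftrightarrow> \<xi> \<in> box ((0, 0), 0) ((2 * pi, 2 * pi), 2 * pi)"
    by (cases \<xi>) (auto simp: Upsilon_def Omega_def mem_box Basis_prod_def)
qed

lemma open_Upsilon [simp]: "open Upsilon"
  unfolding Upsilon_eq_box by (rule open_box)

lemma Upsilon_sets [measurable, simp]: "Upsilon \<in> sets borel"
  by (simp add: borel_open)

lemma open_Omega: "open Omega"
  unfolding Omega_def by (intro open_Times open_greaterThanLessThan)

lemma Omega_sets [measurable, simp]: "Omega \<in> sets borel"
  by (simp add: borel_open open_Omega)

lemma space_cell [simp]: "space cell = Upsilon"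
  by (simp add: cell_def space_restrict_space)

lemma space_angle [simp]: "space angle = {0<..<2 * pi}"
  by (simp add: angle_def space_restrict_space)

lemma measurable_cell: "f \<in> borel_measurable lborel \<Longrightarrow> f \<in> borel_measurable cell"
  unfolding cell_def by (rule measurable_restrict_space1)

lemma set_integral_Upsilon:
  "(LINT \<xi>:Upsilon|lborel. f \<xi>) = (LINT \<xi>|cell. f \<xi>)" for f :: "point \<Rightarrow> 'b::euclidean_space"
  unfolding cell_def set_lebesgue_integral_def by (subst integral_restrict_space) auto

lemma set_integrable_Upsilon:
  "set_integrable lborel Upsilon f \<longleftrightarrow> integrable cell f" for f :: "point \<Rightarrow> 'b::euclidean_space"
  unfolding cell_def set_integrable_def by (subst integrable_restrict_space) auto

lemma AE_cell: "(AE \<xi> in cell. P \<xi>) \<longleftrightarrow> (AE \<xi> in lborel. \<xi> \<in> Upsilon \<longrightarrow> P \<xi>)"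
  unfolding cell_def by (subst AE_restrict_space_iff) auto

lemma angle_measure_eq: "emeasure angle {0<..<2*pi} = ennreal (2 * pi)"
  unfolding angle_def by (subst emeasure_restrict_space) auto

lemma emeasure_cell: "emeasure cell Upsilon = ennreal ((2 * pi) ^ 3)"
proof -
  have "emeasure cell Upsilon = emeasure lborel Upsilon"
    unfolding cell_def by (subst emeasure_restrict_space) auto
  also have "\<dots> = ennreal ((2 * pi) ^ 3)"
    unfolding Upsilon_eq_box
    by (subst emeasure_lborel_box)
      (auto simp: Basis_prod_def prod.union_disjoint power3_eq_cube)
  finally show ?thesis .
qed

interpretation cell: finite_measure cell
  by standard (simp add: emeasure_cell)

interpretation angle: finite_measure angle
  by standard (simp add: angle_measure_eq)

interpretation Om: finite_measure "restrict_space lborel Omega"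
proof
  have "emeasure (restrict_space lborel Omega) Omega = emeasure lborel Omega"
    by (subst emeasure_restrict_space) auto
  also have "\<dots> < \<infinity>"
    by (rule emeasure_bounded_finite) (auto simp: Omega_def bounded_Times)
  finally show "emeasure (restrict_space lborel Omega) (space (restrict_space lborel Omega)) \<noteq> \<infinity>"
    by (simp add: space_restrict_space)
qed

lemma measure_cell [simp]: "measure cell Upsilon = (2 * pi) ^ 3"
  by (simp add: measure_def emeasure_cell)

lemma measure_angle [simp]: "measure angle {0<..<2 * pi} = 2 * pi"
  by (simp add: measure_def angle_measure_eq)

text \<open>Fubini's theorem speaks of product measures, while the integrals to be treated are over
  restrictions of \<open>lborel\<close> to product sets. By uniqueness of the product measure it is
  enough to compare the sigma-algebras and the measures of rectangles.\<close>

lemma restrict_lborel_Times: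
  fixes A :: "'a::euclidean_space set" and B :: "'b::euclidean_space set"
  assumes A [measurable]: "A \<in> sets borel" and B [measurable]: "B \<in> sets borel"
  shows "restrict_space lborel A \<Otimes>\<^sub>M restrict_space lborel B = restrict_space lborel (A \<times> B)"
proof (rule pair_measure_eqI)
  show "sigma_finite_measure (restrict_space lborel A)" "sigma_finite_measure (restrict_space lborel B)"
    using A B by (auto intro!: sigma_finite_measure_restrict_space lborel.sigma_finite_measure_axioms)
  have AB [measurable]: "A \<times> B \<in> sets borel"
    unfolding borel_prod[symmetric] by measurable
  show "sets (restrict_space lborel A \<Otimes>\<^sub>M restrict_space lborel B)
      = sets (restrict_space lborel (A \<times> B))" (is "sets ?P = sets ?R")
  proof
    have i: "(\<lambda>x. x) \<in> measurable (restrict_space lborel A) borel"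
      "(\<lambda>x. x) \<in> measurable (restrict_space lborel B) borel"
      by (rule measurable_restrict_space1, simp)+
    have "fst \<in> measurable ?P borel" "snd \<in> measurable ?P borel"
      by (rule measurable_compose[OF measurable_fst i(1)], rule measurable_compose[OF measurable_snd i(2)])
    then have "(\<lambda>p. (fst p, snd p)) \<in> measurable ?P (borel \<Otimes>\<^sub>M borel)"
      by measurable
    then have id: "(\<lambda>p. p) \<in> measurable ?P borel"
      unfolding borel_prod by simp
    show "sets ?R \<subseteq> sets ?P"
    proof
      fix X assume "X \<in> sets ?R"
      then obtain C where "C \<in> sets borel" "X = A \<times> B \<inter> C"
        by (auto simp: sets_restrict_space)
      then show "X \<in> sets ?P"
        using measurable_sets[OF id, of C]
        by (simp add: space_pair_measure space_restrict_space Int_commute)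
    qed
    show "sets ?P \<subseteq> sets ?R"
    proof (rule sets_pair_in_sets)
      fix X Y assume "X \<in> sets (restrict_space lborel A)" "Y \<in> sets (restrict_space lborel B)"
      then obtain C D where [measurable]: "C \<in> sets borel" "D \<in> sets borel"
        and XY: "X = A \<inter> C" "Y = B \<inter> D"
        by (auto simp: sets_restrict_space)
      have "C \<times> D \<in> sets (borel :: ('a \<times> 'b) measure)"
        unfolding borel_prod[symmetric] by measurable
      then show "X \<times> Y \<in> sets ?R"
        unfolding XY Times_Int_Times[symmetric] by (auto simp: sets_restrict_space)
    qed
  qed
  fix X Y assume X: "X \<in> sets (restrict_space lborel A)" and Y: "Y \<in> sets (restrict_space lborel B)"
  have X': "X \<in> sets lborel" "X \<subseteq> A" and Y': "Y \<in> sets lborel" "Y \<subseteq> B"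
    using X Y by (auto simp: sets_restrict_space)
  have "emeasure (restrict_space lborel (A \<times> B)) (X \<times> Y) = emeasure (lborel \<Otimes>\<^sub>M lborel) (X \<times> Y)"
    unfolding lborel_prod using X' Y' AB by (subst emeasure_restrict_space) auto
  also have "\<dots> = emeasure lborel X * emeasure lborel Y"
    using X' Y' by (subst lborel.emeasure_pair_measure_Times) auto
  also have "\<dots> = emeasure (restrict_space lborel A) X * emeasure (restrict_space lborel B) Y"
    using X' Y' A B by (simp add: emeasure_restrict_space)
  finally show "emeasure (restrict_space lborel A) X * emeasure (restrict_space lborel B) Y
      = emeasure (restrict_space lborel (A \<times> B)) (X \<times> Y)"
    by simp
qed

lemma cell_eq_pair: "restrict_space lborel Omega \<Otimes>\<^sub>M angle = cell"
  using Omega_sets unfolding angle_def cell_def Upsilon_def by (intro restrict_lborel_Times) auto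

interpretation Om_angle: pair_sigma_finite "restrict_space lborel Omega" angle
  by standard

text \<open>Two integrals coexist: the Lebesgue integral over \<open>cell\<close> for measurable
  functions, and the gauge integral over the closed box, where the fundamental theorem of calculus
  and differentiation under the integral are at hand. The faces of the box are null sets, so both
  agree on continuous functions.\<close>

lemma
  fixes f :: "point \<Rightarrow> real"
  assumes "continuous_on UNIV f"
  shows integrable_cell_continuous: "integrable cell f"
    and integral_cell_continuous: "(LINT \<xi>|cell. f \<xi>) = integral period_box f"
proof -
  have "f absolutely_integrable_on period_box"
    by (rule absolutely_integrable_continuous) (rule continuous_on_subset[OF assms], simp)
  then have *: "f absolutely_integrable_on Upsilon"
    by (rule set_integrable_subset) (simp_all add: Upsilon_eq_box box_subset_cbox)
  have m: "f \<in> borel_measurable borel"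
    using assms by (rule borel_measurable_continuous_onI)
  have si: "set_integrable lborel Upsilon f"
    using * unfolding set_integrable_def
    by (subst (asm) integrable_completion) (use m in \<open>auto intro!: borel_measurable_scaleR borel_measurable_indicator\<close>)
  then show "integrable cell f"
    by (simp add: set_integrable_Upsilon)
  have "(LINT \<xi>|cell. f \<xi>) = integral Upsilon f"
    unfolding set_integral_Upsilon[symmetric]
    by (rule set_borel_integral_eq_integral(2)[OF si])
  then show "(LINT \<xi>|cell. f \<xi>) = integral period_box f"
    unfolding Upsilon_eq_box integral_open_interval .
qed

lemma integral_period_deriv:
  fixes h dh :: "real \<Rightarrow> real"
  assumes "\<And>s. (h has_real_derivative dh s) (at s)" "h (2 * pi) = h 0"
  shows "integral (cbox 0 (2 * pi)) dh = 0"
proof -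
  have "(dh has_integral h (2 * pi) - h 0) {0..2 * pi}"
    by (rule fundamental_theorem_of_calculus)
      (simp_all add: has_vector_derivative_at_within assms(1)[unfolded has_real_derivative_iff_has_vector_derivative])
  then show ?thesis
    using assms(2) by (simp add: cbox_interval integral_unique)
qed

text \<open>Fubini lets the integral along \<open>i\<close> come first, and over a full period it
  telescopes to zero. Applied to a product \<open>g\<close>, this is integration by parts on the
  torus, without boundary terms.\<close>

lemma integral_cell_periodic_deriv:
  fixes g dg :: "point \<Rightarrow> real"
  assumes i: "i \<in> Basis"
    and der: "\<And>\<xi>. ((\<lambda>s. g (\<xi> + s *\<^sub>R i)) has_real_derivative dg \<xi>) (at 0)"
    and cont: "continuous_on UNIV dg"
    and per: "\<And>\<xi>. g (\<xi> + (2 * pi) *\<^sub>R i) = g \<xi>"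
  shows "(LINT \<xi>|cell. dg \<xi>) = 0"
proof -
  have line: "((\<lambda>s. g (\<xi> + s *\<^sub>R i)) has_real_derivative dg (\<xi> + s *\<^sub>R i)) (at s)" for \<xi> s
    using DERIV_shift[of "\<lambda>s. g (\<xi> + s *\<^sub>R i)" "dg (\<xi> + s *\<^sub>R i)" 0 s] der[of "\<xi> + s *\<^sub>R i"]
    by (simp add: algebra_simps)
  have zero: "integral (cbox 0 (2 * pi)) (\<lambda>s. dg (\<xi> + s *\<^sub>R i)) = 0" for \<xi>
    by (rule integral_period_deriv[OF line]) (simp add: per)
  have c: "continuous_on S (\<lambda>z. dg (k z))" if "continuous_on S k" for S :: "'b::topological_space set" and k
    by (rule continuous_on_compose2[OF cont that]) simp
  have three: "integral period_box dg = integral (cbox (0,0) (2*pi,2*pi)) (\<lambda>x. integral (cbox 0 (2*pi)) (\<lambda>\<theta>. dg (x, \<theta>)))"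
    by (rule integral_prod_continuous) (rule continuous_on_subset[OF cont], simp)
  have swap: "integral (cbox (0,0) (2*pi,2*pi)) (\<lambda>x. integral (cbox 0 (2*pi)) (\<lambda>\<theta>. dg (x, \<theta>)))
     = integral (cbox 0 (2*pi)) (\<lambda>\<theta>. integral (cbox (0,0) (2*pi,2*pi)) (\<lambda>x. dg (x, \<theta>)))"
    by (rule integral_swap_continuous[of "(0,0)" 0 "(2*pi,2*pi)" "2*pi" "\<lambda>x \<theta>. dg (x, \<theta>)"])
      (auto simp: case_prod_beta intro!: c continuous_intros)
  have two: "integral (cbox (0,0) (2*pi,2*pi)) (\<lambda>x. dg (x, \<theta>))
     = integral (cbox 0 (2*pi)) (\<lambda>a. integral (cbox 0 (2*pi)) (\<lambda>b. dg ((a, b), \<theta>)))" for \<theta>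
    by (rule integral_prod_continuous) (intro c continuous_intros)
  have swap2: "integral (cbox 0 (2*pi)) (\<lambda>a. integral (cbox 0 (2*pi)) (\<lambda>b. dg ((a, b), \<theta>)))
     = integral (cbox 0 (2*pi)) (\<lambda>b. integral (cbox 0 (2*pi)) (\<lambda>a. dg ((a, b), \<theta>)))" for \<theta>
    by (rule integral_swap_continuous[of 0 0 "2*pi" "2*pi" "\<lambda>a b. dg ((a, b), \<theta>)"])
      (auto simp: case_prod_beta intro!: c continuous_intros)
  consider "i = ((1, 0), 0)" | "i = ((0, 1), 0)" | "i = ((0, 0), 1)"
    using i by (auto simp: Basis_prod_def zero_prod_def)
  then have "integral period_box dg = 0"
  proof cases
    case 1
    then show ?thesis unfolding three swap two swap2
      using zero[of "((0, _), _)"] by simp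
  next
    case 2
    then show ?thesis unfolding three swap two
      using zero[of "((_, 0), _)"] by simp
  next
    case 3
    then show ?thesis unfolding three
      using zero[of "(_, 0)"] by (simp add: zero_prod_def[symmetric])
  qed
  then show ?thesis by (simp add: integral_cell_continuous[OF cont])
qed

section \<open>Trigonometric test functions on the torus\<close>

definition lattice :: "point set" where
  "lattice = {m. \<forall>i\<in>Basis. m \<bullet> i \<in> \<int>}"

text \<open>Writing - sin as a cosine with phase advanced by pi/2 keeps the family
  \<open>c * cos (m \<bullet> \<xi> + a)\<close> closed under differentiation, so that smoothness is
  a single induction over all \<open>c\<close> and \<open>a\<close>. Sines belong to the family
  through the phase - pi/2.\<close>

lemma has_derivative_cos_inner:
  "((\<lambda>\<xi>. c * cos (m \<bullet> \<xi> + a)) has_derivative (\<lambda>h. c * (m \<bullet> h) * cos (m \<bullet> \<xi> + (a + pi / 2)))) (at \<xi>)"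
  for m :: "'a::euclidean_space"
proof -
  have "- sin (m \<bullet> \<xi> + a) = cos (m \<bullet> \<xi> + (a + pi / 2))"
    by (simp add: cos_add sin_add)
  then show ?thesis
    by (auto intro!: derivative_eq_intros simp: fun_eq_iff)
qed

lemma partial_deriv_cos_inner:
  "partial_deriv i (\<lambda>\<xi>. c * cos (m \<bullet> \<xi> + a)) = (\<lambda>\<xi>. c * (m \<bullet> i) * cos (m \<bullet> \<xi> + (a + pi / 2)))"
  for m :: "'a::euclidean_space"
  unfolding partial_deriv_def frechet_derivative_at[OF has_derivative_cos_inner, symmetric] ..

lemma times_cont_diff_cos_inner: "times_cont_diff k (\<lambda>\<xi>. c * cos (m \<bullet> \<xi> + a))"
  for m :: "'a::euclidean_space"
proof (induction k arbitrary: c a)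
  case 0
  then show ?case by (auto intro!: continuous_intros)
next
  case (Suc k)
  have "(\<lambda>\<xi>. c * cos (m \<bullet> \<xi> + a)) differentiable (at x)" for x
    unfolding differentiable_def using has_derivative_cos_inner by blast
  then show ?case
    using Suc by (simp add: partial_deriv_cos_inner)
qed

lemma cos_int_shift: "k \<in> \<int> \<Longrightarrow> cos (x + 2 * pi * k) = cos x"
  by (auto elim!: Ints_cases simp: cos_add mult.assoc[symmetric])

lemma cos_inner_periodic:
  "m \<in> lattice \<Longrightarrow> i \<in> Basis \<Longrightarrow> cos (m \<bullet> (\<xi> + (2 * pi) *\<^sub>R i) + a) = cos (m \<bullet> \<xi> + a)"
  using cos_int_shift[of "m \<bullet> i" "m \<bullet> \<xi> + a"]
  by (simp add: lattice_def inner_add_right algebra_simps)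

lemma cos_inner_smooth_per: "m \<in> lattice \<Longrightarrow> (\<lambda>\<xi>. c * cos (m \<bullet> \<xi> + a)) \<in> smooth_per"
  unfolding smooth_per_def smooth_def
  using times_cont_diff_cos_inner cos_inner_periodic by fastforce

lemma smooth_per_partial:
  assumes "\<psi> \<in> smooth_per" "i \<in> Basis"
  shows "continuous_on UNIV (partial_deriv i \<psi>)" "continuous_on UNIV \<psi>"
    and "((\<lambda>s. \<psi> (\<xi> + s *\<^sub>R i)) has_real_derivative partial_deriv i \<psi> \<xi>) (at 0)"
proof -
  have s: "times_cont_diff (Suc 0) \<psi>" "times_cont_diff 0 \<psi>"
    using assms unfolding smooth_per_def smooth_def by blast+
  then show "continuous_on UNIV (partial_deriv i \<psi>)" "continuous_on UNIV \<psi>"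
    using assms(2) by auto
  have df: "\<psi> differentiable (at \<xi>)"
    using s(1) unfolding times_cont_diff.simps by blast
  then have d: "(\<psi> has_derivative frechet_derivative \<psi> (at \<xi>)) (at (\<xi> + 0 *\<^sub>R i))"
    by (simp add: frechet_derivative_works)
  have "((\<lambda>s. \<psi> (\<xi> + s *\<^sub>R i)) has_derivative (\<lambda>s. frechet_derivative \<psi> (at \<xi>) (s *\<^sub>R i))) (at 0)"
    by (rule has_derivative_compose[where f = "\<lambda>s. \<xi> + s *\<^sub>R i" and g = \<psi>, OF _ d]) (auto intro!: derivative_eq_intros)
  moreover have "frechet_derivative \<psi> (at \<xi>) (s *\<^sub>R i) = partial_deriv i \<psi> \<xi> * s" for s
    using linear_frechet_derivative[OF df]
    by (simp add: partial_deriv_def linear_cmul)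
  ultimately show "((\<lambda>s. \<psi> (\<xi> + s *\<^sub>R i)) has_real_derivative partial_deriv i \<psi> \<xi>) (at 0)"
    by (simp add: has_field_derivative_def)
qed

lemma bounded_L2_per:
  fixes u :: "point \<Rightarrow> 'b::euclidean_space"
  assumes "continuous_on UNIV u" "\<And>i \<xi>. i \<in> Basis \<Longrightarrow> u (\<xi> + (2 * pi) *\<^sub>R i) = u \<xi>"
  shows "u \<in> L2_per"
proof -
  have "integrable cell (\<lambda>\<xi>. (norm (u \<xi>))\<^sup>2)"
    by (rule integrable_cell_continuous) (intro continuous_intros assms)
  then show ?thesis
    using assms by (auto simp: L2_per_def periodic_ae_def set_integrable_Upsilon
        intro!: borel_measurable_continuous_onI)
qed

text \<open>The product of the cosine with a test function is smooth and periodic, so the integral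
  of its derivative vanishes; this is the defining identity of the weak gradient.\<close>

lemma H1_grad_cos_inner:
  assumes m: "m \<in> lattice"
  shows "H1_grad (\<lambda>\<xi>. c * cos (m \<bullet> \<xi> + a)) (\<lambda>\<xi>. (- c * sin (m \<bullet> \<xi> + a)) *\<^sub>R m)"
proof -
  let ?v = "\<lambda>\<xi>. c * cos (m \<bullet> \<xi> + a)"
  have s: "- sin (m \<bullet> \<xi> + a) = cos (m \<bullet> \<xi> + (a + pi / 2))" for \<xi>
    by (simp add: cos_add sin_add)
  have "(LINT \<xi>|cell. ?v \<xi> * partial_deriv i \<psi> \<xi>)
      = - (LINT \<xi>|cell. (((- c * sin (m \<bullet> \<xi> + a)) *\<^sub>R m) \<bullet> i) * \<psi> \<xi>)"
    if \<psi>: "\<psi> \<in> smooth_per" and i: "i \<in> Basis" for \<psi> i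
  proof -
    note sp = smooth_per_partial[OF \<psi> i]
    note vp = smooth_per_partial[OF cos_inner_smooth_per[OF m, of c a] i]
    have pd: "partial_deriv i ?v \<xi> = ((- c * sin (m \<bullet> \<xi> + a)) *\<^sub>R m) \<bullet> i" for \<xi>
      unfolding partial_deriv_cos_inner s[symmetric] by simp
    have "(LINT \<xi>|cell. ?v \<xi> * partial_deriv i \<psi> \<xi> + partial_deriv i ?v \<xi> * \<psi> \<xi>) = 0"
    proof (rule integral_cell_periodic_deriv[OF i, where g = "\<lambda>\<xi>. ?v \<xi> * \<psi> \<xi>"])
      show "((\<lambda>s. ?v (\<xi> + s *\<^sub>R i) * \<psi> (\<xi> + s *\<^sub>R i)) has_real_derivative
          ?v \<xi> * partial_deriv i \<psi> \<xi> + partial_deriv i ?v \<xi> * \<psi> \<xi>) (at 0)" for \<xi>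
        using DERIV_mult[OF vp(3) sp(3), of \<xi>] by (simp add: algebra_simps)
      show "continuous_on UNIV (\<lambda>\<xi>. ?v \<xi> * partial_deriv i \<psi> \<xi> + partial_deriv i ?v \<xi> * \<psi> \<xi>)"
        by (intro continuous_intros sp vp)
      show "?v (\<xi> + (2 * pi) *\<^sub>R i) * \<psi> (\<xi> + (2 * pi) *\<^sub>R i) = ?v \<xi> * \<psi> \<xi>" for \<xi>
      proof -
        have "\<psi> (\<xi> + (2 * pi) *\<^sub>R i) = \<psi> \<xi>"
          using \<psi> i unfolding smooth_per_def by blast
        then show ?thesis by (simp only: cos_inner_periodic[OF m i])
      qed
    qed
    moreover have "integrable cell (\<lambda>\<xi>. ?v \<xi> * partial_deriv i \<psi> \<xi>)"
      "integrable cell (\<lambda>\<xi>. partial_deriv i ?v \<xi> * \<psi> \<xi>)"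
      by (intro integrable_cell_continuous continuous_intros sp vp)+
    ultimately show ?thesis
      unfolding pd by simp
  qed
  moreover have "?v \<in> L2_per"
    using cos_inner_periodic[OF m] by (intro bounded_L2_per continuous_intros) auto
  moreover have "(\<lambda>\<xi>. (- c * sin (m \<bullet> \<xi> + a)) *\<^sub>R m) \<in> L2_per"
    using cos_inner_periodic[OF m, of _ _ "a + pi / 2"]
    by (intro bounded_L2_per continuous_intros) (auto simp: s[symmetric] simp del: scaleR_minus_left)
  ultimately show ?thesis
    unfolding H1_grad_def set_integral_Upsilon by simp
qed

section \<open>Functions of time with a weak derivative\<close>

text \<open>Used with towers of derivatives obtained by recursion, so that no closed form of the
  k-th derivative has to be found.\<close>

lemma smooth_realI:
  fixes g :: "nat \<Rightarrow> real \<Rightarrow> real"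
  assumes "\<And>k x. (g k has_real_derivative g (Suc k) x) (at x)"
  shows "smooth (g 0)"
proof -
  have pd: "partial_deriv 1 (g n) = g (Suc n)" for n
    unfolding partial_deriv_def
  proof
    show "frechet_derivative (g n) (at x) 1 = g (Suc n) x" for x
      using frechet_derivative_at[OF assms[of n x, unfolded has_field_derivative_def], symmetric] by simp
  qed
  have "times_cont_diff k (g n)" for k n
  proof (induction k arbitrary: n)
    case 0
    then show ?case
      using assms by (auto intro!: continuous_at_imp_continuous_on DERIV_isCont)
  next
    case (Suc k)
    then show ?case
      using assms[of n] by (auto simp: pd has_field_derivative_def differentiable_def)
  qed
  then show ?thesis by (simp add: smooth_def)
qed

lemma smooth_real_deriv:
  fixes \<psi> :: "real \<Rightarrow> real"
  assumes "smooth \<psi>"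
  shows "(\<psi> has_real_derivative deriv \<psi> x) (at x)" "continuous_on UNIV (deriv \<psi>)"
proof -
  have t: "times_cont_diff (Suc 0) \<psi>"
    using assms unfolding smooth_def by blast
  then show d: "(\<psi> has_real_derivative deriv \<psi> x) (at x)" for x
    by (simp add: DERIV_deriv_iff_real_differentiable)
  have "partial_deriv 1 \<psi> = deriv \<psi>"
    unfolding partial_deriv_def
  proof
    show "frechet_derivative \<psi> (at x) 1 = deriv \<psi> x" for x
      using frechet_derivative_at[OF d[of x, unfolded has_field_derivative_def], symmetric] by simp
  qed
  with t show "continuous_on UNIV (deriv \<psi>)" by simp
qed

text \<open>Every derivative of \<open>exp (- 1 / (x (1 - x)))\<close> on the unit interval has this form.\<close>

definition hump :: "real poly \<Rightarrow> nat \<Rightarrow> real \<Rightarrow> real" where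
  "hump P m x = (if 0 < x \<and> x < 1 then poly P x / (x * (1 - x)) ^ m * exp (- 1 / (x * (1 - x))) else 0)"

text \<open>A single term of the exponential series for exp(1/y) already dominates any chosen power
  of 1/y.\<close>

lemma exp_inverse_le: "exp (- 1 / y) \<le> fact N * y ^ N" if "0 < y" for y :: real
proof -
  have "sum (\<lambda>n. (1 / y) ^ n /\<^sub>R fact n) {N} \<le> exp (1 / y)"
    unfolding exp_def using that by (intro sum_le_suminf summable_exp_generic) auto
  then have "(1 / y) ^ N / fact N \<le> exp (1 / y)"
    by (simp add: divide_inverse mult.commute)
  then have "exp (- (1 / y)) \<le> inverse ((1 / y) ^ N / fact N)"
    unfolding exp_minus using that by (intro le_imp_inverse_le) auto
  then show ?thesis
    by (simp add: field_simps)
qed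

text \<open>Quadratic decay at 0 and 1 is what makes the derivative vanish at these junctions of the
  piecewise formula, through \<open>DERIV_zero_of_quadratic\<close>.\<close>

lemma hump_le: "\<exists>B. \<forall>x. \<bar>hump P m x\<bar> \<le> (if 0 < x \<and> x < 1 then B * (x * (1 - x))\<^sup>2 else 0)"
proof -
  have "compact (poly P ` {0..1})"
    by (intro compact_continuous_image continuous_intros) auto
  then obtain B where B: "\<And>x. x \<in> {0..1} \<Longrightarrow> \<bar>poly P x\<bar> \<le> B"
    using compact_imp_bounded by (force simp: bounded_iff)
  have "\<bar>hump P m x\<bar> \<le> (B * fact (m + 2)) * (x * (1 - x))\<^sup>2" if x: "0 < x" "x < 1" for x
  proof -
    define y where "y = x * (1 - x)"
    have y: "0 < y" using x by (simp add: y_def)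
    have "\<bar>hump P m x\<bar> = \<bar>poly P x\<bar> * (exp (- 1 / y) / y ^ m)"
      using x y by (simp add: hump_def y_def[symmetric] abs_mult)
    \<comment> \<open>Of the \<open>m + 2\<close> powers of \<open>y\<close>, \<open>m\<close>
      cancel the denominator and two remain for the square.\<close>
    also have "\<dots> \<le> B * (fact (m + 2) * y ^ (m + 2) / y ^ m)"
      using x y B[of x] by (intro mult_mono divide_right_mono exp_inverse_le) auto
    also have "\<dots> = (B * fact (m + 2)) * y\<^sup>2"
      using y by (simp add: power_add power2_eq_square)
    finally show ?thesis by (simp add: y_def)
  qed
  then show ?thesis by (intro exI[of _ "B * fact (m + 2)"]) (auto simp: hump_def)
qed

text \<open>The difference quotient is at most B |x - a|. This settles the junctions of piecewise
  definitions, those of \<open>hump\<close> and of \<open>penalty\<close> alike.\<close>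

lemma DERIV_zero_of_quadratic:
  fixes g :: "real \<Rightarrow> real"
  assumes "\<And>x. \<bar>g x - g a\<bar> \<le> B * (x - a)\<^sup>2"
  shows "(g has_real_derivative 0) (at a)"
proof -
  have "((\<lambda>x. (g x - g a) / (x - a)) \<longlongrightarrow> 0) (at a)"
  proof (rule Lim_null_comparison)
    show "\<forall>\<^sub>F x in at a. norm ((g x - g a) / (x - a)) \<le> B * \<bar>x - a\<bar>"
    proof (rule eventually_mono[OF eventually_neq_at_within[of a]])
      fix x assume "x \<noteq> a"
      moreover have "(x - a)\<^sup>2 = \<bar>x - a\<bar> * \<bar>x - a\<bar>"
        by (simp add: power2_eq_square)
      ultimately show "norm ((g x - g a) / (x - a)) \<le> B * \<bar>x - a\<bar>"
        using assms[of x] by (simp add: abs_divide pos_divide_le_eq mult.assoc)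
    qed
    show "((\<lambda>x. B * \<bar>x - a\<bar>) \<longlongrightarrow> 0) (at a)"
      by (auto intro!: tendsto_eq_intros)
  qed
  then show ?thesis by (simp add: has_field_derivative_iff)
qed

text \<open>With y = x (1 - x) and y' = 1 - 2x, the derivative of P y^(-m) exp(-1/y) is (P' y^2 - m
  P y' y + P y') y^(-m-2) exp(-1/y), again of the same form. The coefficient lists
  \<open>[:0, 1, -1:]\<close> and \<open>[:1, -2:]\<close> are y and y'.\<close>

lemma hump_deriv:
  "(hump P m has_real_derivative
     hump (pderiv P * [:0, 1, -1:]\<^sup>2 - of_nat m * P * [:1, -2:] * [:0, 1, -1:] + P * [:1, -2:]) (m + 2) x) (at x)"
  (is "(_ has_real_derivative hump ?Q _ _) _")
proof (cases "0 < x \<and> x < 1")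
  case True
  define y where "y = x * (1 - x)"
  have y: "0 < y" using True by (simp add: y_def)
  have yd: "((\<lambda>z. z * (1 - z)) has_real_derivative (1 - 2 * x)) (at x)"
    by (auto intro!: derivative_eq_intros)
  define u where "u z = inverse z ^ m * exp (- inverse z)" for z :: real
  have "(u has_real_derivative of_nat m * inverse y ^ (m - 1) * (- (inverse y ^ 2)) * exp (- inverse y)
     + inverse y ^ m * (exp (- inverse y) * inverse y ^ 2)) (at (x * (1 - x)))"
    unfolding u_def y_def[symmetric] using y
    by (auto intro!: derivative_eq_intros simp: power2_eq_square algebra_simps)
  from DERIV_mult[OF poly_DERIV[of P x] DERIV_chain2[OF this yd]]
  have "((\<lambda>z. poly P z * u (z * (1 - z))) has_real_derivative
     poly (pderiv P) x * (inverse y ^ m * exp (- inverse y))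
     + poly P x * (of_nat m * inverse y ^ (m - 1) * (- (1 - 2 * x) * inverse y ^ 2) * exp (- inverse y)
     + inverse y ^ m * (exp (- inverse y) * ((1 - 2 * x) * inverse y ^ 2)))) (at x)"
    by (rule DERIV_cong) (simp add: u_def y_def algebra_simps)
  moreover have "poly (pderiv P) x * (inverse y ^ m * exp (- inverse y))
     + poly P x * (of_nat m * inverse y ^ (m - 1) * (- (1 - 2 * x) * inverse y ^ 2) * exp (- inverse y)
     + inverse y ^ m * (exp (- inverse y) * ((1 - 2 * x) * inverse y ^ 2)))
     = hump ?Q (m + 2) x"
  proof -
    have "hump ?Q (m + 2) x = (poly (pderiv P) x * y\<^sup>2 - of_nat m * poly P x * (1 - 2 * x) * y + poly P x * (1 - 2 * x))
        * inverse y ^ (m + 2) * exp (- inverse y)"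
    proof -
      have py: "poly [:0, 1, -1:] x = y" "poly [:1, -2:] x = 1 - 2 * x"
        by (simp_all add: y_def algebra_simps)
      have "poly ?Q x = poly (pderiv P) x * y\<^sup>2 - of_nat m * poly P x * (1 - 2 * x) * y + poly P x * (1 - 2 * x)"
        by (simp only: poly_add poly_diff poly_mult poly_power poly_of_nat py)
      then show ?thesis
        using True unfolding hump_def y_def[symmetric] by (simp add: divide_inverse power_inverse)
    qed
    also have "\<dots> = poly (pderiv P) x * (inverse y ^ m * exp (- inverse y))
     + poly P x * (of_nat m * inverse y ^ (m - 1) * (- (1 - 2 * x) * inverse y ^ 2) * exp (- inverse y)
     + inverse y ^ m * (exp (- inverse y) * ((1 - 2 * x) * inverse y ^ 2)))"
    proof -
      define I where "I = inverse y ^ (m + 2)"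
      \<comment> \<open>For \<open>m = 0\<close> the exponent \<open>m - 1\<close> is truncated to
        0, which is harmless because of the factor \<open>of_nat m\<close>.\<close>
      have I1: "of_nat m * y * I = of_nat m * inverse y ^ (m - 1) * inverse y ^ 2"
        unfolding I_def using y by (cases m) (simp_all add: power2_eq_square)
      have I2: "y\<^sup>2 * I = inverse y ^ m"
        unfolding I_def using y by (simp add: power_add power2_eq_square field_simps)
      have I3: "I = inverse y ^ m * inverse y ^ 2"
        unfolding I_def by (rule power_add)
      have "(A * y\<^sup>2 - of_nat m * p * d * y + p * d) * I * e
          = A * (y\<^sup>2 * I) * e - p * d * (of_nat m * y * I) * e + p * d * I * e" for A p d e :: real
        by (simp add: algebra_simps)
      then show ?thesis
        unfolding I_def[symmetric] by (simp only: I1 I2) (simp add: I3 algebra_simps)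
    qed
    finally show ?thesis by simp
  qed
  moreover have "\<forall>\<^sub>F z in nhds x. hump P m z = poly P z * u (z * (1 - z))"
  proof (rule eventually_mono[OF eventually_nhds_in_open[of "{0<..<1}" x]])
    fix z :: real assume z: "z \<in> {0<..<1}"
    have "- 1 / (z * (1 - z)) = - inverse (z * (1 - z))"
      by (simp add: divide_inverse)
    with z show "hump P m z = poly P z * u (z * (1 - z))"
      unfolding hump_def u_def by (simp add: divide_inverse flip: power_inverse inverse_mult_distrib)
  qed (use True in auto)
  ultimately show ?thesis
    by (subst DERIV_cong_ev[OF refl _ refl]) auto
next
  case False
  obtain B where B: "\<And>z. \<bar>hump P m z\<bar> \<le> (if 0 < z \<and> z < 1 then B * (z * (1 - z))\<^sup>2 else 0)"
    using hump_le by blast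
  \<comment> \<open>The bound at the midpoint forces \<open>B\<close> to be non-negative.\<close>
  have "B * (1 / 4)\<^sup>2 \<ge> 0" using B[of "1/2"] by (simp add: power2_eq_square)
  then have B0: "0 \<le> B" by (simp add: zero_le_mult_iff)
  have "\<bar>hump P m z - hump P m x\<bar> \<le> B * (z - x)\<^sup>2" for z
  proof -
    have "(z * (1 - z))\<^sup>2 \<le> (z - x)\<^sup>2" if z: "0 < z" "z < 1"
    proof -
      consider "x \<le> 0" | "1 \<le> x" using False by linarith
      then have "z * (1 - z) \<le> \<bar>z - x\<bar>"
      proof cases
        case 1
        have "z * (1 - z) \<le> z * 1" using z by (intro mult_left_mono) auto
        then show ?thesis using 1 by simp
      next
        case 2
        have "z * (1 - z) \<le> 1 * (1 - z)" using z by (intro mult_right_mono) auto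
        then show ?thesis using 2 by simp
      qed
      from power_mono[OF this, of 2] show ?thesis using z by simp
    qed
    then have "B * (z * (1 - z))\<^sup>2 \<le> B * (z - x)\<^sup>2" if "0 < z" "z < 1"
      using that B0 by (intro mult_left_mono) auto
    moreover have "hump P m x = 0" using False by (auto simp: hump_def)
    ultimately show ?thesis
      using B[of z] B0 by (cases "0 < z \<and> z < 1") auto
  qed
  then have "(hump P m has_real_derivative 0) (at x)"
    by (rule DERIV_zero_of_quadratic)
  moreover have "hump Q M x = 0" for Q M using False by (auto simp: hump_def)
  ultimately show ?thesis by simp
qed

lemma hump_tower:
  "\<exists>g. g 0 = hump P m \<and> (\<forall>k x. (g k has_real_derivative g (Suc k) x) (at x))"
proof -
  define st where "st = (\<lambda>(P, m :: nat). (pderiv P * [:0, 1, -1:]\<^sup>2 - of_nat m * P * [:1, -2:] * [:0, 1, -1:] + P * [:1, -2:] :: real poly, m + 2))"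
  define g where "g k = case_prod hump ((st ^^ k) (P, m))" for k
  have "(g k has_real_derivative g (Suc k) x) (at x)" for k x
    using hump_deriv by (simp add: g_def st_def case_prod_beta)
  then show ?thesis by (intro exI[of _ g]) (auto simp: g_def)
qed

text \<open>\<open>S 0\<close> is a primitive of the bump \<open>hump 1 0\<close>, hence constant on
  either side of the unit interval and increasing inside. The whole tower of derivatives is
  returned, so that shifted and rescaled copies are smooth by \<open>smooth_realI\<close>.\<close>

lemma smooth_step:
  "\<exists>S :: nat \<Rightarrow> real \<Rightarrow> real. (\<forall>k x. (S k has_real_derivative S (Suc k) x) (at x)) \<and>
    (\<forall>x. 0 \<le> S 1 x) \<and> (\<forall>x. 0 < x \<longrightarrow> x < 1 \<longrightarrow> 0 < S 1 x) \<and> (\<forall>x. x \<le> 0 \<or> 1 \<le> x \<longrightarrow> S 1 x = 0)"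
proof -
  obtain g where g: "g 0 = hump 1 0" "\<And>k x. (g k has_real_derivative g (Suc k) x) (at x)"
    using hump_tower by blast
  have "\<exists>F. \<forall>x. - \<infinity> < ereal x \<longrightarrow> ereal x < \<infinity> \<longrightarrow> (F has_vector_derivative hump 1 0 x) (at x)"
    by (rule einterval_antiderivative) (use g(2)[of 0] g(1) in \<open>auto intro!: DERIV_isCont\<close>)
  then obtain F where F: "\<And>x. (F has_real_derivative hump 1 0 x) (at x)"
    by (auto simp: has_real_derivative_iff_has_vector_derivative)
  define S where "S k = (case k of 0 \<Rightarrow> F | Suc j \<Rightarrow> g j)" for k
  have "(S k has_real_derivative S (Suc k) x) (at x)" for k x
    using F g by (cases k) (auto simp: S_def)
  then show ?thesis
    by (intro exI[of _ S]) (auto simp: S_def g(1) hump_def)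
qed

section \<open>From the distributional to the classical time derivative\<close>

lemma LINT_lebesgue_on_open_interval:
  fixes f :: "real \<Rightarrow> real"
  assumes "continuous_on {0..T} f"
  shows "(LINT t|lebesgue_on {0<..<T}. f t) = integral {0..T} f"
proof -
  have "f absolutely_integrable_on {0..T}"
    by (rule absolutely_integrable_continuous_real[OF assms])
  then have "f absolutely_integrable_on {0<..<T}"
    by (rule set_integrable_subset) auto
  then have "integrable (lebesgue_on {0<..<T}) f"
    by (simp add: integrable_restrict_space set_integrable_def)
  then have "(LINT t|lebesgue_on {0<..<T}. f t) = integral {0<..<T} f"
    by (intro lebesgue_integral_eq_integral) auto
  then show ?thesis
    by (simp add: integral_open_interval_real)
qed

text \<open>Suppose w(a) < m < w(b). A test function that rises just to the right of
  \<open>a\<close>, where w < m, and falls just to the right of \<open>b\<close>, where m < w, would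
  make the integral of its derivative times m - w positive, although both terms integrate to zero.
  One inequality suffices: applied to \<open>w\<close> and to - \<open>w\<close> it makes
  \<open>w\<close> constant.\<close>

lemma du_Bois_Reymond:
  fixes w :: "real \<Rightarrow> real"
  assumes w: "continuous_on {0..T} w"
    and orth: "\<And>\<psi>. \<psi> \<in> smooth_cpt {0<..<T} \<Longrightarrow> integral {0..T} (\<lambda>t. deriv \<psi> t * w t) = 0"
    and a: "0 < a" "a < b" "b < T"
  shows "w b \<le> w a"
proof (rule ccontr)
  assume "\<not> w b \<le> w a"
  then obtain m where m: "w a < m" "m < w b" by (meson dense not_le)
  have cont: "isCont w t" if "0 < t" "t < T" for t
    using w that by (intro continuous_on_interior[of "{0..T}"]) auto
  have "\<forall>\<^sub>F t in at_right a. w t < m" "\<forall>\<^sub>F t in at_right b. m < w t"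
    using m cont[of a] cont[of b] a
    by (auto simp: isCont_def intro: order_tendstoD[OF tendsto_within_subset[of w _ _ UNIV]])
  then obtain a' b' where a': "a < a'" "\<And>t. a < t \<Longrightarrow> t < a' \<Longrightarrow> w t < m"
    and b': "b < b'" "\<And>t. b < t \<Longrightarrow> t < b' \<Longrightarrow> m < w t"
    unfolding eventually_at_right_field by blast
  \<comment> \<open>The halving makes every inequality strict: the two transition zones of width
    \<open>e\<close> are disjoint, lie inside the interval and stay where \<open>w\<close> is on the
    right side of \<open>m\<close>.\<close>
  define e where "e = min (min (a' - a) (b' - b)) (min (b - a) (T - b)) / 2"
  have "0 < e" unfolding e_def using a a' b' by simp
  moreover have "e \<le> (a' - a) / 2" "e \<le> (b' - b) / 2" "e \<le> (b - a) / 2" "e \<le> (T - b) / 2"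
    unfolding e_def by (simp_all add: min_le_iff_disj)
  ultimately have e: "0 < e" "a + e < a'" "b + e < b'" "a + e < b" "b + e < T"
    by simp_all
  obtain S :: "nat \<Rightarrow> real \<Rightarrow> real" where
    SS: "(\<forall>k x. (S k has_real_derivative S (Suc k) x) (at x)) \<and>
    (\<forall>x. 0 \<le> S 1 x) \<and> (\<forall>x. 0 < x \<longrightarrow> x < 1 \<longrightarrow> 0 < S 1 x) \<and> (\<forall>x. x \<le> 0 \<or> 1 \<le> x \<longrightarrow> S 1 x = 0)"
    by (rule exE[OF smooth_step])
  have S: "(S k has_real_derivative S (Suc k) x) (at x)" "0 \<le> S 1 x"
    "0 < x \<Longrightarrow> x < 1 \<Longrightarrow> 0 < S 1 x" "x \<le> 0 \<or> 1 \<le> x \<Longrightarrow> S 1 x = 0" for k x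
    using SS by blast+
  \<comment> \<open>A plateau that rises where \<open>w < m\<close> and falls where \<open>m < w\<close>.\<close>
  define g where "g k t = S k ((t - a) / e) / e ^ k - S k ((t - b) / e) / e ^ k" for k t
  have g: "(g k has_real_derivative g (Suc k) t) (at t)" for k t
    unfolding g_def using e
    by (auto intro!: derivative_eq_intros DERIV_chain2[OF S(1)] simp: field_simps)
  have S0_cont: "continuous_on A (S 0)" for A
    using S(1)[of 0] by (blast intro: continuous_at_imp_continuous_on DERIV_isCont)
  have S0_deriv: "(S 0 has_real_derivative 0) (at x)" if "x \<le> 0 \<or> 1 \<le> x" for x
    using S(1)[of 0 x] S(4)[OF that] by simp
  have Sl: "S 0 x = S 0 0" if "x \<le> 0" for x
  proof (cases "x = 0")
    case False
    then show ?thesis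
      using that S0_deriv by (intro DERIV_isconst_end[of x 0 "S 0", symmetric] S0_cont) auto
  qed auto
  have Sr: "S 0 x = S 0 1" if "1 \<le> x" for x
  proof (cases "x = 1")
    case False
    then show ?thesis
      using that S0_deriv by (intro DERIV_isconst_end[of 1 x "S 0"] S0_cont) auto
  qed auto
  have g0: "g 0 t = 0" if "t \<notin> {a..b + e}" for t
  proof (cases "t < a")
    case True
    then show ?thesis
      unfolding g_def using e a by (subst (1 2) Sl) (auto simp: divide_le_0_iff)
  next
    case False
    then show ?thesis
      unfolding g_def using that e a by (subst (1 2) Sr) (auto simp: field_simps)
  qed
  have "smooth (g 0)" by (rule smooth_realI[of g, OF g])
  then have g_cpt: "g 0 \<in> smooth_cpt {0<..<T}"
    unfolding smooth_cpt_def using a e g0 by (auto intro!: exI[of _ "{a..b + e}"])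
  have dg: "deriv (g 0) = g 1"
    using g[of 0] by (auto simp: fun_eq_iff intro: DERIV_imp_deriv)
  have g1_cont: "continuous_on A (g 1)" for A
    using g[of 1] by (auto intro!: continuous_at_imp_continuous_on DERIV_isCont)
  have g1: "g 1 t = S 1 ((t - a) / e) / e - S 1 ((t - b) / e) / e" for t
    by (simp add: g_def)
  have "(g 1 has_integral g 0 T - g 0 0) {0..T}"
    using g[of 0] a by (intro fundamental_theorem_of_calculus)
      (auto intro: has_vector_derivative_at_within simp: has_real_derivative_iff_has_vector_derivative)
  then have int1: "(g 1 has_integral 0) {0..T}"
    using g0[of T] g0[of 0] a e by simp
  have "((\<lambda>t. g 1 t * w t) has_integral 0) {0..T}"
    using orth[OF g_cpt] unfolding dg
    by (subst has_integral_iff) (auto intro!: integrable_continuous_real continuous_intros w g1_cont[unfolded One_nat_def])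
  \<comment> \<open>As \<open>g 1\<close> has integral zero, the level \<open>m\<close> may be
    subtracted from \<open>w\<close> at no cost; the integrand then has a sign.\<close>
  from has_integral_diff[OF has_integral_mult_left[OF int1] this]
  have int: "((\<lambda>t. g 1 t * m - g 1 t * w t) has_integral 0) {0..T}"
    by simp
  have nonneg: "0 \<le> g 1 t * m - g 1 t * w t" for t
  proof -
    consider "a < t" "t < a + e" | "b < t" "t < b + e" | "t \<notin> {a<..<a+e}" "t \<notin> {b<..<b+e}" by force
    then show ?thesis
    proof cases
      case 1
      then have "S 1 ((t - b) / e) = 0" using e by (intro S(4)) (auto simp: divide_le_0_iff)
      then have "0 \<le> g 1 t" unfolding g1 using S(2) e by simp
      then have "0 \<le> g 1 t * (m - w t)" using a'(2)[of t] 1 e by (intro mult_nonneg_nonneg) auto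
      then show ?thesis by (simp add: algebra_simps)
    next
      case 2
      then have "S 1 ((t - a) / e) = 0" using e by (intro S(4)) (auto simp: field_simps)
      then have "g 1 t \<le> 0" unfolding g1 using S(2) e by simp
      then have "0 \<le> g 1 t * (m - w t)" using b'(2)[of t] 2 e by (intro mult_nonpos_nonpos) auto
      then show ?thesis by (simp add: algebra_simps)
    next
      case 3
      then have "S 1 ((t - a) / e) = 0" "S 1 ((t - b) / e) = 0"
        using e by (intro S(4); auto simp: field_simps)+
      then have "g 1 t = 0" unfolding g1 by simp
      then show ?thesis by simp
    qed
  qed
  \<comment> \<open>A continuous non-negative function of integral zero vanishes everywhere, but in
    the middle of the rising zone both \<open>g 1\<close> and \<open>m - w\<close> are
    positive.\<close>
  have "g 1 (a + e / 2) * m - g 1 (a + e / 2) * w (a + e / 2) = 0"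
  proof (rule has_integral_0_cbox_imp_0[of 0 T "\<lambda>t. g 1 t * m - g 1 t * w t"])
    show "continuous_on (cbox 0 T) (\<lambda>t. g 1 t * m - g 1 t * w t)"
      unfolding cbox_interval by (intro continuous_intros w g1_cont)
    show "((\<lambda>t. g 1 t * m - g 1 t * w t) has_integral 0) (cbox 0 T)"
      unfolding cbox_interval by (rule int)
    show "a + e / 2 \<in> cbox 0 T" "box 0 T \<noteq> {}" using a e by auto
  qed (rule nonneg)
  then have "g 1 (a + e / 2) * (m - w (a + e / 2)) = 0"
    by (simp only: right_diff_distrib)
  moreover have "0 < g 1 (a + e / 2)"
  proof -
    have "S 1 ((a + e / 2 - b) / e) = 0" using e by (intro S(4)) (auto simp: divide_le_0_iff)
    moreover have "0 < S 1 (((a + e / 2) - a) / e)" using e by (intro S(3)) auto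
    ultimately show ?thesis unfolding g1 using e by simp
  qed
  ultimately show False
    using a'(2)[of "a + e / 2"] e by simp
qed

text \<open>The difference of \<open>c\<close> and a primitive of \<open>h\<close> has weak
  derivative zero, so it is constant by \<open>du_Bois_Reymond\<close> in both directions. Fourier
  coefficients of a weak solution become classically differentiable in this way.\<close>

lemma weak_deriv_imp_deriv:
  fixes c h :: "real \<Rightarrow> real"
  assumes c: "continuous_on {0..T} c" and h: "continuous_on {0..T} h"
    and weak: "\<And>\<psi>. \<psi> \<in> smooth_cpt {0<..<T} \<Longrightarrow>
      (LINT t|lebesgue_on {0<..<T}. deriv \<psi> t * c t) = - (LINT t|lebesgue_on {0<..<T}. \<psi> t * h t)"
    and t: "0 < t" "t < T"
  shows "(c has_real_derivative h t) (at t)"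
proof -
  define H where "H t = integral {0..t} h" for t
  have H: "(H has_real_derivative h s) (at s within {0..T})" if "s \<in> {0..T}" for s
    unfolding H_def using integral_has_real_derivative[OF h that] .
  have Hc: "continuous_on {0..T} H"
    unfolding continuous_on_eq_continuous_within using DERIV_continuous[OF H] by blast
  have orth: "integral {0..T} (\<lambda>t. deriv \<psi> t * (c t - H t)) = 0" if \<psi>: "\<psi> \<in> smooth_cpt {0<..<T}" for \<psi>
  proof -
    have s: "smooth \<psi>" and \<psi>0: "\<psi> 0 = 0" "\<psi> T = 0"
      using \<psi> by (auto simp: smooth_cpt_def)
    note d = smooth_real_deriv[OF s]
    have cs: "continuous_on {0..T} \<psi>" "continuous_on {0..T} (deriv \<psi>)"
      using DERIV_isCont[OF d(1)] continuous_on_subset[OF d(2)]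
      by (auto intro!: continuous_at_imp_continuous_on)
    have "((\<lambda>t. deriv \<psi> t * H t + \<psi> t * h t) has_integral \<psi> T * H T - \<psi> 0 * H 0) {0..T}"
    proof (rule fundamental_theorem_of_calculus)
      show "((\<lambda>t. \<psi> t * H t) has_vector_derivative deriv \<psi> t * H t + \<psi> t * h t) (at t within {0..T})"
        if "t \<in> {0..T}" for t
        unfolding has_real_derivative_iff_has_vector_derivative[symmetric]
        using DERIV_mult[OF has_field_derivative_at_within[OF d(1)] H[OF that]] by (simp add: algebra_simps)
    qed (use t in auto)
    then have 1: "integral {0..T} (\<lambda>t. deriv \<psi> t * H t + \<psi> t * h t) = 0"
      by (simp add: \<psi>0 integral_unique)
    have 2: "integral {0..T} (\<lambda>t. deriv \<psi> t * c t) = - integral {0..T} (\<lambda>t. \<psi> t * h t)"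
      using weak[OF \<psi>] by (simp add: LINT_lebesgue_on_open_interval continuous_intros c h cs)
    have "(\<lambda>t. deriv \<psi> t * c t) integrable_on {0..T}" "(\<lambda>t. deriv \<psi> t * H t) integrable_on {0..T}"
      "(\<lambda>t. \<psi> t * h t) integrable_on {0..T}"
      by (intro integrable_continuous_real continuous_intros c h Hc cs)+
    then show ?thesis
      using 1 2 by (simp add: right_diff_distrib integral_add integral_diff)
  qed
  have cH: "continuous_on {0..T} (\<lambda>t. c t - H t)" by (intro continuous_intros c Hc)
  have mono: "c b - H b \<le> c a - H a" "c a - H a \<le> c b - H b" if "0 < a" "a < b" "b < T" for a b
  proof -
    show "c b - H b \<le> c a - H a"
      by (rule du_Bois_Reymond[OF cH orth that])
    have "- (c b - H b) \<le> - (c a - H a)"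
    proof (rule du_Bois_Reymond[OF _ _ that, of "\<lambda>t. - (c t - H t)"])
      show "continuous_on {0..T} (\<lambda>t. - (c t - H t))"
        by (intro continuous_on_minus cH)
      show "integral {0..T} (\<lambda>t. deriv \<psi> t * - (c t - H t)) = 0" if "\<psi> \<in> smooth_cpt {0<..<T}" for \<psi>
        using orth[OF that] by (simp only: mult_minus_right integral_neg)
    qed
    then show "c a - H a \<le> c b - H b" by simp
  qed
  define k where "k = c t - H t"
  have eq: "c s = k + H s" if "0 < s" "s < T" for s
  proof -
    consider "s < t" | "s = t" | "t < s" by linarith
    then show ?thesis
    proof cases
      case 1
      then show ?thesis using mono[of s t] t that by (simp add: k_def)
    next
      case 2
      then show ?thesis by (simp add: k_def)
    next
      case 3
      then show ?thesis using mono[of t s] t that by (simp add: k_def)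
    qed
  qed
  have "(H has_real_derivative h t) (at t)"
    using H[of t] t at_within_Icc_at[of 0 t T] by simp
  from DERIV_add[OF DERIV_const[of k] this]
  have "((\<lambda>s. k + H s) has_real_derivative h t) (at t)"
    by simp
  moreover have "\<forall>\<^sub>F s in nhds t. k + H s = c s"
  proof (rule eventually_mono[OF eventually_nhds_in_open[of "{0<..<T}" t]])
    fix s assume "s \<in> {0<..<T}"
    then show "k + H s = c s" using eq[of s] by simp
  qed (use t in auto)
  ultimately show ?thesis
    using DERIV_cong_ev[OF refl _ refl, of "\<lambda>s. k + H s" c t "h t"] by blast
qed

section \<open>Square integrable functions and the flux\<close>

lemma Cauchy_Schwarz_integral:
  fixes u v :: "'a \<Rightarrow> real"
  assumes [measurable]: "u \<in> borel_measurable M" "v \<in> borel_measurable M"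
    and u: "integrable M (\<lambda>x. (u x)\<^sup>2)" and v: "integrable M (\<lambda>x. (v x)\<^sup>2)"
  shows "integrable M (\<lambda>x. u x * v x)"
    and "(LINT x|M. \<bar>u x * v x\<bar>) \<le> sqrt (LINT x|M. (u x)\<^sup>2) * sqrt (LINT x|M. (v x)\<^sup>2)"
proof -
  show int: "integrable M (\<lambda>x. u x * v x)"
  proof (rule Bochner_Integration.integrable_bound)
    show "integrable M (\<lambda>x. (u x)\<^sup>2 + (v x)\<^sup>2)" using u v by simp
    have "\<bar>a * b\<bar> \<le> a\<^sup>2 + b\<^sup>2" for a b :: real
      using sum_squares_bound[of "\<bar>a\<bar>" "\<bar>b\<bar>"] zero_le_power2[of a] zero_le_power2[of b] unfolding abs_mult power2_abs
      by linarith
    then show "AE x in M. norm (u x * v x) \<le> norm ((u x)\<^sup>2 + (v x)\<^sup>2)"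
      by (intro AE_I2) (simp add: abs_of_nonneg)
  qed measurable
  let ?c = "LINT x|M. \<bar>u x * v x\<bar>" and ?a = "LINT x|M. (u x)\<^sup>2" and ?b = "LINT x|M. (v x)\<^sup>2"
  have "(\<integral>\<^sup>+ x. ennreal \<bar>u x\<bar> * ennreal \<bar>v x\<bar> \<partial>M)\<^sup>2 \<le> (\<integral>\<^sup>+ x. (ennreal \<bar>u x\<bar>)\<^sup>2 \<partial>M) * (\<integral>\<^sup>+ x. (ennreal \<bar>v x\<bar>)\<^sup>2 \<partial>M)"
    by (rule Cauchy_Schwarz_nn_integral) measurable
  also have "(\<integral>\<^sup>+ x. ennreal \<bar>u x\<bar> * ennreal \<bar>v x\<bar> \<partial>M) = ennreal ?c"
    using integrable_abs[OF int] by (subst nn_integral_eq_integral[symmetric]) (auto simp: ennreal_mult[symmetric] abs_mult)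
  also have "(\<integral>\<^sup>+ x. (ennreal \<bar>u x\<bar>)\<^sup>2 \<partial>M) = ennreal ?a"
    using u by (subst nn_integral_eq_integral[symmetric]) (auto simp: ennreal_power)
  also have "(\<integral>\<^sup>+ x. (ennreal \<bar>v x\<bar>)\<^sup>2 \<partial>M) = ennreal ?b"
    using v by (subst nn_integral_eq_integral[symmetric]) (auto simp: ennreal_power)
  finally have "ennreal (?c\<^sup>2) \<le> ennreal (?a * ?b)"
    by (simp add: ennreal_power ennreal_mult)
  then have "?c\<^sup>2 \<le> ?a * ?b"
    by (subst (asm) ennreal_le_iff) auto
  then show "?c \<le> sqrt ?a * sqrt ?b"
    unfolding real_sqrt_mult[symmetric] by (rule real_le_rsqrt)
qed

lemma L2_perD:
  fixes u :: "point \<Rightarrow> real"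
  assumes "u \<in> L2_per"
  shows "u \<in> borel_measurable lborel" "u \<in> borel_measurable cell"
    "integrable cell (\<lambda>\<xi>. (u \<xi>)\<^sup>2)" "integrable cell u"
proof -
  show m: "u \<in> borel_measurable lborel" "u \<in> borel_measurable cell"
    using assms by (auto simp: L2_per_def intro: measurable_cell)
  show s: "integrable cell (\<lambda>\<xi>. (u \<xi>)\<^sup>2)"
    using assms by (simp add: L2_per_def set_integrable_Upsilon)
  show "integrable cell u"
    by (rule cell.square_integrable_imp_integrable[OF m(2) s])
qed

lemma L2_norm_eq: "L2_norm u = sqrt (LINT \<xi>|cell. (u \<xi>)\<^sup>2)" for u :: "point \<Rightarrow> real"
  by (simp add: L2_norm_def set_integral_Upsilon)

lemma L2_norm_nonneg: "0 \<le> L2_norm u" for u :: "point \<Rightarrow> real"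
  by (simp add: L2_norm_eq)

lemma L2_norm_square: "(L2_norm u)\<^sup>2 = (LINT \<xi>|cell. (u \<xi>)\<^sup>2)" for u :: "point \<Rightarrow> real"
  by (simp add: L2_norm_eq)

lemma square_integrable_add_diff:
  fixes u v :: "'a \<Rightarrow> real"
  assumes [measurable]: "u \<in> borel_measurable M" "v \<in> borel_measurable M"
    and u: "integrable M (\<lambda>x. (u x)\<^sup>2)" and v: "integrable M (\<lambda>x. (v x)\<^sup>2)"
  shows "integrable M (\<lambda>x. (u x - v x)\<^sup>2)"
  using Cauchy_Schwarz_integral(1)[OF assms] u v by (simp add: power2_diff mult.assoc)

lemma angular_int_eq: "angular_int u x = (LINT \<theta>|angle. u (x, \<theta>))"
  unfolding angular_int_def angle_def set_lebesgue_integral_def by (subst integral_restrict_space) auto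

lemma integral_fst_cell:
  fixes g :: "real \<times> real \<Rightarrow> real"
  assumes g: "integrable (restrict_space lborel Omega) g"
  shows "integrable cell (\<lambda>\<eta>. g (fst \<eta>))"
    and "(LINT \<eta>|cell. g (fst \<eta>)) = 2 * pi * (LINT x|restrict_space lborel Omega. g x)"
proof -
  have [measurable]: "g \<in> borel_measurable (restrict_space lborel Omega)" using g by auto
  have i: "integrable (restrict_space lborel Omega \<Otimes>\<^sub>M angle) (\<lambda>\<eta>. g (fst \<eta>))"
    by (rule Om_angle.Fubini_integrable) (use g in \<open>auto simp: mult.commute\<close>)
  then show "integrable cell (\<lambda>\<eta>. g (fst \<eta>))" by (simp add: cell_eq_pair)
  have "(LINT \<eta>|cell. g (fst \<eta>)) = (LINT x|restrict_space lborel Omega. LINT \<theta>|angle. g x)"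
    using Om_angle.integral_fst'[OF i] by (simp add: cell_eq_pair)
  then show "(LINT \<eta>|cell. g (fst \<eta>)) = 2 * pi * (LINT x|restrict_space lborel Omega. g x)"
    by simp
qed

lemma integral_cell_iterated:
  fixes u :: "point \<Rightarrow> real"
  assumes "integrable cell u"
  shows "AE x in restrict_space lborel Omega. integrable angle (\<lambda>\<theta>. u (x, \<theta>))"
    and "integrable (restrict_space lborel Omega) (angular_int u)"
    and "(LINT \<eta>|cell. u \<eta>) = (LINT x|restrict_space lborel Omega. angular_int u x)"
  using Om_angle.AE_integrable_fst'[of u] Om_angle.integrable_fst'[of u] Om_angle.integral_fst'[of u] assms
  by (simp_all add: cell_eq_pair angular_int_eq[abs_def])

text \<open>The density depends on x alone, while it is integrated over the cell; a null set in x
  times the interval of angles is a null set.\<close>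

lemma AE_fst_cell:
  assumes "AE x in restrict_space lborel Omega. P x"
  shows "AE \<eta> in cell. P (fst \<eta>)"
proof -
  obtain N where N: "N \<in> null_sets (restrict_space lborel Omega)"
    "\<And>x. x \<in> space (restrict_space lborel Omega) - N \<Longrightarrow> P x"
    using assms by (rule AE_E3) blast
  have "emeasure cell (N \<times> space angle) = 0"
    using N(1) sets.top[of angle] unfolding cell_eq_pair[symmetric]
    by (subst angle.emeasure_pair_measure_Times) (auto simp: null_sets_def)
  moreover have "N \<times> space angle \<in> sets cell"
    using N(1) sets.top[of angle] unfolding cell_eq_pair[symmetric] by (intro pair_measureI) auto
  ultimately have "N \<times> space angle \<in> null_sets cell" by (simp add: null_sets_def)
  then show ?thesis
  proof (rule AE_I')
    show "{\<eta> \<in> space cell. \<not> P (fst \<eta>)} \<subseteq> N \<times> space angle"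
    proof
      fix \<eta> assume "\<eta> \<in> {\<eta> \<in> space cell. \<not> P (fst \<eta>)}"
      then show "\<eta> \<in> N \<times> space angle"
        using N(2)[of "fst \<eta>"] by (cases \<eta>) (auto simp: space_restrict_space Upsilon_def)
    qed
  qed
qed

lemma angular_int_cell_measurable:
  assumes "integrable cell u"
  shows "(\<lambda>\<eta>. angular_int u (fst \<eta>)) \<in> borel_measurable cell"
  using integral_fst_cell(1)[OF integral_cell_iterated(2)[OF assms]] by auto

text \<open>Cauchy-Schwarz in the angle gives one factor 2 pi; regarding a function of x as a
  function on the cell gives the other.\<close>

lemma angular_int_L2:
  fixes u :: "point \<Rightarrow> real"
  assumes [measurable]: "u \<in> borel_measurable cell" and u2: "integrable cell (\<lambda>\<eta>. (u \<eta>)\<^sup>2)"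
  shows "integrable cell (\<lambda>\<eta>. (angular_int u (fst \<eta>))\<^sup>2)"
    and "(LINT \<eta>|cell. (angular_int u (fst \<eta>))\<^sup>2) \<le> (2 * pi)\<^sup>2 * (LINT \<eta>|cell. (u \<eta>)\<^sup>2)"
proof -
  have u1: "integrable cell u" by (rule cell.square_integrable_imp_integrable) (use u2 in auto)
  let ?s = "angular_int (\<lambda>\<eta>. (u \<eta>)\<^sup>2)"
  note it = integral_cell_iterated[OF u2]
  have "AE x in restrict_space lborel Omega. (angular_int u x)\<^sup>2 \<le> 2 * pi * ?s x"
    using it(1) integral_cell_iterated(1)[OF u1]
  proof eventually_elim
    case (elim x)
    have m: "(\<lambda>\<theta>. u (x, \<theta>)) \<in> borel_measurable angle" using elim(2) by auto
    have "\<bar>angular_int u x\<bar> \<le> (LINT \<theta>|angle. \<bar>u (x, \<theta>) * 1\<bar>)"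
      unfolding angular_int_eq using integral_abs_bound by simp
    also have "\<dots> \<le> sqrt (LINT \<theta>|angle. (u (x, \<theta>))\<^sup>2) * sqrt (LINT \<theta>|angle. 1\<^sup>2)"
      by (rule Cauchy_Schwarz_integral(2)) (use m elim in auto)
    also have "\<dots> = sqrt (?s x) * sqrt (2 * pi)"
      by (simp add: angular_int_eq)
    also have "\<dots> = sqrt (2 * pi * ?s x)"
      by (simp add: real_sqrt_mult)
    finally have "\<bar>angular_int u x\<bar>\<^sup>2 \<le> (sqrt (2 * pi * ?s x))\<^sup>2"
      by (intro power_mono) auto
    moreover have "0 \<le> ?s x" by (simp add: angular_int_eq)
    ultimately show ?case by simp
  qed
  then have ae: "AE \<eta> in cell. (angular_int u (fst \<eta>))\<^sup>2 \<le> 2 * pi * ?s (fst \<eta>)"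
    by (rule AE_fst_cell)
  note f = integral_fst_cell[OF it(2)]
  have [measurable]: "(\<lambda>\<eta>. angular_int u (fst \<eta>)) \<in> borel_measurable cell"
    by (rule angular_int_cell_measurable[OF u1])
  show int: "integrable cell (\<lambda>\<eta>. (angular_int u (fst \<eta>))\<^sup>2)"
  proof (rule Bochner_Integration.integrable_bound)
    show "integrable cell (\<lambda>\<eta>. 2 * pi * ?s (fst \<eta>))" using f(1) by simp
    show "AE \<eta> in cell. norm ((angular_int u (fst \<eta>))\<^sup>2) \<le> norm (2 * pi * ?s (fst \<eta>))"
      using ae by eventually_elim simp
  qed measurable
  have "(LINT \<eta>|cell. (angular_int u (fst \<eta>))\<^sup>2) \<le> (LINT \<eta>|cell. 2 * pi * ?s (fst \<eta>))"
    using int f(1) ae by (intro integral_mono_AE) auto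
  also have "\<dots> = (2 * pi)\<^sup>2 * (LINT \<eta>|cell. (u \<eta>)\<^sup>2)"
    using f(2) it(3) by (simp add: power2_eq_square)
  finally show "(LINT \<eta>|cell. (angular_int u (fst \<eta>))\<^sup>2) \<le> (2 * pi)\<^sup>2 * (LINT \<eta>|cell. (u \<eta>)\<^sup>2)" .
qed

lemma angular_int_diff:
  fixes u v :: "point \<Rightarrow> real"
  assumes "integrable cell u" "integrable cell v"
  shows "AE \<eta> in cell. angular_int (\<lambda>\<eta>. u \<eta> - v \<eta>) (fst \<eta>) = angular_int u (fst \<eta>) - angular_int v (fst \<eta>)"
proof (rule AE_fst_cell)
  show "AE x in restrict_space lborel Omega. angular_int (\<lambda>\<eta>. u \<eta> - v \<eta>) x = angular_int u x - angular_int v x"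
    using integral_cell_iterated(1)[OF assms(1)] integral_cell_iterated(1)[OF assms(2)]
    by eventually_elim (simp add: angular_int_eq)
qed

text \<open>One component of \<open>(1 - \<rho>) f e(\<theta>)\<close>; \<open>a\<close> is \<open>cos\<close> or \<open>sin\<close>.\<close>

definition flux :: "(point \<Rightarrow> real) \<Rightarrow> (real \<Rightarrow> real) \<Rightarrow> point \<Rightarrow> real" where
  "flux u a \<eta> = (1 - angular_int u (fst \<eta>)) * u \<eta> * a (snd \<eta>)"

text \<open>The flux is quadratic in \<open>u\<close>, so its L^1 norm is estimated by a product of
  two L^2 norms over the cell; this is the norm of the vacancy factor.\<close>

definition vacancy_norm :: "(point \<Rightarrow> real) \<Rightarrow> real" where
  "vacancy_norm u = sqrt (LINT \<eta>|cell. (1 - angular_int u (fst \<eta>))\<^sup>2)"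

lemma vacancy_L2:
  assumes u: "u \<in> L2_per"
  shows "(\<lambda>\<eta>. 1 - angular_int u (fst \<eta>)) \<in> borel_measurable cell"
    and "integrable cell (\<lambda>\<eta>. (1 - angular_int u (fst \<eta>))\<^sup>2)"
proof -
  note d = L2_perD[OF u]
  show m: "(\<lambda>\<eta>. 1 - angular_int u (fst \<eta>)) \<in> borel_measurable cell"
    using angular_int_cell_measurable[OF d(4)] by measurable
  show "integrable cell (\<lambda>\<eta>. (1 - angular_int u (fst \<eta>))\<^sup>2)"
    by (rule square_integrable_add_diff)
      (use angular_int_L2(1)[OF d(2,3)] angular_int_cell_measurable[OF d(4)] in auto)
qed

text \<open>The bound holds at every time, whereas the range of the density is known for almost
  every time only; the price is L^1 in place of L^2.\<close>

lemma flux_L1: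
  assumes u: "u \<in> L2_per" and a: "continuous_on UNIV a" "\<And>\<theta>. \<bar>a \<theta>\<bar> \<le> 1"
  shows "integrable cell (flux u a)"
    and "(LINT \<eta>|cell. \<bar>flux u a \<eta>\<bar>) \<le> vacancy_norm u * L2_norm u"
proof -
  note d = L2_perD[OF u] and v = vacancy_L2[OF u]
  note cs = Cauchy_Schwarz_integral[OF v(1) d(2) v(2) d(3)]
  have am [measurable]: "(\<lambda>\<eta>. a (snd \<eta>)) \<in> borel_measurable cell"
    by (rule measurable_cell) (auto intro!: borel_measurable_continuous_onI continuous_on_compose2[OF a(1)] continuous_intros)
  note [measurable] = v(1) d(2)
  have fm: "flux u a \<in> borel_measurable cell"
    unfolding flux_def[abs_def]
    by (intro borel_measurable_times v(1) d(2) am)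
  have le: "\<bar>flux u a \<eta>\<bar> \<le> \<bar>(1 - angular_int u (fst \<eta>)) * u \<eta>\<bar>" for \<eta>
    unfolding flux_def abs_mult using a(2)[of "snd \<eta>"] by (intro mult_left_le) auto
  show int: "integrable cell (flux u a)"
    by (rule Bochner_Integration.integrable_bound[OF cs(1)]) (use le fm in auto)
  have "(LINT \<eta>|cell. \<bar>flux u a \<eta>\<bar>) \<le> (LINT \<eta>|cell. \<bar>(1 - angular_int u (fst \<eta>)) * u \<eta>\<bar>)"
    using int cs(1) le by (intro integral_mono) auto
  then show "(LINT \<eta>|cell. \<bar>flux u a \<eta>\<bar>) \<le> vacancy_norm u * L2_norm u"
    using cs(2) by (simp add: vacancy_norm_def L2_norm_eq)
qed

lemma L2_per_diff: "u \<in> L2_per \<Longrightarrow> v \<in> L2_per \<Longrightarrow> (\<lambda>\<eta>. u \<eta> - v \<eta>) \<in> L2_per" for u v :: "point \<Rightarrow> real"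
  unfolding L2_per_def
proof safe
  assume u: "u \<in> borel_measurable lborel" "periodic_ae u" "set_integrable lborel Upsilon (\<lambda>\<xi>. (norm (u \<xi>))\<^sup>2)"
    and v: "v \<in> borel_measurable lborel" "periodic_ae v" "set_integrable lborel Upsilon (\<lambda>\<xi>. (norm (v \<xi>))\<^sup>2)"
  show "(\<lambda>\<eta>. u \<eta> - v \<eta>) \<in> borel_measurable lborel" using u(1) v(1) by measurable
  show "periodic_ae (\<lambda>\<eta>. u \<eta> - v \<eta>)"
    unfolding periodic_ae_def
  proof
    fix i :: point assume i: "i \<in> Basis"
    from u(2) v(2) i have "AE \<xi> in lborel. u (\<xi> + (2 * pi) *\<^sub>R i) = u \<xi>" "AE \<xi> in lborel. v (\<xi> + (2 * pi) *\<^sub>R i) = v \<xi>"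
      unfolding periodic_ae_def by blast+
    then show "AE \<xi> in lborel. u (\<xi> + (2 * pi) *\<^sub>R i) - v (\<xi> + (2 * pi) *\<^sub>R i) = u \<xi> - v \<xi>"
      by eventually_elim simp
  qed
  show "set_integrable lborel Upsilon (\<lambda>\<xi>. (norm (u \<xi> - v \<xi>))\<^sup>2)"
    using square_integrable_add_diff[OF measurable_cell[OF u(1)] measurable_cell[OF v(1)]] u(3) v(3)
    by (simp add: set_integrable_Upsilon)
qed

lemma L1_le_L2:
  assumes u: "u \<in> L2_per"
  shows "(LINT \<eta>|cell. \<bar>u \<eta>\<bar>) \<le> sqrt ((2 * pi) ^ 3) * L2_norm u"
proof -
  note d = L2_perD[OF u]
  have "(LINT \<eta>|cell. \<bar>u \<eta> * 1\<bar>) \<le> sqrt (LINT \<eta>|cell. (u \<eta>)\<^sup>2) * sqrt (LINT \<eta>|cell. 1\<^sup>2)"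
    by (rule Cauchy_Schwarz_integral(2)) (use d in auto)
  then show ?thesis by (simp add: L2_norm_eq mult.commute)
qed

lemma L2_norm_triangle:
  fixes u v :: "point \<Rightarrow> real"
  assumes u: "u \<in> L2_per" and v: "v \<in> L2_per"
  shows "L2_norm u \<le> L2_norm v + L2_norm (\<lambda>\<eta>. u \<eta> - v \<eta>)"
proof -
  note d = L2_perD[OF v] and e = L2_perD[OF L2_per_diff[OF u v]]
  note cs = Cauchy_Schwarz_integral[OF d(2) e(2) d(3) e(3)]
  have "(LINT \<eta>|cell. v \<eta> * (u \<eta> - v \<eta>)) \<le> L2_norm v * L2_norm (\<lambda>\<eta>. u \<eta> - v \<eta>)"
    unfolding L2_norm_eq by (rule order_trans[OF order_trans[OF abs_ge_self integral_abs_bound] cs(2)])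
  moreover have "(LINT \<eta>|cell. (u \<eta>)\<^sup>2) = (LINT \<eta>|cell. (v \<eta>)\<^sup>2 + 2 * (v \<eta> * (u \<eta> - v \<eta>)) + (u \<eta> - v \<eta>)\<^sup>2)"
    by (intro Bochner_Integration.integral_cong refl) (simp add: power2_eq_square algebra_simps)
  moreover have "\<dots> = (LINT \<eta>|cell. (v \<eta>)\<^sup>2) + 2 * (LINT \<eta>|cell. v \<eta> * (u \<eta> - v \<eta>)) + (LINT \<eta>|cell. (u \<eta> - v \<eta>)\<^sup>2)"
    using d e cs by simp
  ultimately have "(L2_norm u)\<^sup>2 \<le> (L2_norm v + L2_norm (\<lambda>\<eta>. u \<eta> - v \<eta>))\<^sup>2"
    by (simp add: L2_norm_square power2_sum)
  then show ?thesis
    by (rule power2_le_imp_le) (simp add: L2_norm_nonneg)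
qed

text \<open>With d = u - v, the difference of the fluxes splits into the vacancy of \<open>v\<close>
  times d minus the angular integral of d times \<open>u\<close>, and each product is treated by
  Cauchy-Schwarz.\<close>

lemma flux_diff_L1:
  assumes u: "u \<in> L2_per" and v: "v \<in> L2_per" and a: "continuous_on UNIV a" "\<And>\<theta>. \<bar>a \<theta>\<bar> \<le> 1"
  shows "(LINT \<eta>|cell. \<bar>flux u a \<eta> - flux v a \<eta>\<bar>)
    \<le> (vacancy_norm v + 2 * pi * L2_norm u) * L2_norm (\<lambda>\<eta>. u \<eta> - v \<eta>)"
proof -
  let ?d = "\<lambda>\<eta>. u \<eta> - v \<eta>"
  note du = L2_perD[OF u] and dv = L2_perD[OF v] and dd = L2_perD[OF L2_per_diff[OF u v]]
  note vv = vacancy_L2[OF v]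
  note am = angular_int_cell_measurable[OF dd(4)] angular_int_L2[OF dd(2,3)]
  note c1 = Cauchy_Schwarz_integral[OF vv(1) dd(2) vv(2) dd(3)]
  note c2 = Cauchy_Schwarz_integral[OF am(1) du(2) am(2) du(3)]
  have ae: "AE \<eta> in cell. \<bar>flux u a \<eta> - flux v a \<eta>\<bar>
      \<le> \<bar>(1 - angular_int v (fst \<eta>)) * ?d \<eta>\<bar> + \<bar>angular_int ?d (fst \<eta>) * u \<eta>\<bar>"
    using angular_int_diff[OF du(4) dv(4)]
  proof eventually_elim
    case (elim \<eta>)
    have "flux u a \<eta> - flux v a \<eta> = ((1 - angular_int v (fst \<eta>)) * ?d \<eta> - angular_int ?d (fst \<eta>) * u \<eta>) * a (snd \<eta>)"
      unfolding elim flux_def by (simp add: algebra_simps)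
    then have "\<bar>flux u a \<eta> - flux v a \<eta>\<bar> \<le> \<bar>(1 - angular_int v (fst \<eta>)) * ?d \<eta> - angular_int ?d (fst \<eta>) * u \<eta>\<bar> * 1"
      using a(2)[of "snd \<eta>"] by (simp add: abs_mult mult_left_le)
    also have "\<dots> \<le> \<bar>(1 - angular_int v (fst \<eta>)) * ?d \<eta>\<bar> + \<bar>angular_int ?d (fst \<eta>) * u \<eta>\<bar>"
      unfolding mult_1_right by (rule abs_triangle_ineq4)
    finally show ?case .
  qed
  have "(LINT \<eta>|cell. \<bar>flux u a \<eta> - flux v a \<eta>\<bar>)
      \<le> (LINT \<eta>|cell. \<bar>(1 - angular_int v (fst \<eta>)) * ?d \<eta>\<bar> + \<bar>angular_int ?d (fst \<eta>) * u \<eta>\<bar>)"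
    using flux_L1(1)[OF u a] flux_L1(1)[OF v a] c1(1) c2(1) ae
    by (intro integral_mono_AE Bochner_Integration.integrable_add integrable_abs Bochner_Integration.integrable_diff) auto
  also have "\<dots> = (LINT \<eta>|cell. \<bar>(1 - angular_int v (fst \<eta>)) * ?d \<eta>\<bar>) + (LINT \<eta>|cell. \<bar>angular_int ?d (fst \<eta>) * u \<eta>\<bar>)"
    using c1(1) c2(1) by (intro Bochner_Integration.integral_add integrable_abs)
  also have "\<dots> \<le> vacancy_norm v * L2_norm ?d + sqrt (LINT \<eta>|cell. (angular_int ?d (fst \<eta>))\<^sup>2) * L2_norm u"
    using c1(2) c2(2) by (simp add: vacancy_norm_def L2_norm_eq)
  also have "\<dots> \<le> vacancy_norm v * L2_norm ?d + sqrt ((2 * pi)\<^sup>2 * (LINT \<eta>|cell. (?d \<eta>)\<^sup>2)) * L2_norm u"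
    by (intro add_left_mono mult_right_mono real_sqrt_le_mono am(3) L2_norm_nonneg)
  also have "\<dots> = (vacancy_norm v + 2 * pi * L2_norm u) * L2_norm ?d"
    by (simp add: L2_norm_eq real_sqrt_mult algebra_simps)
  finally show ?thesis .
qed

section \<open>Continuity in time of averages of the solution and of its flux\<close>

lemma C_L2_D:
  assumes "C_L2 T f" "t \<in> {0..T}"
  shows "f t \<in> L2_per" "((\<lambda>s. L2_norm (\<lambda>\<xi>. f s \<xi> - f t \<xi>)) \<longlongrightarrow> 0) (at t within {0..T})"
  using assms unfolding C_L2_def by blast+

text \<open>Integration against a bounded kernel is Lipschitz in L^1. The one lemma covers Fourier
  coefficients, Fejer means and angular masses, for the solution and, where needed, for its
  flux.\<close>

lemma L1_continuous_kernel:
  fixes g :: "real \<Rightarrow> point \<Rightarrow> real"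
  assumes int: "\<And>t. t \<in> S \<Longrightarrow> integrable cell (g t)"
    and lim: "\<And>t. t \<in> S \<Longrightarrow> ((\<lambda>s. LINT \<eta>|cell. \<bar>g s \<eta> - g t \<eta>\<bar>) \<longlongrightarrow> 0) (at t within S)"
    and k [measurable]: "k \<in> borel_measurable cell" and K: "\<And>\<eta>. \<bar>k \<eta>\<bar> \<le> K"
  shows "continuous_on S (\<lambda>t. LINT \<eta>|cell. g t \<eta> * k \<eta>)"
  unfolding continuous_on_def
proof
  fix t assume t: "t \<in> S"
  have i: "integrable cell (\<lambda>\<eta>. w \<eta> * k \<eta>)" if "integrable cell w" for w
  proof (rule Bochner_Integration.integrable_bound[of _ "\<lambda>\<eta>. K * w \<eta>"])
    have [measurable]: "w \<in> borel_measurable cell" using that by auto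
    show "(\<lambda>\<eta>. w \<eta> * k \<eta>) \<in> borel_measurable cell" by measurable
    have "\<bar>k \<eta>\<bar> \<le> \<bar>K\<bar>" for \<eta> using K[of \<eta>] by linarith
    then show "AE \<eta> in cell. norm (w \<eta> * k \<eta>) \<le> norm (K * w \<eta>)"
      by (auto simp: abs_mult mult.commute intro!: mult_right_mono)
  qed (use that in auto)
  have "((\<lambda>s. (LINT \<eta>|cell. g s \<eta> * k \<eta>) - (LINT \<eta>|cell. g t \<eta> * k \<eta>)) \<longlongrightarrow> 0) (at t within S)"
  proof (rule Lim_null_comparison)
    show "((\<lambda>s. (LINT \<eta>|cell. \<bar>g s \<eta> - g t \<eta>\<bar>) * K) \<longlongrightarrow> 0) (at t within S)"
      using tendsto_mult_right[OF lim[OF t], of K] by simp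
    show "\<forall>\<^sub>F s in at t within S. norm ((LINT \<eta>|cell. g s \<eta> * k \<eta>) - (LINT \<eta>|cell. g t \<eta> * k \<eta>))
        \<le> (LINT \<eta>|cell. \<bar>g s \<eta> - g t \<eta>\<bar>) * K"
      unfolding eventually_at_topological
    proof (intro exI[of _ UNIV] conjI ballI impI)
      fix s assume s: "s \<in> S"
      have d: "integrable cell (\<lambda>\<eta>. g s \<eta> - g t \<eta>)" using int[OF s] int[OF t] by simp
      have "norm ((LINT \<eta>|cell. g s \<eta> * k \<eta>) - (LINT \<eta>|cell. g t \<eta> * k \<eta>))
         = \<bar>LINT \<eta>|cell. (g s \<eta> - g t \<eta>) * k \<eta>\<bar>"
        using i[OF int[OF s]] i[OF int[OF t]] by (simp add: left_diff_distrib)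
      also have "\<dots> \<le> (LINT \<eta>|cell. \<bar>(g s \<eta> - g t \<eta>) * k \<eta>\<bar>)" by (rule integral_abs_bound)
      also have "\<dots> \<le> (LINT \<eta>|cell. \<bar>g s \<eta> - g t \<eta>\<bar> * K)"
        using K by (intro integral_mono integrable_abs i d integrable_mult_left) (simp add: abs_mult mult_left_mono)
      finally show "norm ((LINT \<eta>|cell. g s \<eta> * k \<eta>) - (LINT \<eta>|cell. g t \<eta> * k \<eta>))
        \<le> (LINT \<eta>|cell. \<bar>g s \<eta> - g t \<eta>\<bar>) * K"
        by simp
    qed auto
  qed
  then show "((\<lambda>t. LINT \<eta>|cell. g t \<eta> * k \<eta>) \<longlongrightarrow> (LINT \<eta>|cell. g t \<eta> * k \<eta>)) (at t within S)"
    by (simp add: LIM_zero_iff)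
qed

lemma C_L2_L1_limit:
  assumes f: "C_L2 T f" and t: "t \<in> {0..T}"
  shows "((\<lambda>s. LINT \<eta>|cell. \<bar>f s \<eta> - f t \<eta>\<bar>) \<longlongrightarrow> 0) (at t within {0..T})"
proof (rule Lim_null_comparison)
  show "((\<lambda>s. sqrt ((2 * pi) ^ 3) * L2_norm (\<lambda>\<xi>. f s \<xi> - f t \<xi>)) \<longlongrightarrow> 0) (at t within {0..T})"
    using tendsto_mult_left[OF C_L2_D(2)[OF f t], of "sqrt ((2 * pi) ^ 3)"] by simp
  show "\<forall>\<^sub>F s in at t within {0..T}. norm (LINT \<eta>|cell. \<bar>f s \<eta> - f t \<eta>\<bar>) \<le> sqrt ((2 * pi) ^ 3) * L2_norm (\<lambda>\<xi>. f s \<xi> - f t \<xi>)"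
    unfolding eventually_at_topological
    using L1_le_L2[OF L2_per_diff[OF C_L2_D(1)[OF f] C_L2_D(1)[OF f t]]]
    by (intro exI[of _ UNIV]) (auto simp: integral_nonneg)
qed

lemma C_L2_flux_limit:
  assumes f: "C_L2 T f" and t: "t \<in> {0..T}" and a: "continuous_on UNIV a" "\<And>\<theta>. \<bar>a \<theta>\<bar> \<le> 1"
  shows "((\<lambda>s. LINT \<eta>|cell. \<bar>flux (f s) a \<eta> - flux (f t) a \<eta>\<bar>) \<longlongrightarrow> 0) (at t within {0..T})"
proof (rule Lim_null_comparison)
  let ?d = "\<lambda>s. L2_norm (\<lambda>\<xi>. f s \<xi> - f t \<xi>)"
  have "((\<lambda>s. (vacancy_norm (f t) + 2 * pi * (L2_norm (f t) + ?d s)) * ?d s) \<longlongrightarrow>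
      (vacancy_norm (f t) + 2 * pi * (L2_norm (f t) + 0)) * 0) (at t within {0..T})"
    by (intro tendsto_mult tendsto_add tendsto_const C_L2_D(2)[OF f t])
  then show "((\<lambda>s. (vacancy_norm (f t) + 2 * pi * (L2_norm (f t) + ?d s)) * ?d s) \<longlongrightarrow> 0) (at t within {0..T})"
    by simp
  show "\<forall>\<^sub>F s in at t within {0..T}. norm (LINT \<eta>|cell. \<bar>flux (f s) a \<eta> - flux (f t) a \<eta>\<bar>)
      \<le> (vacancy_norm (f t) + 2 * pi * (L2_norm (f t) + ?d s)) * ?d s"
    unfolding eventually_at_topological
  proof (intro exI[of _ UNIV] conjI ballI impI)
    fix s assume "s \<in> {0..T}"
    note s = C_L2_D(1)[OF f this] and t' = C_L2_D(1)[OF f t]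
    have "(LINT \<eta>|cell. \<bar>flux (f s) a \<eta> - flux (f t) a \<eta>\<bar>) \<le> (vacancy_norm (f t) + 2 * pi * L2_norm (f s)) * ?d s"
      by (rule flux_diff_L1[OF s t' a])
    also have "\<dots> \<le> (vacancy_norm (f t) + 2 * pi * (L2_norm (f t) + ?d s)) * ?d s"
      by (intro mult_right_mono add_left_mono mult_left_mono L2_norm_triangle[OF s t'] L2_norm_nonneg) simp
    finally show "norm (LINT \<eta>|cell. \<bar>flux (f s) a \<eta> - flux (f t) a \<eta>\<bar>)
      \<le> (vacancy_norm (f t) + 2 * pi * (L2_norm (f t) + ?d s)) * ?d s"
      by (simp add: integral_nonneg)
  qed auto
qed

lemma C_L2_norm_continuous:
  assumes f: "C_L2 T f"
  shows "continuous_on {0..T} (\<lambda>t. L2_norm (f t))"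
  unfolding continuous_on_def
  proof
    fix t assume t: "t \<in> {0..T}"
    have "((\<lambda>s. L2_norm (f s) - L2_norm (f t)) \<longlongrightarrow> 0) (at t within {0..T})"
    proof (rule Lim_null_comparison[OF _ C_L2_D(2)[OF f t]])
      show "\<forall>\<^sub>F s in at t within {0..T}. norm (L2_norm (f s) - L2_norm (f t)) \<le> L2_norm (\<lambda>\<xi>. f s \<xi> - f t \<xi>)"
        unfolding eventually_at_topological
      proof (intro exI[of _ UNIV] conjI ballI impI)
        fix s assume "s \<in> {0..T}"
        note s = C_L2_D(1)[OF f this] and t' = C_L2_D(1)[OF f t]
        have "L2_norm (\<lambda>\<eta>. f t \<eta> - f s \<eta>) = L2_norm (\<lambda>\<xi>. f s \<xi> - f t \<xi>)"
          by (simp add: L2_norm_eq power2_commute)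
        then show "norm (L2_norm (f s) - L2_norm (f t)) \<le> L2_norm (\<lambda>\<xi>. f s \<xi> - f t \<xi>)"
          using L2_norm_triangle[OF s t'] L2_norm_triangle[OF t' s] by simp
      qed auto
    qed
    then show "((\<lambda>t. L2_norm (f t)) \<longlongrightarrow> L2_norm (f t)) (at t within {0..T})"
      by (simp add: LIM_zero_iff)
  qed

lemma C_L2_bounded:
  assumes f: "C_L2 T f"
  obtains K where "\<And>t. t \<in> {0..T} \<Longrightarrow> L2_norm (f t) \<le> K"
proof -
  have "bounded ((\<lambda>t. L2_norm (f t)) ` {0..T})"
    by (intro compact_imp_bounded compact_continuous_image C_L2_norm_continuous f) auto
  then obtain K where "\<forall>t\<in>{0..T}. norm (L2_norm (f t)) \<le> K"
    by (auto simp: bounded_iff)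
  then show ?thesis by (intro that[of K]) (auto simp: L2_norm_nonneg)
qed

lemma vacancy_norm_le:
  assumes u: "u \<in> L2_per"
  shows "vacancy_norm u \<le> sqrt (2 * (2 * pi) ^ 3 + 2 * (2 * pi * L2_norm u)\<^sup>2)"
  unfolding vacancy_norm_def
proof (rule real_sqrt_le_mono)
  note d = L2_perD[OF u]
  note a = angular_int_L2[OF d(2,3)]
  have "(LINT \<eta>|cell. (1 - angular_int u (fst \<eta>))\<^sup>2) \<le> (LINT \<eta>|cell. 2 + 2 * (angular_int u (fst \<eta>))\<^sup>2)"
  proof (rule integral_mono[OF vacancy_L2(2)[OF u]])
    show "integrable cell (\<lambda>\<eta>. 2 + 2 * (angular_int u (fst \<eta>))\<^sup>2)" using a(1) by simp
    show "(1 - angular_int u (fst \<eta>))\<^sup>2 \<le> 2 + 2 * (angular_int u (fst \<eta>))\<^sup>2" for \<eta>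
      using zero_le_power2[of "1 + angular_int u (fst \<eta>)"] by (simp add: power2_sum power2_diff)
  qed
  also have "\<dots> = 2 * (2 * pi) ^ 3 + 2 * (LINT \<eta>|cell. (angular_int u (fst \<eta>))\<^sup>2)"
    using a(1) by simp
  also have "\<dots> \<le> 2 * (2 * pi) ^ 3 + 2 * (2 * pi * L2_norm u)\<^sup>2"
    using a(2) by (simp add: power_mult_distrib L2_norm_square)
  finally show "(LINT \<eta>|cell. (1 - angular_int u (fst \<eta>))\<^sup>2) \<le> 2 * (2 * pi) ^ 3 + 2 * (2 * pi * L2_norm u)\<^sup>2" .
qed

section \<open>Integration over space-time cylinders\<close>

definition time :: "real \<Rightarrow> real measure" where
  "time T = restrict_space lborel {0<..<T}"

lemma space_time [simp]: "space (time T) = {0<..<T}"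
  by (simp add: time_def space_restrict_space)

lemma finite_measure_time: "finite_measure (time T)"
proof
  have "emeasure (time T) {0<..<T} = emeasure lborel {0<..<T}"
    unfolding time_def by (subst emeasure_restrict_space) auto
  also have "\<dots> < \<infinity>" by (rule emeasure_bounded_finite) simp
  finally show "emeasure (time T) (space (time T)) \<noteq> \<infinity>" by simp
qed

lemma time_cell: "time T \<Otimes>\<^sub>M cell = restrict_space lborel ({0<..<T} \<times> Upsilon)"
  unfolding time_def cell_def by (rule restrict_lborel_Times) auto

lemma time_cell_integral:
  fixes g :: "real \<times> point \<Rightarrow> real"
  shows "set_lebesgue_integral lborel ({0<..<T} \<times> Upsilon) g = (LINT p|(time T \<Otimes>\<^sub>M cell). g p)"
    and "set_integrable lborel ({0<..<T} \<times> Upsilon) g \<longleftrightarrow> integrable (time T \<Otimes>\<^sub>M cell) g"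
proof -
  have "open ({0<..<T} \<times> Upsilon)" by (intro open_Times) auto
  then have "{0<..<T} \<times> Upsilon \<inter> space lborel \<in> sets lborel" by (simp add: borel_open)
  then show "set_lebesgue_integral lborel ({0<..<T} \<times> Upsilon) g = (LINT p|(time T \<Otimes>\<^sub>M cell). g p)"
    "set_integrable lborel ({0<..<T} \<times> Upsilon) g \<longleftrightarrow> integrable (time T \<Otimes>\<^sub>M cell) g"
    unfolding time_cell set_lebesgue_integral_def set_integrable_def
    by (simp_all only: integral_restrict_space integrable_restrict_space)
qed

lemma measurable_time_cell:
  fixes u :: "real \<Rightarrow> point \<Rightarrow> 'b::euclidean_space"
  assumes "(\<lambda>(t, \<xi>). u t \<xi>) \<in> borel_measurable (restrict_space lborel ({0<..<T} \<times> UNIV))"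
  shows "(\<lambda>(t, \<xi>). u t \<xi>) \<in> borel_measurable (time T \<Otimes>\<^sub>M cell)"
  unfolding time_cell by (rule measurable_restrict_mono[OF assms]) auto

lemma integral_time_continuous:
  fixes g :: "real \<Rightarrow> real"
  assumes "continuous_on {0..T} g"
  shows "(LINT t|time T. g t) = integral {0..T} g" "g \<in> borel_measurable (time T)"
proof -
  have c: "continuous_on {0<..<T} g" by (rule continuous_on_subset[OF assms]) auto
  then have m: "g \<in> borel_measurable (restrict_space borel {0<..<T})"
    by (rule borel_measurable_continuous_on_restrict)
  then show "g \<in> borel_measurable (time T)"
    unfolding time_def by (simp cong: measurable_cong_sets sets_restrict_space_cong)
  have "g absolutely_integrable_on {0..T}"
    by (rule absolutely_integrable_continuous_real[OF assms])
  then have "g absolutely_integrable_on {0<..<T}"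
    by (rule set_integrable_subset) auto
  then have si: "set_integrable lborel {0<..<T} g"
    unfolding set_integrable_def
    by (subst (asm) integrable_completion) (use m in \<open>auto simp: borel_measurable_restrict_space_iff\<close>)
  have "(LINT t|time T. g t) = (LINT t:{0<..<T}|lborel. g t)"
    unfolding time_def set_lebesgue_integral_def by (subst integral_restrict_space) auto
  also have "\<dots> = integral {0<..<T} g" by (rule set_borel_integral_eq_integral(2)[OF si])
  finally show "(LINT t|time T. g t) = integral {0..T} g" by (simp add: integral_open_interval_real)
qed

interpretation time: finite_measure "time T" for T
  by (rule finite_measure_time)

interpretation time_cell: pair_sigma_finite "time T" cell for T
  by standard

lemma time_cell_iterated:
  fixes g :: "real \<times> point \<Rightarrow> real"
  assumes "integrable (time T \<Otimes>\<^sub>M cell) g"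
  shows "set_lebesgue_integral lborel ({0<..<T} \<times> Upsilon) g = (LINT t|time T. LINT \<eta>|cell. g (t, \<eta>))"
    and "(\<lambda>t. LINT \<eta>|cell. g (t, \<eta>)) \<in> borel_measurable (time T)"
  unfolding time_cell_integral
  using time_cell.integral_fst'[OF assms] time_cell.integrable_fst'[OF assms] by auto

lemma time_cell_integrable:
  fixes g :: "real \<times> point \<Rightarrow> real"
  assumes [measurable]: "g \<in> borel_measurable (time T \<Otimes>\<^sub>M cell)"
    and int: "\<And>t. 0 < t \<Longrightarrow> t < T \<Longrightarrow> integrable cell (\<lambda>\<eta>. g (t, \<eta>))"
    and K: "\<And>t. 0 < t \<Longrightarrow> t < T \<Longrightarrow> (LINT \<eta>|cell. \<bar>g (t, \<eta>)\<bar>) \<le> K"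
  shows "integrable (time T \<Otimes>\<^sub>M cell) g"
proof (rule time_cell.Fubini_integrable)
  show "integrable (time T) (\<lambda>t. LINT \<eta>|cell. norm (g (t, \<eta>)))"
  proof (rule time.integrable_const_bound[where B = K])
    show "AE t in time T. norm (LINT \<eta>|cell. norm (g (t, \<eta>))) \<le> K"
      using K by (intro AE_I2) (simp add: integral_nonneg)
    show "(\<lambda>t. LINT \<eta>|cell. norm (g (t, \<eta>))) \<in> borel_measurable (time T)"
      by (intro cell.borel_measurable_lebesgue_integral) measurable
  qed
  show "AE t in time T. integrable cell (\<lambda>\<eta>. g (t, \<eta>))"
    using int by (intro AE_I2) simp
qed measurable

text \<open>The density is a parameter integral: composing \<open>f\<close> with the map that
  replaces the angle of the point by a separate variable gives a jointly measurable
  integrand.\<close>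

lemma angular_int_time_measurable:
  assumes f: "(\<lambda>(t, \<xi>). f t \<xi>) \<in> borel_measurable (time T \<Otimes>\<^sub>M cell)"
  shows "(\<lambda>(t, \<xi>). angular_int (f t) (fst \<xi>)) \<in> borel_measurable (time T \<Otimes>\<^sub>M cell)"
proof -
  have fs: "fst \<in> measurable cell (restrict_space lborel Omega)"
    unfolding cell_eq_pair[symmetric] by (rule measurable_fst)
  have "(\<lambda>z. (fst (fst z), (fst (snd (fst z)), snd z))) \<in> measurable ((time T \<Otimes>\<^sub>M cell) \<Otimes>\<^sub>M angle) (time T \<Otimes>\<^sub>M (restrict_space lborel Omega \<Otimes>\<^sub>M angle))"
    by (intro measurable_Pair measurable_compose[OF measurable_fst] measurable_compose[OF measurable_snd] measurable_snd fs measurable_fst)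
  then have m: "(\<lambda>z. (fst (fst z), (fst (snd (fst z)), snd z))) \<in> measurable ((time T \<Otimes>\<^sub>M cell) \<Otimes>\<^sub>M angle) (time T \<Otimes>\<^sub>M cell)"
    by (simp add: cell_eq_pair)
  from measurable_compose[OF m f]
  have "(\<lambda>(p, \<theta>). f (fst p) (fst (snd p), \<theta>)) \<in> borel_measurable ((time T \<Otimes>\<^sub>M cell) \<Otimes>\<^sub>M angle)"
    by (simp add: case_prod_beta)
  from angle.borel_measurable_lebesgue_integral[OF this]
  show ?thesis by (simp add: angular_int_eq case_prod_beta)
qed

text \<open>Measurability of \<open>h\<close> comes from that of \<open>g\<close> by completeness of
  the Lebesgue measure. The pairing of the time derivative with a product test function is
  determined for almost every time only, and is known to be measurable in its simplified
  form.\<close>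

lemma integral_lebesgue_on_cong_AE:
  fixes g h :: "real \<Rightarrow> real"
  assumes S: "S \<in> sets lebesgue" and g: "g \<in> borel_measurable (lebesgue_on S)"
    and ae: "AE t in lebesgue_on S. g t = h t"
  shows "(LINT t|lebesgue_on S. h t) = (LINT t|lebesgue_on S. g t)"
proof -
  have ae': "AE t in lebesgue. indicator S t *\<^sub>R g t = indicator S t *\<^sub>R h t"
    using ae S by (subst (asm) AE_restrict_space_iff) (auto elim!: eventually_mono simp: indicator_def)
  have gm: "(\<lambda>t. indicator S t *\<^sub>R g t) \<in> borel_measurable lebesgue"
    using g S by (subst (asm) borel_measurable_restrict_space_iff) auto
  then have hm: "(\<lambda>t. indicator S t *\<^sub>R h t) \<in> borel_measurable lebesgue"
    using ae' by (rule borel_measurable_AE)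
  have "(LINT t|lebesgue. indicator S t *\<^sub>R h t) = (LINT t|lebesgue. indicator S t *\<^sub>R g t)"
    using hm gm ae' by (intro integral_cong_AE) (auto elim: eventually_mono)
  then show ?thesis using S by (simp add: integral_restrict_space)
qed

section \<open>The weak formulation tested with cosines\<close>

lemma L2_H1_grad_cos_inner:
  fixes \<psi> :: "real \<Rightarrow> real"
  assumes m: "m \<in> lattice" and \<psi>: "continuous_on UNIV \<psi>"
  shows "L2_H1_grad T (\<lambda>t \<xi>. \<psi> t * cos (m \<bullet> \<xi> + a)) (\<lambda>t \<xi>. (- \<psi> t * sin (m \<bullet> \<xi> + a)) *\<^sub>R m)"
  unfolding L2_H1_grad_def
proof (intro conjI)
  have c: "continuous_on UNIV (\<lambda>p. \<psi> (fst p))"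
    by (rule continuous_on_compose2[OF \<psi>]) (auto intro!: continuous_intros)
  show "(\<lambda>(t, \<xi>). \<psi> t * cos (m \<bullet> \<xi> + a)) \<in> borel_measurable (restrict_space lborel ({0<..<T} \<times> UNIV))"
    unfolding case_prod_beta
    by (rule measurable_restrict_space1, unfold measurable_lborel2, rule borel_measurable_continuous_onI, intro continuous_intros c)
  show "(\<lambda>(t, \<xi>). (- \<psi> t * sin (m \<bullet> \<xi> + a)) *\<^sub>R m) \<in> borel_measurable (restrict_space lborel ({0<..<T} \<times> UNIV))"
    unfolding case_prod_beta
    by (rule measurable_restrict_space1, unfold measurable_lborel2, rule borel_measurable_continuous_onI, intro continuous_intros c)
  show "AE t in lborel. t \<in> {0<..<T} \<longrightarrow> H1_grad (\<lambda>\<xi>. \<psi> t * cos (m \<bullet> \<xi> + a)) (\<lambda>\<xi>. (- \<psi> t * sin (m \<bullet> \<xi> + a)) *\<^sub>R m)"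
    by (intro AE_I2 impI H1_grad_cos_inner[OF m])
  have c2: "continuous_on UNIV (\<lambda>p. (\<psi> (fst p) * cos (m \<bullet> snd p + a))\<^sup>2 + (norm ((- \<psi> (fst p) * sin (m \<bullet> snd p + a)) *\<^sub>R m))\<^sup>2)"
    by (intro continuous_intros c)
  show "set_integrable lborel ({0<..<T} \<times> Upsilon)
     (\<lambda>(t, \<xi>). (\<psi> t * cos (m \<bullet> \<xi> + a))\<^sup>2 + (norm ((- \<psi> t * sin (m \<bullet> \<xi> + a)) *\<^sub>R m))\<^sup>2)"
  proof (rule set_integrable_subset)
    have "compact ({0..T} \<times> period_box)" by (intro compact_Times) auto
    then show "set_integrable lborel ({0..T} \<times> period_box)
     (\<lambda>(t, \<xi>). (\<psi> t * cos (m \<bullet> \<xi> + a))\<^sup>2 + (norm ((- \<psi> t * sin (m \<bullet> \<xi> + a)) *\<^sub>R m))\<^sup>2)"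
      unfolding set_integrable_def case_prod_beta
      by (rule borel_integrable_compact) (rule continuous_on_subset[OF c2], simp)
    show "{0<..<T} \<times> Upsilon \<in> sets lborel" by (simp add: borel_open open_Times)
    show "{0<..<T} \<times> Upsilon \<subseteq> {0..T} \<times> period_box"
      unfolding Upsilon_eq_box using box_subset_cbox[of "((0,0),0)" "((2*pi,2*pi),2*pi)"] by force
  qed
qed

text \<open>The sine of the same phase, used as test function in the definition of the weak
  gradient, shows that diffusion multiplies a Fourier coefficient by an eigenvalue. The x- and
  \<theta>-parts stay separate because they carry different diffusivities.\<close>

lemma H1_grad_cos_identity:
  assumes g: "H1_grad u g" and m: "m \<in> lattice"
  shows "(LINT \<xi>|cell. fst (g \<xi>) \<bullet> fst ((- sin (m \<bullet> \<xi> + a)) *\<^sub>R m)) = fst m \<bullet> fst m * (LINT \<xi>|cell. u \<xi> * cos (m \<bullet> \<xi> + a))"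
    and "(LINT \<xi>|cell. snd (g \<xi>) * snd ((- sin (m \<bullet> \<xi> + a)) *\<^sub>R m)) = (snd m)\<^sup>2 * (LINT \<xi>|cell. u \<xi> * cos (m \<bullet> \<xi> + a))"
proof -
  let ?s = "\<lambda>\<xi>. 1 * cos (m \<bullet> \<xi> + (a - pi / 2))"
  have s: "?s \<xi> = sin (m \<bullet> \<xi> + a)" for \<xi> by (simp add: cos_add sin_add cos_diff sin_diff)
  have pd: "partial_deriv i ?s \<xi> = (m \<bullet> i) * cos (m \<bullet> \<xi> + a)" for i \<xi>
    unfolding partial_deriv_cos_inner by simp
  have "?s \<in> smooth_per" by (rule cos_inner_smooth_per[OF m])
  then have *: "(LINT \<xi>|cell. u \<xi> * partial_deriv i ?s \<xi>) = - (LINT \<xi>|cell. (g \<xi> \<bullet> i) * ?s \<xi>)" if "i \<in> Basis" for i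
    using g that unfolding H1_grad_def set_integral_Upsilon by blast
  then have 1: "(LINT \<xi>|cell. (g \<xi> \<bullet> i) * sin (m \<bullet> \<xi> + a)) = - (m \<bullet> i) * (LINT \<xi>|cell. u \<xi> * cos (m \<bullet> \<xi> + a))" if "i \<in> Basis" for i
  proof -
    have "(LINT \<xi>|cell. u \<xi> * ((m \<bullet> i) * cos (m \<bullet> \<xi> + a))) = - (LINT \<xi>|cell. (g \<xi> \<bullet> i) * sin (m \<bullet> \<xi> + a))"
      using *[OF that] unfolding pd unfolding s .
    moreover have "(LINT \<xi>|cell. u \<xi> * ((m \<bullet> i) * cos (m \<bullet> \<xi> + a))) = (m \<bullet> i) * (LINT \<xi>|cell. u \<xi> * cos (m \<bullet> \<xi> + a))"
      by (subst integral_mult_right_zero[symmetric]) (simp add: mult.left_commute)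
    ultimately show ?thesis by simp
  qed
  have gL: "g \<in> borel_measurable lborel" "integrable cell (\<lambda>\<xi>. (norm (g \<xi>))\<^sup>2)"
    using g by (auto simp: H1_grad_def L2_per_def set_integrable_Upsilon)
  have [measurable]: "g \<in> borel_measurable cell" using gL(1) by (rule measurable_cell)
  have [measurable]: "(\<lambda>\<xi>. sin (m \<bullet> \<xi> + a)) \<in> borel_measurable cell"
    by (intro measurable_cell) (auto intro!: borel_measurable_continuous_onI continuous_intros)
  have gi: "integrable cell (\<lambda>\<xi>. norm (g \<xi>))"
    by (rule cell.square_integrable_imp_integrable[OF _ gL(2)]) measurable
  have int: "integrable cell (\<lambda>\<xi>. (g \<xi> \<bullet> i) * sin (m \<bullet> \<xi> + a))" if "i \<in> Basis" for i
  proof (rule Bochner_Integration.integrable_bound[OF gi])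
    have "\<bar>g \<xi> \<bullet> i\<bar> * \<bar>sin (m \<bullet> \<xi> + a)\<bar> \<le> norm (g \<xi>) * 1" for \<xi>
      using Basis_le_norm[OF that, of "g \<xi>"] by (intro mult_mono) auto
    then show "AE \<xi> in cell. norm (g \<xi> \<bullet> i * sin (m \<bullet> \<xi> + a)) \<le> norm (norm (g \<xi>))"
      by (intro AE_I2) (simp add: abs_mult)
  qed measurable
  let ?i1 = "((1, 0), 0) :: point" and ?i2 = "((0, 1), 0) :: point" and ?i3 = "((0, 0), 1) :: point"
  have B: "?i1 \<in> Basis" "?i2 \<in> Basis" "?i3 \<in> Basis" by (auto simp: Basis_prod_def zero_prod_def)
  have "(LINT \<xi>|cell. fst (g \<xi>) \<bullet> fst ((- sin (m \<bullet> \<xi> + a)) *\<^sub>R m))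
      = (LINT \<xi>|cell. - (m \<bullet> ?i1) * ((g \<xi> \<bullet> ?i1) * sin (m \<bullet> \<xi> + a)) + - (m \<bullet> ?i2) * ((g \<xi> \<bullet> ?i2) * sin (m \<bullet> \<xi> + a)))"
    by (intro Bochner_Integration.integral_cong refl) (simp add: inner_prod_def algebra_simps)
  also have "\<dots> = - (m \<bullet> ?i1) * (LINT \<xi>|cell. (g \<xi> \<bullet> ?i1) * sin (m \<bullet> \<xi> + a)) + - (m \<bullet> ?i2) * (LINT \<xi>|cell. (g \<xi> \<bullet> ?i2) * sin (m \<bullet> \<xi> + a))"
    using int[OF B(1)] int[OF B(2)] by (subst Bochner_Integration.integral_add) (auto simp del: integral_mult_right_zero simp: integral_mult_right_zero)
  also have "\<dots> = fst m \<bullet> fst m * (LINT \<xi>|cell. u \<xi> * cos (m \<bullet> \<xi> + a))"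
    unfolding 1[OF B(1)] 1[OF B(2)] by (cases m) (auto simp: inner_prod_def algebra_simps)
  finally show "(LINT \<xi>|cell. fst (g \<xi>) \<bullet> fst ((- sin (m \<bullet> \<xi> + a)) *\<^sub>R m)) = fst m \<bullet> fst m * (LINT \<xi>|cell. u \<xi> * cos (m \<bullet> \<xi> + a))" .
  have "(LINT \<xi>|cell. snd (g \<xi>) * snd ((- sin (m \<bullet> \<xi> + a)) *\<^sub>R m)) = (LINT \<xi>|cell. - (m \<bullet> ?i3) * ((g \<xi> \<bullet> ?i3) * sin (m \<bullet> \<xi> + a)))"
    by (intro Bochner_Integration.integral_cong refl) (simp add: inner_prod_def algebra_simps)
  also have "\<dots> = (snd m)\<^sup>2 * (LINT \<xi>|cell. u \<xi> * cos (m \<bullet> \<xi> + a))"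
    unfolding integral_mult_right_zero 1[OF B(3)] by (simp add: inner_prod_def power2_eq_square)
  finally show "(LINT \<xi>|cell. snd (g \<xi>) * snd ((- sin (m \<bullet> \<xi> + a)) *\<^sub>R m)) = (snd m)\<^sup>2 * (LINT \<xi>|cell. u \<xi> * cos (m \<bullet> \<xi> + a))" .
qed


text \<open>The eigenvalue of - (D_e \<Delta> + \<partial>_\<theta>^2) at frequency
  \<open>m\<close>.\<close>

abbreviation decay :: "real \<Rightarrow> point \<Rightarrow> real" where
  "decay De m \<equiv> De * (fst m \<bullet> fst m) + (snd m)\<^sup>2"

text \<open>The coefficient of div((1 - \<rho>) u e) against cos(m \<bullet> \<eta> + a), with the
  divergence moved onto the cosine.\<close>

abbreviation flux_coeff :: "(point \<Rightarrow> real) \<Rightarrow> point \<Rightarrow> real \<Rightarrow> real" where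
  "flux_coeff u m a \<equiv> fst (fst m) * (LINT \<eta>|cell. flux u cos \<eta> * sin (m \<bullet> \<eta> + a))
     + snd (fst m) * (LINT \<eta>|cell. flux u sin \<eta> * sin (m \<bullet> \<eta> + a))"

lemma trig_measurable_bounded:
  fixes m :: point
  shows "(\<lambda>\<eta>. cos (m \<bullet> \<eta> + a)) \<in> borel_measurable cell" "(\<lambda>\<eta>. sin (m \<bullet> \<eta> + a)) \<in> borel_measurable cell"
  by (intro measurable_cell; auto intro!: borel_measurable_continuous_onI continuous_intros)+

lemma C_L2_coeff_continuous:
  assumes f: "C_L2 T f"
  shows "continuous_on {0..T} (\<lambda>t. LINT \<eta>|cell. f t \<eta> * cos (m \<bullet> \<eta> + a))"
    and "continuous_on {0..T} (\<lambda>t. flux_coeff (f t) m a)"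
proof -
  note cs = continuous_on_cos[OF continuous_on_id, of UNIV, unfolded id_def] continuous_on_sin[OF continuous_on_id, of UNIV, unfolded id_def]
  show "continuous_on {0..T} (\<lambda>t. LINT \<eta>|cell. f t \<eta> * cos (m \<bullet> \<eta> + a))"
    by (rule L1_continuous_kernel[where K = 1])
      (auto intro: L2_perD(4)[OF C_L2_D(1)[OF f]] C_L2_L1_limit[OF f] trig_measurable_bounded)
  have fc: "continuous_on {0..T} (\<lambda>t. LINT \<eta>|cell. flux (f t) b \<eta> * sin (m \<bullet> \<eta> + a))"
    if b: "continuous_on UNIV b" "\<And>\<theta>. \<bar>b \<theta>\<bar> \<le> 1" for b
  proof (rule L1_continuous_kernel[where K = 1])
    show "integrable cell (flux (f t) b)" if "t \<in> {0..T}" for t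
      by (rule flux_L1(1)[OF C_L2_D(1)[OF f that] b])
    show "((\<lambda>s. LINT \<eta>|cell. \<bar>flux (f s) b \<eta> - flux (f t) b \<eta>\<bar>) \<longlongrightarrow> 0) (at t within {0..T})" if "t \<in> {0..T}" for t
      by (rule C_L2_flux_limit[OF f that b])
  qed (auto intro: trig_measurable_bounded)
  show "continuous_on {0..T} (\<lambda>t. flux_coeff (f t) m a)"
    by (intro continuous_on_add continuous_on_mult continuous_on_const fc[OF cs(1) abs_cos_le_one] fc[OF cs(2) abs_sin_le_one])
qed

lemma flux_time_integrable:
  fixes k :: "real \<Rightarrow> point \<Rightarrow> real"
  assumes f: "C_L2 T f" and fm: "(\<lambda>(t, \<xi>). f t \<xi>) \<in> borel_measurable (time T \<Otimes>\<^sub>M cell)"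
    and b: "continuous_on UNIV b" "\<And>\<theta>. \<bar>b \<theta>\<bar> \<le> 1"
    and k: "(\<lambda>(t, \<xi>). k t \<xi>) \<in> borel_measurable (time T \<Otimes>\<^sub>M cell)" "\<And>t. k t \<in> borel_measurable cell"
    and K: "\<And>t \<xi>. 0 < t \<Longrightarrow> t < T \<Longrightarrow> \<bar>k t \<xi>\<bar> \<le> K"
  shows "integrable (time T \<Otimes>\<^sub>M cell) (\<lambda>(t, \<xi>). flux (f t) b \<xi> * k t \<xi>)"
proof -
  obtain L where L: "\<And>t. t \<in> {0..T} \<Longrightarrow> L2_norm (f t) \<le> L"
    using C_L2_bounded[OF f] by blast
  have bm: "(\<lambda>p. b (snd (snd p))) \<in> borel_measurable (time T \<Otimes>\<^sub>M cell)"
  proof -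
    have "(\<lambda>\<eta>. b (snd \<eta>)) \<in> borel_measurable cell"
      by (intro measurable_cell)
        (auto intro!: borel_measurable_continuous_onI continuous_on_compose2[OF b(1)] continuous_intros)
    from measurable_compose[OF measurable_snd this] show ?thesis .
  qed
  note [measurable] = bm fm[unfolded case_prod_beta] angular_int_time_measurable[OF fm, unfolded case_prod_beta] k(1)[unfolded case_prod_beta]
  show ?thesis
  proof (rule time_cell_integrable[where K = "K * (sqrt (2 * (2 * pi) ^ 3 + 2 * (2 * pi * L)\<^sup>2) * L)"])
    show "(\<lambda>(t, \<xi>). flux (f t) b \<xi> * k t \<xi>) \<in> borel_measurable (time T \<Otimes>\<^sub>M cell)"
      unfolding flux_def case_prod_beta by measurable
    fix t assume t: "0 < t" "t < T"
    then have ft: "f t \<in> L2_per" and Lt: "L2_norm (f t) \<le> L" and K0: "0 \<le> K"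
      using C_L2_D(1)[OF f, of t] L[of t] order_trans[OF abs_ge_zero K[OF t]] by auto
    note fl = flux_L1[OF ft b]
    have le: "\<bar>flux (f t) b \<xi> * k t \<xi>\<bar> \<le> K * \<bar>flux (f t) b \<xi>\<bar>" for \<xi>
      using mult_right_mono[OF K[OF t, of \<xi>] abs_ge_zero[of "flux (f t) b \<xi>"]] by (simp add: abs_mult mult.commute)
    have i: "integrable cell (\<lambda>\<xi>. flux (f t) b \<xi> * k t \<xi>)"
    proof (rule Bochner_Integration.integrable_bound)
      show "integrable cell (\<lambda>\<xi>. K * \<bar>flux (f t) b \<xi>\<bar>)" using fl(1) by simp
      have "flux (f t) b \<in> borel_measurable cell" using fl(1) by auto
      then show "(\<lambda>\<xi>. flux (f t) b \<xi> * k t \<xi>) \<in> borel_measurable cell"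
        using k(2) by measurable
      show "AE \<xi> in cell. norm (flux (f t) b \<xi> * k t \<xi>) \<le> norm (K * \<bar>flux (f t) b \<xi>\<bar>)"
        using le K0 by (intro AE_I2) (simp add: abs_mult)
    qed
    then show "integrable cell (\<lambda>\<eta>. case (t, \<eta>) of (t, \<xi>) \<Rightarrow> flux (f t) b \<xi> * k t \<xi>)" by simp
    have "(LINT \<eta>|cell. \<bar>flux (f t) b \<eta> * k t \<eta>\<bar>) \<le> (LINT \<eta>|cell. K * \<bar>flux (f t) b \<eta>\<bar>)"
      using i fl(1) le by (intro integral_mono) auto
    also have "\<dots> = K * (LINT \<eta>|cell. \<bar>flux (f t) b \<eta>\<bar>)" by simp
    also have "\<dots> \<le> K * (vacancy_norm (f t) * L2_norm (f t))"
      using fl(2) K0 by (intro mult_left_mono)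
    also have "\<dots> \<le> K * (sqrt (2 * (2 * pi) ^ 3 + 2 * (2 * pi * L)\<^sup>2) * L)"
    proof (intro mult_left_mono mult_mono Lt K0 L2_norm_nonneg)
      have "(2 * pi * L2_norm (f t))\<^sup>2 \<le> (2 * pi * L)\<^sup>2"
        using Lt L2_norm_nonneg[of "f t"] by (intro power_mono mult_left_mono) auto
      then show "vacancy_norm (f t) \<le> sqrt (2 * (2 * pi) ^ 3 + 2 * (2 * pi * L)\<^sup>2)"
        by (intro order_trans[OF vacancy_norm_le[OF ft]] real_sqrt_le_mono) simp
    qed simp
    finally show "(LINT \<eta>|cell. \<bar>case (t, \<eta>) of (t, \<xi>) \<Rightarrow> flux (f t) b \<xi> * k t \<xi>\<bar>)
        \<le> K * (sqrt (2 * (2 * pi) ^ 3 + 2 * (2 * pi * L)\<^sup>2) * L)"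
      by simp
  qed
qed


text \<open>Test functions that are products of a smooth function of time and a cosine reduce the
  weak formulation to a distributional differential equation for one coefficient. Its right-hand
  side is continuous in time, so the equation holds classically. The free phase \<open>a\<close>
  covers cosine and sine coefficients at once.\<close>

lemma weak_solution_coeff_deriv:
  assumes sol: "weak_solution Pe De f0 T f" and m: "m \<in> lattice" and t0: "0 < t0" "t0 < T"
  shows "((\<lambda>t. LINT \<eta>|cell. f t \<eta> * cos (m \<bullet> \<eta> + a)) has_real_derivative
    - decay De m * (LINT \<eta>|cell. f t0 \<eta> * cos (m \<bullet> \<eta> + a)) - Pe * flux_coeff (f t0) m a) (at t0)"
proof -
  from sol obtain G F where f: "C_L2 T f" and G: "L2_H1_grad T f G" and F: "L2_H1_dual T F"
    and FD: "is_time_deriv T f F"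
    and weak: "\<And>\<phi> \<Phi>. L2_H1_grad T \<phi> \<Phi> \<Longrightarrow>
           (LINT t|lebesgue_on {0<..<T}. F t (\<phi> t)) =
             Pe * set_lebesgue_integral lborel ({0<..<T} \<times> Upsilon)
               (\<lambda>(t, x, \<theta>). (1 - angular_int (f t) x) * f t (x, \<theta>) * (e_dir \<theta> \<bullet> fst (\<Phi> t (x, \<theta>))))
             - De * set_lebesgue_integral lborel ({0<..<T} \<times> Upsilon)
               (\<lambda>(t, \<xi>). fst (G t \<xi>) \<bullet> fst (\<Phi> t \<xi>))
             - set_lebesgue_integral lborel ({0<..<T} \<times> Upsilon)
               (\<lambda>(t, \<xi>). snd (G t \<xi>) * snd (\<Phi> t \<xi>))"
    unfolding weak_solution_def Let_def by blast
  define v where "v = (\<lambda>\<xi>. cos (m \<bullet> \<xi> + a))"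
  define vg where "vg = (\<lambda>\<xi>. (- sin (m \<bullet> \<xi> + a)) *\<^sub>R m)"
  define c where "c t = (LINT \<eta>|cell. f t \<eta> * cos (m \<bullet> \<eta> + a))" for t
  have vH: "v \<in> H1_per"
    using H1_grad_cos_inner[OF m, of 1 a] unfolding v_def H1_per_def by auto
  note cont = C_L2_coeff_continuous[OF f, of m a, folded c_def]
  have fm: "(\<lambda>(t, \<xi>). f t \<xi>) \<in> borel_measurable (time T \<Otimes>\<^sub>M cell)"
    and Gm: "(\<lambda>(t, \<xi>). G t \<xi>) \<in> borel_measurable (time T \<Otimes>\<^sub>M cell)"
    using G unfolding L2_H1_grad_def by (auto intro: measurable_time_cell)
  have GH: "AE t in time T. H1_grad (f t) (G t)"
    using G unfolding L2_H1_grad_def time_def by (subst AE_restrict_space_iff) auto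
  have Gi: "integrable (time T \<Otimes>\<^sub>M cell) (\<lambda>(t, \<xi>). (f t \<xi>)\<^sup>2 + (norm (G t \<xi>))\<^sup>2)"
    using G unfolding L2_H1_grad_def time_cell_integral(2) by blast
  interpret TC: finite_measure "time T \<Otimes>\<^sub>M cell"
  proof
    have "emeasure (time T \<Otimes>\<^sub>M cell) (space (time T) \<times> space cell) = emeasure (time T) (space (time T)) * emeasure cell (space cell)"
      by (rule cell.emeasure_pair_measure_Times[OF sets.top sets.top])
    then show "emeasure (time T \<Otimes>\<^sub>M cell) (space (time T \<Otimes>\<^sub>M cell)) \<noteq> \<infinity>"
      unfolding space_pair_measure
      by (simp add: ennreal_mult_eq_top_iff time.emeasure_finite cell.emeasure_finite del: space_time space_cell)
  qed
  have key: "(LINT t|lebesgue_on {0<..<T}. deriv \<psi> t * c t) =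
      - (LINT t|lebesgue_on {0<..<T}. \<psi> t * (- decay De m * c t - Pe * flux_coeff (f t) m a))"
    if \<psi>: "\<psi> \<in> smooth_cpt {0<..<T}" for \<psi>
  proof -
    have sm: "smooth \<psi>" using \<psi> by (simp add: smooth_cpt_def)
    have \<psi>c: "continuous_on A \<psi>" for A
      using smooth_real_deriv(1)[OF sm] by (blast intro: continuous_at_imp_continuous_on DERIV_isCont)
    have "bounded (\<psi> ` {0..T})"
      by (intro compact_imp_bounded compact_continuous_image \<psi>c) auto
    then obtain P where "\<forall>t\<in>{0..T}. norm (\<psi> t) \<le> P" by (auto simp: bounded_iff)
    then have P: "\<bar>\<psi> t\<bar> \<le> P" if "0 < t" "t < T" for t using that by simp
    have \<psi>m: "(\<lambda>p. \<psi> (fst p)) \<in> borel_measurable (time T \<Otimes>\<^sub>M cell)"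
      by (rule measurable_compose[OF measurable_fst integral_time_continuous(2)[OF \<psi>c]])
    have sm': "(\<lambda>p. sin (m \<bullet> snd p + a)) \<in> borel_measurable (time T \<Otimes>\<^sub>M cell)"
      by (rule measurable_compose[OF measurable_snd trig_measurable_bounded(2)])
    have ks: "\<bar>\<psi> t * sin (m \<bullet> \<xi> + a)\<bar> \<le> P" if "0 < t" "t < T" for t \<xi>
    proof -
      have "\<bar>\<psi> t\<bar> * \<bar>sin (m \<bullet> \<xi> + a)\<bar> \<le> P * 1"
        using P[OF that] order_trans[OF abs_ge_zero P[OF that]] by (intro mult_mono) auto
      then show ?thesis by (simp add: abs_mult)
    qed
    define \<Phi> where "\<Phi> t \<xi> = (- \<psi> t * sin (m \<bullet> \<xi> + a)) *\<^sub>R m" for t \<xi>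
    have Lg: "L2_H1_grad T (\<lambda>t \<xi>. \<psi> t * v \<xi>) \<Phi>"
      unfolding \<Phi>_def v_def by (rule L2_H1_grad_cos_inner[OF m \<psi>c])
    have \<Phi>vg: "\<Phi> t \<xi> = \<psi> t *\<^sub>R vg \<xi>" for t \<xi>
      by (simp add: \<Phi>_def vg_def)
    let ?X = "\<lambda>b (t, \<xi>). flux (f t) b \<xi> * (\<psi> t * sin (m \<bullet> \<xi> + a))"
    have fi: "integrable (time T \<Otimes>\<^sub>M cell) (?X b)" if "continuous_on UNIV b" "\<And>\<theta>. \<bar>b \<theta>\<bar> \<le> 1" for b
    proof (rule flux_time_integrable[OF f fm that _ _ ks])
      show "(\<lambda>(t, \<xi>). \<psi> t * sin (m \<bullet> \<xi> + a)) \<in> borel_measurable (time T \<Otimes>\<^sub>M cell)"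
        unfolding case_prod_beta by (intro borel_measurable_times \<psi>m sm')
      show "(\<lambda>\<xi>. \<psi> t * sin (m \<bullet> \<xi> + a)) \<in> borel_measurable cell" for t
        by (intro borel_measurable_times trig_measurable_bounded) simp
    qed
    have fi': "integrable (time T \<Otimes>\<^sub>M cell) (?X cos)" "integrable (time T \<Otimes>\<^sub>M cell) (?X sin)"
      by (intro fi continuous_on_cos continuous_on_sin continuous_on_id; simp)+
    define Y where "Y p = - fst (fst m) * ?X cos p + - snd (fst m) * ?X sin p" for p
    have Yi: "integrable (time T \<Otimes>\<^sub>M cell) Y"
      unfolding Y_def using fi' by simp
    have Yeq: "(\<lambda>(t, x, \<theta>). (1 - angular_int (f t) x) * f t (x, \<theta>) * (e_dir \<theta> \<bullet> fst (\<Phi> t (x, \<theta>)))) = Y"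
      by (auto simp: fun_eq_iff Y_def \<Phi>_def flux_def e_dir_def inner_prod_def algebra_simps)
    have fx: "integrable cell (\<lambda>\<eta>. flux (f t) b \<eta> * sin (m \<bullet> \<eta> + a))"
      if "0 < t" "t < T" "continuous_on UNIV b" "\<And>\<theta>. \<bar>b \<theta>\<bar> \<le> 1" for t b
    proof (rule Bochner_Integration.integrable_bound[OF flux_L1(1)[OF C_L2_D(1)[OF f] that(3,4)]])
      show "t \<in> {0..T}" using that by simp
      have "flux (f t) b \<in> borel_measurable cell"
        using flux_L1(1)[OF C_L2_D(1)[OF f] that(3,4), of t] that by auto
      then show "(\<lambda>\<eta>. flux (f t) b \<eta> * sin (m \<bullet> \<eta> + a)) \<in> borel_measurable cell"
        by (intro borel_measurable_times trig_measurable_bounded)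
    qed (simp add: abs_mult mult_left_le)
    have "(LINT \<eta>|cell. Y (t, \<eta>)) = - (\<psi> t * flux_coeff (f t) m a)" if "0 < t" "t < T" for t
    proof -
      have fx': "integrable cell (\<lambda>\<eta>. flux (f t) cos \<eta> * sin (m \<bullet> \<eta> + a))"
        "integrable cell (\<lambda>\<eta>. flux (f t) sin \<eta> * sin (m \<bullet> \<eta> + a))"
        by (intro fx that continuous_on_cos continuous_on_sin continuous_on_id; simp)+
      have "(LINT \<eta>|cell. Y (t, \<eta>)) = (LINT \<eta>|cell. (- fst (fst m) * \<psi> t) * (flux (f t) cos \<eta> * sin (m \<bullet> \<eta> + a))
          + (- snd (fst m) * \<psi> t) * (flux (f t) sin \<eta> * sin (m \<bullet> \<eta> + a)))"
        unfolding Y_def by (intro Bochner_Integration.integral_cong refl) (simp add: algebra_simps)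
      also have "\<dots> = (LINT \<eta>|cell. (- fst (fst m) * \<psi> t) * (flux (f t) cos \<eta> * sin (m \<bullet> \<eta> + a)))
          + (LINT \<eta>|cell. (- snd (fst m) * \<psi> t) * (flux (f t) sin \<eta> * sin (m \<bullet> \<eta> + a)))"
        by (intro Bochner_Integration.integral_add integrable_mult_right fx')
      also have "\<dots> = - (\<psi> t * flux_coeff (f t) m a)"
        unfolding integral_mult_right_zero by (simp add: algebra_simps)
      finally show ?thesis .
    qed
    then have "(LINT t|time T. LINT \<eta>|cell. Y (t, \<eta>)) = (LINT t|time T. - (\<psi> t * flux_coeff (f t) m a))"
      by (intro Bochner_Integration.integral_cong refl) simp
    then have I1: "set_lebesgue_integral lborel ({0<..<T} \<times> Upsilon) Y = integral {0..T} (\<lambda>t. - (\<psi> t * flux_coeff (f t) m a))"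
      unfolding time_cell_iterated(1)[OF Yi]
      by (simp only:) (intro integral_time_continuous(1) continuous_on_minus continuous_on_mult \<psi>c cont)
    \<comment> \<open>Both diffusion terms have this shape, \<open>\<kappa>\<close> being their
      share of the eigenvalue. The bound by the gradient gives integrability on the cylinder; the
      value is computed at almost every time.\<close>
    have diff: "set_lebesgue_integral lborel ({0<..<T} \<times> Upsilon) Z = integral {0..T} (\<lambda>t. \<psi> t * (\<kappa> * c t))"
      if Zm: "Z \<in> borel_measurable (time T \<Otimes>\<^sub>M cell)"
        and Zb: "\<And>t \<xi>. 0 < t \<Longrightarrow> t < T \<Longrightarrow> \<bar>Z (t, \<xi>)\<bar> \<le> norm (G t \<xi>) * (P * norm m)"
        and Zi: "\<And>t. H1_grad (f t) (G t) \<Longrightarrow> (LINT \<eta>|cell. Z (t, \<eta>)) = \<psi> t * (\<kappa> * c t)" for Z \<kappa>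
    proof -
      have Zint: "integrable (time T \<Otimes>\<^sub>M cell) Z"
      proof (rule Bochner_Integration.integrable_bound)
        show "integrable (time T \<Otimes>\<^sub>M cell) (\<lambda>(t, \<xi>). (P * norm m)\<^sup>2 + ((f t \<xi>)\<^sup>2 + (norm (G t \<xi>))\<^sup>2))"
          using Gi unfolding case_prod_beta by simp
        show "AE p in time T \<Otimes>\<^sub>M cell. norm (Z p) \<le> norm (case p of (t, \<xi>) \<Rightarrow> (P * norm m)\<^sup>2 + ((f t \<xi>)\<^sup>2 + (norm (G t \<xi>))\<^sup>2))"
        proof (rule AE_I2)
          fix p assume "p \<in> space (time T \<Otimes>\<^sub>M cell)"
          then obtain t \<xi> where p: "p = (t, \<xi>)" "0 < t" "t < T" by (auto simp: space_pair_measure)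
          have "\<bar>Z (t, \<xi>)\<bar> \<le> norm (G t \<xi>) * (P * norm m)" by (rule Zb[OF p(2,3)])
          also have "\<dots> \<le> (P * norm m)\<^sup>2 + ((f t \<xi>)\<^sup>2 + (norm (G t \<xi>))\<^sup>2)"
            using sum_squares_bound[of "norm (G t \<xi>)" "P * norm m"] zero_le_power2[of "f t \<xi>"]
              zero_le_power2[of "norm (G t \<xi>)"] zero_le_power2[of "P * norm m"]
            unfolding mult.assoc by linarith
          finally show "norm (Z p) \<le> norm (case p of (t, \<xi>) \<Rightarrow> (P * norm m)\<^sup>2 + ((f t \<xi>)\<^sup>2 + (norm (G t \<xi>))\<^sup>2))"
            by (simp add: p)
        qed
      qed (rule Zm)
      have "(LINT t|time T. LINT \<eta>|cell. Z (t, \<eta>)) = (LINT t|time T. \<psi> t * (\<kappa> * c t))"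
      proof (rule integral_cong_AE)
        show "(\<lambda>t. LINT \<eta>|cell. Z (t, \<eta>)) \<in> borel_measurable (time T)"
          by (rule time_cell_iterated(2)[OF Zint])
        show "(\<lambda>t. \<psi> t * (\<kappa> * c t)) \<in> borel_measurable (time T)"
          by (intro integral_time_continuous(2) continuous_on_mult continuous_on_const \<psi>c cont)
        show "AE t in time T. (LINT \<eta>|cell. Z (t, \<eta>)) = \<psi> t * (\<kappa> * c t)"
          using GH by eventually_elim (rule Zi)
      qed
      also have "\<dots> = integral {0..T} (\<lambda>t. \<psi> t * (\<kappa> * c t))"
        by (intro integral_time_continuous(1) continuous_on_mult continuous_on_const \<psi>c cont)
      finally show ?thesis unfolding time_cell_iterated(1)[OF Zint] .
    qed
    have Gm1: "(\<lambda>p. fst (G (fst p) (snd p))) \<in> borel_measurable (time T \<Otimes>\<^sub>M cell)"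
      "(\<lambda>p. snd (G (fst p) (snd p))) \<in> borel_measurable (time T \<Otimes>\<^sub>M cell)"
      using measurable_compose[OF Gm[unfolded case_prod_beta] borel_measurable_continuous_onI[OF continuous_on_fst[OF continuous_on_id]]]
        measurable_compose[OF Gm[unfolded case_prod_beta] borel_measurable_continuous_onI[OF continuous_on_snd[OF continuous_on_id]]]
      by simp_all
    have \<Phi>m: "(\<lambda>p. fst (\<Phi> (fst p) (snd p))) \<in> borel_measurable (time T \<Otimes>\<^sub>M cell)"
      "(\<lambda>p. snd (\<Phi> (fst p) (snd p))) \<in> borel_measurable (time T \<Otimes>\<^sub>M cell)"
      unfolding \<Phi>_def fst_scaleR snd_scaleR
      by (intro borel_measurable_scaleR borel_measurable_times borel_measurable_uminus \<psi>m sm' borel_measurable_const)+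
    have \<Phi>le: "norm (\<Phi> t \<xi>) \<le> P * norm m" if "0 < t" "t < T" for t \<xi>
      using ks[OF that, of \<xi>] unfolding \<Phi>_def by (simp add: abs_mult mult_right_mono)
    have I2: "set_lebesgue_integral lborel ({0<..<T} \<times> Upsilon) (\<lambda>(t, \<xi>). fst (G t \<xi>) \<bullet> fst (\<Phi> t \<xi>))
        = integral {0..T} (\<lambda>t. \<psi> t * (fst m \<bullet> fst m * c t))"
    proof (rule diff)
      show "(\<lambda>(t, \<xi>). fst (G t \<xi>) \<bullet> fst (\<Phi> t \<xi>)) \<in> borel_measurable (time T \<Otimes>\<^sub>M cell)"
        unfolding case_prod_beta by (intro borel_measurable_inner Gm1 \<Phi>m)
      fix t \<xi>
      show "\<bar>case (t, \<xi>) of (t, \<xi>) \<Rightarrow> fst (G t \<xi>) \<bullet> fst (\<Phi> t \<xi>)\<bar> \<le> norm (G t \<xi>) * (P * norm m)" if "0 < t" "t < T"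
      proof -
        have "\<bar>fst (G t \<xi>) \<bullet> fst (\<Phi> t \<xi>)\<bar> \<le> norm (fst (G t \<xi>)) * norm (fst (\<Phi> t \<xi>))" by (rule Cauchy_Schwarz_ineq2)
        also have "\<dots> \<le> norm (G t \<xi>) * norm (\<Phi> t \<xi>)"
          using norm_fst_le[of "fst (G t \<xi>)" "snd (G t \<xi>)"] norm_fst_le[of "fst (\<Phi> t \<xi>)" "snd (\<Phi> t \<xi>)"]
          by (intro mult_mono) auto
        also have "\<dots> \<le> norm (G t \<xi>) * (P * norm m)" by (intro mult_left_mono \<Phi>le that) simp
        finally show ?thesis by simp
      qed
      show "(LINT \<eta>|cell. (case (t, \<eta>) of (t, \<xi>) \<Rightarrow> fst (G t \<xi>) \<bullet> fst (\<Phi> t \<xi>))) = \<psi> t * (fst m \<bullet> fst m * c t)" if "H1_grad (f t) (G t)"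
      proof -
        have "(LINT \<eta>|cell. fst (G t \<eta>) \<bullet> fst (\<Phi> t \<eta>)) = (LINT \<eta>|cell. \<psi> t * (fst (G t \<eta>) \<bullet> fst (vg \<eta>)))"
          by (intro Bochner_Integration.integral_cong refl) (simp add: \<Phi>vg)
        also have "\<dots> = \<psi> t * (fst m \<bullet> fst m * c t)"
          using H1_grad_cos_identity(1)[OF that m, of a] by (simp only: vg_def c_def integral_mult_right_zero)
        finally show ?thesis by (simp only: prod.case mult.assoc)
      qed
    qed
    have I3: "set_lebesgue_integral lborel ({0<..<T} \<times> Upsilon) (\<lambda>(t, \<xi>). snd (G t \<xi>) * snd (\<Phi> t \<xi>))
        = integral {0..T} (\<lambda>t. \<psi> t * ((snd m)\<^sup>2 * c t))"
    proof (rule diff)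
      show "(\<lambda>(t, \<xi>). snd (G t \<xi>) * snd (\<Phi> t \<xi>)) \<in> borel_measurable (time T \<Otimes>\<^sub>M cell)"
        unfolding case_prod_beta by (intro borel_measurable_times Gm1 \<Phi>m)
      fix t \<xi>
      show "\<bar>case (t, \<xi>) of (t, \<xi>) \<Rightarrow> snd (G t \<xi>) * snd (\<Phi> t \<xi>)\<bar> \<le> norm (G t \<xi>) * (P * norm m)" if "0 < t" "t < T"
      proof -
        have "\<bar>snd (G t \<xi>) * snd (\<Phi> t \<xi>)\<bar> \<le> norm (G t \<xi>) * norm (\<Phi> t \<xi>)"
          unfolding abs_mult using norm_snd_le[of "snd (G t \<xi>)" "fst (G t \<xi>)"] norm_snd_le[of "snd (\<Phi> t \<xi>)" "fst (\<Phi> t \<xi>)"]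
          by (intro mult_mono) auto
        also have "\<dots> \<le> norm (G t \<xi>) * (P * norm m)" by (intro mult_left_mono \<Phi>le that) simp
        finally show ?thesis by simp
      qed
      show "(LINT \<eta>|cell. (case (t, \<eta>) of (t, \<xi>) \<Rightarrow> snd (G t \<xi>) * snd (\<Phi> t \<xi>))) = \<psi> t * ((snd m)\<^sup>2 * c t)" if "H1_grad (f t) (G t)"
      proof -
        have "(LINT \<eta>|cell. snd (G t \<eta>) * snd (\<Phi> t \<eta>)) = (LINT \<eta>|cell. \<psi> t * (snd (G t \<eta>) * snd (vg \<eta>)))"
          by (intro Bochner_Integration.integral_cong refl) (simp add: \<Phi>vg)
        also have "\<dots> = \<psi> t * ((snd m)\<^sup>2 * c t)"
          using H1_grad_cos_identity(2)[OF that m, of a] by (simp only: vg_def c_def integral_mult_right_zero)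
        finally show ?thesis by (simp only: prod.case)
      qed
    qed
    \<comment> \<open>Homogeneity is linearity with second coefficient zero.\<close>
    have Flin: "F t (\<lambda>\<xi>. \<psi> t * v \<xi>) = \<psi> t * F t v" if "F t \<in> H1_dual" for t
    proof -
      have "F t (\<lambda>\<xi>. \<psi> t * v \<xi> + 0 * v \<xi>) = \<psi> t * F t v + 0 * F t v"
        using that vH unfolding H1_dual_def H1_functional_def by blast
      then show ?thesis by simp
    qed
    have "(LINT t|lebesgue_on {0<..<T}. F t (\<lambda>\<xi>. \<psi> t * v \<xi>)) = (LINT t|lebesgue_on {0<..<T}. \<psi> t * F t v)"
    proof (rule integral_lebesgue_on_cong_AE)
      have "\<psi> \<in> borel_measurable (lebesgue_on {0<..<T})"
        by (rule measurable_restrict_space1, rule measurable_completion) (simp add: borel_measurable_continuous_onI \<psi>c)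
      moreover have "(\<lambda>t. F t v) \<in> borel_measurable (lebesgue_on {0<..<T})"
        using F vH unfolding L2_H1_dual_def by blast
      ultimately show "(\<lambda>t. \<psi> t * F t v) \<in> borel_measurable (lebesgue_on {0<..<T})"
        by measurable
      have "AE t in lebesgue_on {0<..<T}. F t \<in> H1_dual" using F unfolding L2_H1_dual_def by blast
      then show "AE t in lebesgue_on {0<..<T}. \<psi> t * F t v = F t (\<lambda>\<xi>. \<psi> t * v \<xi>)"
        by eventually_elim (simp add: Flin)
    qed simp
    moreover have "(LINT t|lebesgue_on {0<..<T}. deriv \<psi> t * c t) = - (LINT t|lebesgue_on {0<..<T}. \<psi> t * F t v)"
      using FD[unfolded is_time_deriv_def set_integral_Upsilon, rule_format, OF \<psi> vH]
      by (simp only: c_def v_def)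
    ultimately have "(LINT t|lebesgue_on {0<..<T}. deriv \<psi> t * c t)
        = - (Pe * integral {0..T} (\<lambda>t. - (\<psi> t * flux_coeff (f t) m a))
            - De * integral {0..T} (\<lambda>t. \<psi> t * (fst m \<bullet> fst m * c t)) - integral {0..T} (\<lambda>t. \<psi> t * ((snd m)\<^sup>2 * c t)))"
      using weak[OF Lg] by (simp only: Yeq I1 I2 I3)
    also have "Pe * integral {0..T} (\<lambda>t. - (\<psi> t * flux_coeff (f t) m a))
            - De * integral {0..T} (\<lambda>t. \<psi> t * (fst m \<bullet> fst m * c t)) - integral {0..T} (\<lambda>t. \<psi> t * ((snd m)\<^sup>2 * c t))
        = integral {0..T} (\<lambda>t. Pe * (- (\<psi> t * flux_coeff (f t) m a)) - De * (\<psi> t * (fst m \<bullet> fst m * c t)) - \<psi> t * ((snd m)\<^sup>2 * c t))"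
    proof -
      have i: "(\<lambda>t. Pe * (- (\<psi> t * flux_coeff (f t) m a))) integrable_on {0..T}"
        "(\<lambda>t. De * (\<psi> t * (fst m \<bullet> fst m * c t))) integrable_on {0..T}"
        "(\<lambda>t. \<psi> t * ((snd m)\<^sup>2 * c t)) integrable_on {0..T}"
        by (intro integrable_continuous_real continuous_on_minus continuous_on_mult continuous_on_const \<psi>c cont)+
      show ?thesis
        by (simp only: integral_diff[OF integrable_diff[OF i(1,2)] i(3)] integral_diff[OF i(1,2)] integral_mult_right)
    qed
    also have "\<dots> = integral {0..T} (\<lambda>t. \<psi> t * (- decay De m * c t - Pe * flux_coeff (f t) m a))"
      by (intro Henstock_Kurzweil_Integration.integral_cong) (simp add: algebra_simps)
    also have "\<dots> = (LINT t|lebesgue_on {0<..<T}. \<psi> t * (- decay De m * c t - Pe * flux_coeff (f t) m a))"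
      by (intro LINT_lebesgue_on_open_interval[symmetric] continuous_on_mult continuous_on_diff continuous_on_const \<psi>c cont)
    finally show ?thesis .
  qed
  have "(c has_real_derivative - decay De m * c t0 - Pe * flux_coeff (f t0) m a) (at t0)"
    by (rule weak_deriv_imp_deriv[OF cont(1) _ key t0])
      (intro continuous_on_mult continuous_on_diff continuous_on_const cont)+
  then show ?thesis by (simp add: c_def[abs_def])
qed

section \<open>Trigonometric polynomials and Fejer means\<close>

text \<open>The frequencies \<open>m p\<close> may repeat: Fejer means are indexed by pairs of grid
  points, and like terms are never collected.\<close>

definition trig_poly :: "'i set \<Rightarrow> ('i \<Rightarrow> point) \<Rightarrow> ('i \<Rightarrow> real) \<Rightarrow> ('i \<Rightarrow> real) \<Rightarrow> point \<Rightarrow> real" where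
  "trig_poly I m A B \<xi> = (\<Sum>p\<in>I. A p * cos (m p \<bullet> \<xi>) + B p * sin (m p \<bullet> \<xi>))"

lemma continuous_on_trig_poly [continuous_intros]:
  "continuous_on S g \<Longrightarrow> continuous_on S (\<lambda>x. trig_poly I m A B (g x))"
  for S :: "'b::t2_space set"
  unfolding trig_poly_def by (intro continuous_intros)

lemma trig_poly_deriv:
  "((\<lambda>s. trig_poly I m A B (\<xi> + s *\<^sub>R i)) has_real_derivative
    trig_poly I m (\<lambda>p. (m p \<bullet> i) * B p) (\<lambda>p. - (m p \<bullet> i) * A p) \<xi>) (at 0)"
  unfolding trig_poly_def
proof (rule DERIV_sum)
  fix p
  show "((\<lambda>s. A p * cos (m p \<bullet> (\<xi> + s *\<^sub>R i)) + B p * sin (m p \<bullet> (\<xi> + s *\<^sub>R i))) has_real_derivative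
      m p \<bullet> i * B p * cos (m p \<bullet> \<xi>) + - (m p \<bullet> i) * A p * sin (m p \<bullet> \<xi>)) (at 0)"
    unfolding inner_add_right inner_scaleR_right
    by (auto intro!: derivative_eq_intros)
qed

lemma trig_poly_periodic:
  assumes "\<And>p. p \<in> I \<Longrightarrow> m p \<in> lattice" "i \<in> Basis"
  shows "trig_poly I m A B (\<xi> + (2 * pi) *\<^sub>R i) = trig_poly I m A B \<xi>"
proof -
  have "cos (m p \<bullet> (\<xi> + (2 * pi) *\<^sub>R i)) = cos (m p \<bullet> \<xi>)" "sin (m p \<bullet> (\<xi> + (2 * pi) *\<^sub>R i)) = sin (m p \<bullet> \<xi>)"
    if "p \<in> I" for p
    using cos_inner_periodic[OF assms(1)[OF that] assms(2), of \<xi> 0]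
      cos_inner_periodic[OF assms(1)[OF that] assms(2), of \<xi> "- (pi / 2)"]
    by (simp_all add: cos_diff flip: diff_conv_add_uminus)
  then show ?thesis unfolding trig_poly_def by simp
qed

text \<open>A non-zero frequency has a non-zero component, along which the cosine is the derivative
  of a periodic function.\<close>

lemma integral_cos_inner:
  assumes m: "m \<in> lattice"
  shows "(LINT \<xi>|cell. cos (m \<bullet> \<xi> + a)) = (if m = 0 then (2 * pi) ^ 3 * cos a else 0)"
proof (cases "m = 0")
  case True
  then show ?thesis by simp
next
  case False
  then obtain i where i: "i \<in> Basis" "m \<bullet> i \<noteq> 0"
    using euclidean_all_zero_iff[of m] by blast
  have "(LINT \<xi>|cell. cos (m \<bullet> \<xi> + a)) = 0"
  proof (rule integral_cell_periodic_deriv[OF i(1), where g = "\<lambda>\<xi>. sin (m \<bullet> \<xi> + a) / (m \<bullet> i)"])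
    show "((\<lambda>s. sin (m \<bullet> (\<xi> + s *\<^sub>R i) + a) / (m \<bullet> i)) has_real_derivative cos (m \<bullet> \<xi> + a)) (at 0)" for \<xi>
      unfolding inner_add_right inner_scaleR_right using i(2)
      by (auto intro!: derivative_eq_intros)
    show "sin (m \<bullet> (\<xi> + (2 * pi) *\<^sub>R i) + a) / (m \<bullet> i) = sin (m \<bullet> \<xi> + a) / (m \<bullet> i)" for \<xi>
      using cos_inner_periodic[OF m i(1), of \<xi> "a - pi / 2"]
      by (simp add: cos_diff add_diff_eq)
  qed (intro continuous_intros)
  with False show ?thesis by simp
qed

section \<open>The Fejer kernel\<close>

definition grid_pt :: "nat \<Rightarrow> nat \<Rightarrow> nat \<Rightarrow> point" where
  "grid_pt a b c = ((real a, real b), real c)"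

definition grid :: "nat \<Rightarrow> point set" where
  "grid n = (\<lambda>(a, b, c). grid_pt a b c) ` ({..<n} \<times> {..<n} \<times> {..<n})"

abbreviation freqs :: "nat \<Rightarrow> (point \<times> point) set" where
  "freqs n \<equiv> grid n \<times> grid n"

abbreviation freq :: "point \<times> point \<Rightarrow> point" where
  "freq p \<equiv> fst p - snd p"

text \<open>The double sum is the squared modulus of the exponential sum over the grid, so this is
  the product of three one-dimensional Fejer kernels. As a sum over pairs it is visibly
  non-negative, and its moments are counts of pairs.\<close>

definition fejer :: "nat \<Rightarrow> point \<Rightarrow> real" where
  "fejer n \<zeta> = (\<Sum>p\<in>freqs n. cos (freq p \<bullet> \<zeta>)) / ((2 * pi) ^ 3 * real n ^ 3)"

lemma finite_grid [simp]: "finite (grid n)"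
  by (simp add: grid_def)

lemma card_grid: "card (grid n) = n ^ 3"
proof -
  have "inj (\<lambda>(a, b, c). grid_pt a b c)" by (auto simp: inj_on_def grid_pt_def)
  then have "card (grid n) = card ({..<n} \<times> {..<n} \<times> {..<n})"
    unfolding grid_def by (intro card_image) (auto intro: inj_on_subset)
  then show ?thesis by (simp add: card_cartesian_product power3_eq_cube)
qed

lemma freq_lattice: "p \<in> freqs n \<Longrightarrow> freq p \<in> lattice"
  by (auto simp: grid_def grid_pt_def lattice_def Basis_prod_def)

lemma fejer_nonneg: "0 \<le> fejer n \<zeta>"
proof -
  have "(\<Sum>p\<in>freqs n. cos (freq p \<bullet> \<zeta>))
      = (\<Sum>k\<in>grid n. cos (k \<bullet> \<zeta>))\<^sup>2 + (\<Sum>k\<in>grid n. sin (k \<bullet> \<zeta>))\<^sup>2"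
    by (simp add: power2_eq_square sum_product sum.cartesian_product' inner_diff_left cos_diff
        flip: sum.distrib)
  then show ?thesis by (simp add: fejer_def)
qed

lemma continuous_on_fejer [continuous_intros]:
  "continuous_on S g \<Longrightarrow> continuous_on S (\<lambda>x. fejer n (g x))"
  for S :: "'b::t2_space set"
proof (cases "n = 0")
  case False
  moreover assume "continuous_on S g"
  ultimately show ?thesis
    unfolding fejer_def by (intro continuous_intros) auto
qed (simp add: fejer_def)

lemma fejer_measurable [measurable]: "fejer n \<in> borel_measurable borel"
  by (rule borel_measurable_continuous_onI) (intro continuous_intros)

lemma fejer_le: "fejer n \<zeta> \<le> real n ^ 3 / (2 * pi) ^ 3"
proof (cases "n = 0")
  case False
  have "(\<Sum>p\<in>freqs n. cos (freq p \<bullet> \<zeta>)) \<le> real (card (freqs n)) * 1"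
    by (rule sum_bounded_above) simp
  then have "fejer n \<zeta> \<le> real n ^ 3 * real n ^ 3 / ((2 * pi) ^ 3 * real n ^ 3)"
    unfolding fejer_def by (intro divide_right_mono) (auto simp: card_cartesian_product card_grid)
  also have "\<dots> = real n ^ 3 / (2 * pi) ^ 3" using False by (simp add: field_simps)
  finally show ?thesis .
qed (simp add: fejer_def grid_def)

lemma fejer_even: "fejer n (- \<zeta>) = fejer n \<zeta>"
  by (simp add: fejer_def)

text \<open>Orthogonality retains only the pairs whose difference cancels \<open>l\<close>. With
  \<open>l = 0\<close> this gives the total mass, with \<open>l\<close> a unit vector or its
  negative the first cosine moments.\<close>

lemma integral_fejer_aux:
  assumes l: "l \<in> lattice"
  shows "(LINT \<eta>|cell. (\<Sum>p\<in>freqs n. cos ((freq p + l) \<bullet> (\<xi> - \<eta>))))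
    = (2 * pi) ^ 3 * real (card {p \<in> freqs n. freq p = - l})"
proof -
  have lat: "- (freq p + l) \<in> lattice" if "p \<in> freqs n" for p
  proof -
    have "freq p \<bullet> i \<in> \<int>" "l \<bullet> i \<in> \<int>" if "i \<in> Basis" for i
      using freq_lattice[OF \<open>p \<in> freqs n\<close>] l that unfolding lattice_def mem_Collect_eq by blast+
    then have "- (freq p + l) \<bullet> i \<in> \<int>" if "i \<in> Basis" for i
      using that unfolding inner_minus_left inner_add_left by (intro Ints_minus Ints_add)
    then show ?thesis unfolding lattice_def by blast
  qed
  have eq: "cos ((freq p + l) \<bullet> (\<xi> - \<eta>)) = cos (- (freq p + l) \<bullet> \<eta> + (freq p + l) \<bullet> \<xi>)" for p \<eta>
    by (simp only: inner_diff_right inner_minus_left) (simp add: algebra_simps)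
  have "(LINT \<eta>|cell. (\<Sum>p\<in>freqs n. cos ((freq p + l) \<bullet> (\<xi> - \<eta>))))
      = (\<Sum>p\<in>freqs n. LINT \<eta>|cell. cos ((freq p + l) \<bullet> (\<xi> - \<eta>)))"
    by (intro Bochner_Integration.integral_sum integrable_cell_continuous continuous_intros)
  also have "\<dots> = (\<Sum>p\<in>freqs n. if freq p = - l then (2 * pi) ^ 3 else 0)"
  proof (rule sum.cong[OF refl])
    fix p assume "p \<in> freqs n"
    then show "(LINT \<eta>|cell. cos ((freq p + l) \<bullet> (\<xi> - \<eta>))) = (if freq p = - l then (2 * pi) ^ 3 else 0)"
    proof -
      have "- (freq p + l) = 0 \<longleftrightarrow> freq p = - l" by (simp only: neg_equal_0_iff_equal eq_neg_iff_add_eq_0)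
      then show ?thesis
        using integral_cos_inner[OF lat[OF \<open>p \<in> freqs n\<close>], of "(freq p + l) \<bullet> \<xi>"]
        unfolding eq by (auto simp: eq_neg_iff_add_eq_0)
    qed
  qed
  also have "\<dots> = (2 * pi) ^ 3 * real (card {p \<in> freqs n. freq p = - l})"
    by (simp add: sum.If_cases Int_def)
  finally show ?thesis .
qed

lemma integral_fejer:
  assumes "0 < n"
  shows "(LINT \<eta>|cell. fejer n (\<xi> - \<eta>)) = 1" "(LINT \<xi>|cell. fejer n (\<xi> - \<eta>)) = 1"
proof -
  have "{p \<in> freqs n. freq p = - 0} = (\<lambda>k. (k, k)) ` grid n" by auto
  then have "card {p \<in> freqs n. freq p = - 0} = n ^ 3"
    by (simp add: card_image inj_on_def card_grid)
  then show *: "(LINT \<eta>|cell. fejer n (\<xi> - \<eta>)) = 1" for \<xi>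
    using integral_fejer_aux[of 0 \<xi> n] assms by (simp add: fejer_def lattice_def)
  show "(LINT \<xi>|cell. fejer n (\<xi> - \<eta>)) = 1"
    using *[of \<eta>] fejer_even[of n "_ - \<eta>"] by simp
qed

text \<open>Along the direction \<open>i\<close> all grid points but those of the last layer stay in
  the grid after a unit shift.\<close>

lemma card_shifted:
  assumes "i \<in> Basis"
  shows "n ^ 2 * (n - 1) \<le> card {p \<in> freqs n. freq p = i}"
proof -
  let ?c = "\<lambda>A B C :: nat set. A \<times> B \<times> C"
  consider "i = ((1, 0), 0)" | "i = ((0, 1), 0)" | "i = ((0, 0), 1)"
    using assms by (auto simp: Basis_prod_def zero_prod_def)
  then show ?thesis
  proof cases
    case 1
    have "card ((\<lambda>(a, b, c). (grid_pt (Suc a) b c, grid_pt a b c)) ` ?c {..<n-1} {..<n} {..<n})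
        \<le> card {p \<in> freqs n. freq p = i}"
      unfolding 1 by (intro card_mono) (auto simp: grid_def grid_pt_def image_iff intro!: bexI[of _ "Suc _"])
    then show ?thesis
      by (subst (asm) card_image) (auto simp: inj_on_def grid_pt_def card_cartesian_product power2_eq_square algebra_simps)
  next
    case 2
    have "card ((\<lambda>(a, b, c). (grid_pt a (Suc b) c, grid_pt a b c)) ` ?c {..<n} {..<n-1} {..<n})
        \<le> card {p \<in> freqs n. freq p = i}"
      unfolding 2 by (intro card_mono) (auto simp: grid_def grid_pt_def image_iff intro!: bexI[of _ "Suc _"])
    then show ?thesis
      by (subst (asm) card_image) (auto simp: inj_on_def grid_pt_def card_cartesian_product power2_eq_square algebra_simps)
  next
    case 3
    have "card ((\<lambda>(a, b, c). (grid_pt a b (Suc c), grid_pt a b c)) ` ?c {..<n} {..<n} {..<n-1})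
        \<le> card {p \<in> freqs n. freq p = i}"
      unfolding 3 by (intro card_mono) (auto simp: grid_def grid_pt_def image_iff zero_prod_def intro!: bexI[of _ "Suc _"])
    then show ?thesis
      by (subst (asm) card_image) (auto simp: inj_on_def grid_pt_def card_cartesian_product power2_eq_square algebra_simps)
  qed
qed

text \<open>1 - cos is comparable to the squared distance on the circle, so this moment is all that
  the convergence proof has to know about concentration. Of the n^3 pairs counted for the total
  mass, at least n^2 (n - 1) reappear for the shifted frequency, whence the defect 1/n.\<close>

lemma integral_fejer_cos:
  assumes n: "0 < n" and i: "i \<in> Basis"
  shows "(LINT \<eta>|cell. fejer n (\<xi> - \<eta>) * (1 - cos ((\<xi> - \<eta>) \<bullet> i))) \<le> 1 / real n"
proof -
  let ?N = "(2 * pi) ^ 3 * real n ^ 3"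
  let ?X = "\<lambda>\<eta>. (\<Sum>p\<in>freqs n. cos ((freq p + i) \<bullet> (\<xi> - \<eta>)))"
  let ?Y = "\<lambda>\<eta>. (\<Sum>p\<in>freqs n. cos ((freq p + (- i)) \<bullet> (\<xi> - \<eta>)))"
  have il: "i \<in> lattice" "- i \<in> lattice"
    using i by (auto simp: lattice_def Basis_prod_def)
  have prod: "fejer n \<zeta> * cos (\<zeta> \<bullet> i) = ((\<Sum>p\<in>freqs n. cos ((freq p + i) \<bullet> \<zeta>)) + (\<Sum>p\<in>freqs n. cos ((freq p + (- i)) \<bullet> \<zeta>))) / (2 * ?N)" for \<zeta>
  proof -
    have cc: "cos ((freq p + i) \<bullet> \<zeta>) + cos ((freq p + (- i)) \<bullet> \<zeta>) = 2 * (cos (freq p \<bullet> \<zeta>) * cos (\<zeta> \<bullet> i))" for p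
      unfolding inner_add_left inner_minus_left inner_commute[of \<zeta> i] cos_add cos_minus sin_minus
      by simp
    show ?thesis
      unfolding sum.distrib[symmetric] fejer_def
      by (simp only: cc sum_distrib_left[symmetric] sum_distrib_right[symmetric]) (simp add: ac_simps)
  qed
  have swap: "card {p \<in> freqs n. freq p = - i} = card {p \<in> freqs n. freq p = i}"
    by (rule bij_betw_same_card[of prod.swap])
      (auto intro!: bij_betw_byWitness[where f' = prod.swap] simp: algebra_simps)
  have "real (card {p \<in> freqs n. freq p = i}) \<ge> real (n ^ 2 * (n - 1))"
    using card_shifted[OF i, of n] by linarith
  then have cd: "real (card {p \<in> freqs n. freq p = i}) \<ge> real n ^ 3 - real n ^ 2"
    using n by (simp add: of_nat_diff algebra_simps power3_eq_cube power2_eq_square)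
  have int: "integrable cell ?X" "integrable cell ?Y"
    by (intro integrable_cell_continuous continuous_intros)+
  have "(LINT \<eta>|cell. fejer n (\<xi> - \<eta>) * cos ((\<xi> - \<eta>) \<bullet> i)) = ((LINT \<eta>|cell. ?X \<eta>) + (LINT \<eta>|cell. ?Y \<eta>)) / (2 * ?N)"
    unfolding prod using int by simp
  also have "\<dots> = real (card {p \<in> freqs n. freq p = i}) / real n ^ 3"
    unfolding integral_fejer_aux[OF il(1)] integral_fejer_aux[OF il(2)] swap minus_minus
    using n by (simp add: field_simps)
  also have "\<dots> \<ge> (real n ^ 3 - real n ^ 2) / real n ^ 3"
    using cd by (rule divide_right_mono) simp
  moreover have "(real n ^ 3 - real n ^ 2) / real n ^ 3 = 1 - 1 / real n"
    using n by (simp add: field_simps power2_eq_square power3_eq_cube)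
  moreover have "(LINT \<eta>|cell. fejer n (\<xi> - \<eta>) * (1 - cos ((\<xi> - \<eta>) \<bullet> i)))
      = (LINT \<eta>|cell. fejer n (\<xi> - \<eta>)) - (LINT \<eta>|cell. fejer n (\<xi> - \<eta>) * cos ((\<xi> - \<eta>) \<bullet> i))"
    unfolding right_diff_distrib mult_1_right
    by (intro Bochner_Integration.integral_diff integrable_cell_continuous continuous_intros)
  ultimately show ?thesis
    using integral_fejer(1)[OF n, of \<xi>] by linarith
qed

section \<open>Fejer means and their convergence\<close>

definition fejer_mean :: "nat \<Rightarrow> (point \<Rightarrow> real) \<Rightarrow> point \<Rightarrow> real" where
  "fejer_mean n w \<xi> = (LINT \<eta>|cell. fejer n (\<xi> - \<eta>) * w \<eta>)"

lemma integrable_mult_bounded: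
  fixes w k :: "point \<Rightarrow> real"
  assumes w: "integrable cell w" and [measurable]: "k \<in> borel_measurable cell" and k: "\<And>\<eta>. \<bar>k \<eta>\<bar> \<le> C"
  shows "integrable cell (\<lambda>\<eta>. k \<eta> * w \<eta>)"
proof (rule Bochner_Integration.integrable_bound[of _ "\<lambda>\<eta>. C * w \<eta>"])
  have [measurable]: "w \<in> borel_measurable cell" using w by auto
  show "(\<lambda>\<eta>. k \<eta> * w \<eta>) \<in> borel_measurable cell" by measurable
  have "\<bar>k \<eta>\<bar> \<le> \<bar>C\<bar>" for \<eta> using k[of \<eta>] by linarith
  then show "AE \<eta> in cell. norm (k \<eta> * w \<eta>) \<le> norm (C * w \<eta>)"
    by (auto simp: abs_mult intro!: mult_right_mono)
qed (use w in auto)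

lemma measurable_cell_continuous: "continuous_on UNIV k \<Longrightarrow> k \<in> borel_measurable cell"
  for k :: "point \<Rightarrow> 'a::topological_space"
  by (intro measurable_cell) (simp add: borel_measurable_continuous_onI)

lemma integrable_fejer_mult: "integrable cell w \<Longrightarrow> integrable cell (\<lambda>\<eta>. fejer n (\<xi> - \<eta>) * w \<eta>)"
  using fejer_le fejer_nonneg
  by (intro integrable_mult_bounded[of _ _ "real n ^ 3 / (2 * pi) ^ 3"] measurable_cell_continuous continuous_intros) auto

lemma integrable_trig_mult:
  assumes "integrable cell w"
  shows "integrable cell (\<lambda>\<eta>. w \<eta> * cos (m \<bullet> \<eta> + a))" "integrable cell (\<lambda>\<eta>. w \<eta> * sin (m \<bullet> \<eta> + a))"
    "integrable cell (\<lambda>\<eta>. w \<eta> * cos (m \<bullet> \<eta>))" "integrable cell (\<lambda>\<eta>. w \<eta> * sin (m \<bullet> \<eta>))"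
  unfolding mult.commute[of "w _"]
  by (intro integrable_mult_bounded[of _ _ 1] assms measurable_cell_continuous continuous_intros; simp)+

definition cos_coeff :: "nat \<Rightarrow> (point \<Rightarrow> real) \<Rightarrow> point \<times> point \<Rightarrow> real" where
  "cos_coeff n w p = (LINT \<eta>|cell. w \<eta> * cos (freq p \<bullet> \<eta>)) / ((2 * pi) ^ 3 * real n ^ 3)"

definition sin_coeff :: "nat \<Rightarrow> (point \<Rightarrow> real) \<Rightarrow> point \<times> point \<Rightarrow> real" where
  "sin_coeff n w p = (LINT \<eta>|cell. w \<eta> * sin (freq p \<bullet> \<eta>)) / ((2 * pi) ^ 3 * real n ^ 3)"

text \<open>The addition theorem for the cosine separates \<xi> from \<eta>. As an average the mean
  obeys pointwise bounds; as a trigonometric polynomial it is smooth in \<xi> and its evolution is a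
  finite system of ordinary differential equations.\<close>

lemma fejer_mean_eq_trig_poly:
  assumes w: "integrable cell w"
  shows "fejer_mean n w = trig_poly (freqs n) freq (cos_coeff n w) (sin_coeff n w)"
proof
  fix \<xi>
  have "fejer n (\<xi> - \<eta>) * w \<eta>
      = (\<Sum>p\<in>freqs n. (w \<eta> * cos (freq p \<bullet> \<eta>)) * (cos (freq p \<bullet> \<xi>) / ((2 * pi) ^ 3 * real n ^ 3))
          + (w \<eta> * sin (freq p \<bullet> \<eta>)) * (sin (freq p \<bullet> \<xi>) / ((2 * pi) ^ 3 * real n ^ 3)))" for \<eta>
    unfolding fejer_def inner_diff_right cos_diff sum_divide_distrib sum_distrib_right
    by (intro sum.cong refl) (simp add: add_divide_distrib algebra_simps)
  then have "fejer_mean n w \<xi> = (LINT \<eta>|cell. (\<Sum>p\<in>freqs n. (w \<eta> * cos (freq p \<bullet> \<eta>)) * (cos (freq p \<bullet> \<xi>) / ((2 * pi) ^ 3 * real n ^ 3))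
          + (w \<eta> * sin (freq p \<bullet> \<eta>)) * (sin (freq p \<bullet> \<xi>) / ((2 * pi) ^ 3 * real n ^ 3))))"
    unfolding fejer_mean_def by simp
  also have "\<dots> = (\<Sum>p\<in>freqs n. (LINT \<eta>|cell. w \<eta> * cos (freq p \<bullet> \<eta>)) * (cos (freq p \<bullet> \<xi>) / ((2 * pi) ^ 3 * real n ^ 3))
          + (LINT \<eta>|cell. w \<eta> * sin (freq p \<bullet> \<eta>)) * (sin (freq p \<bullet> \<xi>) / ((2 * pi) ^ 3 * real n ^ 3)))"
    using integrable_trig_mult[OF w] by simp
  also have "\<dots> = trig_poly (freqs n) freq (cos_coeff n w) (sin_coeff n w) \<xi>"
    unfolding trig_poly_def cos_coeff_def sin_coeff_def by simp
  finally show "fejer_mean n w \<xi> = trig_poly (freqs n) freq (cos_coeff n w) (sin_coeff n w) \<xi>" .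
qed

lemma fejer_mean_continuous: "integrable cell w \<Longrightarrow> continuous_on S (fejer_mean n w)"
  by (simp only: fejer_mean_eq_trig_poly continuous_on_trig_poly[OF continuous_on_id, unfolded id_def])

lemma integrable_fejer_mean: "integrable cell w \<Longrightarrow> integrable cell (fejer_mean n w)"
  by (rule integrable_cell_continuous[OF fejer_mean_continuous])

lemma fejer_mean_mono:
  assumes "integrable cell v" "integrable cell w" "AE \<eta> in cell. v \<eta> \<le> w \<eta>"
  shows "fejer_mean n v \<xi> \<le> fejer_mean n w \<xi>"
  unfolding fejer_mean_def using assms(3)
  by (intro integral_mono_AE integrable_fejer_mult assms) (auto elim!: eventually_mono intro!: mult_left_mono fejer_nonneg)

lemma fejer_mean_abs: "\<bar>fejer_mean n w \<xi>\<bar> \<le> fejer_mean n (\<lambda>\<eta>. \<bar>w \<eta>\<bar>) \<xi>"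
  unfolding fejer_mean_def using integral_abs_bound[of cell "\<lambda>\<eta>. fejer n (\<xi> - \<eta>) * w \<eta>"]
  by (simp add: abs_mult fejer_nonneg)

lemma fejer_mean_const: "0 < n \<Longrightarrow> fejer_mean n (\<lambda>\<eta>. c) \<xi> = c"
  by (simp add: fejer_mean_def integral_fejer)

lemma fejer_mean_diff:
  "integrable cell v \<Longrightarrow> integrable cell w \<Longrightarrow> fejer_mean n (\<lambda>\<eta>. v \<eta> - w \<eta>) \<xi> = fejer_mean n v \<xi> - fejer_mean n w \<xi>"
  unfolding fejer_mean_def right_diff_distrib
  by (intro Bochner_Integration.integral_diff integrable_fejer_mult)

interpretation cell_cell: pair_sigma_finite cell cell
  by standard

lemma fejer_mean_L1:
  assumes n: "0 < n" and w: "integrable cell w"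
  shows "(LINT \<xi>|cell. \<bar>fejer_mean n w \<xi>\<bar>) \<le> (LINT \<eta>|cell. \<bar>w \<eta>\<bar>)"
proof -
  have [measurable]: "w \<in> borel_measurable cell" using w by auto
  have [measurable]: "(\<lambda>x. x) \<in> measurable cell borel"
    by (intro measurable_cell) simp
  have [measurable]: "(\<lambda>x. fejer n (fst x - snd x)) \<in> borel_measurable (cell \<Otimes>\<^sub>M cell)"
    by (rule measurable_compose[OF _ fejer_measurable])
      (intro borel_measurable_diff measurable_compose[OF measurable_fst] measurable_compose[OF measurable_snd]; measurable)
  have [measurable]: "(\<lambda>(\<eta>, \<xi>). fejer n (\<xi> - \<eta>) * \<bar>w \<eta>\<bar>) \<in> borel_measurable (cell \<Otimes>\<^sub>M cell)"
    using fejer_even[of n "snd _ - fst _"] unfolding case_prod_beta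
    by (subst fejer_even[symmetric]) (simp only: minus_diff_eq, measurable)
  have int1: "(LINT \<xi>|cell. norm (fejer n (\<xi> - \<eta>) * \<bar>w \<eta>\<bar>)) = \<bar>w \<eta>\<bar>" for \<eta>
    using integral_fejer(2)[OF n] by (simp add: abs_mult fejer_nonneg)
  have fub: "integrable (cell \<Otimes>\<^sub>M cell) (\<lambda>(\<eta>, \<xi>). fejer n (\<xi> - \<eta>) * \<bar>w \<eta>\<bar>)"
  proof (rule cell_cell.Fubini_integrable)
    show "AE \<eta> in cell. integrable cell (\<lambda>\<xi>. case (\<eta>, \<xi>) of (\<eta>, \<xi>) \<Rightarrow> fejer n (\<xi> - \<eta>) * \<bar>w \<eta>\<bar>)"
      by (auto intro!: AE_I2 integrable_mult_left integrable_cell_continuous continuous_intros)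
    show "integrable cell (\<lambda>\<eta>. LINT \<xi>|cell. norm (case (\<eta>, \<xi>) of (\<eta>, \<xi>) \<Rightarrow> fejer n (\<xi> - \<eta>) * \<bar>w \<eta>\<bar>))"
      unfolding prod.case int1 using w by simp
  qed measurable
  have "(LINT \<xi>|cell. \<bar>fejer_mean n w \<xi>\<bar>) \<le> (LINT \<xi>|cell. fejer_mean n (\<lambda>\<eta>. \<bar>w \<eta>\<bar>) \<xi>)"
    using w by (intro integral_mono integrable_abs integrable_fejer_mean fejer_mean_abs) auto
  also have "\<dots> = (LINT \<eta>|cell. LINT \<xi>|cell. fejer n (\<xi> - \<eta>) * \<bar>w \<eta>\<bar>)"
    unfolding fejer_mean_def by (rule cell_cell.Fubini_integral[OF fub])
  also have "\<dots> = (LINT \<eta>|cell. \<bar>w \<eta>\<bar>)"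
    using integral_fejer(2)[OF n] by simp
  finally show ?thesis .
qed

text \<open>Korovkin's argument: near \<xi> the oscillation of \<open>h\<close> is at most
  \<open>e\<close>, and elsewhere it is at most a multiple of the sum of the 1 - cos, whose means
  are of order 1/n. Since \<open>h\<close> need not be periodic, \<xi> lies in the open cell, away
  from the values that the periodic kernel sees on opposite faces.\<close>

lemma fejer_mean_pointwise:
  fixes h :: "point \<Rightarrow> real"
  assumes h: "continuous_on UNIV h" and M: "\<And>\<eta>. \<bar>h \<eta>\<bar> \<le> M" and \<xi>: "\<xi> \<in> Upsilon"
  shows "(\<lambda>n. fejer_mean n h \<xi>) \<longlonglongrightarrow> h \<xi>"
proof (rule LIMSEQ_I)
  fix r :: real assume r: "0 < r"
  define e where "e = r / 2"
  have e: "0 < e" using r by (simp add: e_def)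
  have M0: "0 \<le> M" using M[of 0] by simp
  obtain d where d: "0 < d" "\<And>\<eta>. dist \<eta> \<xi> < d \<Longrightarrow> dist (h \<eta>) (h \<xi>) < e"
    using h e unfolding continuous_on_iff by (metis UNIV_I)
  have coord: "0 < \<zeta> \<bullet> i" "\<zeta> \<bullet> i < 2 * pi" if "\<zeta> \<in> Upsilon" "i \<in> Basis" for \<zeta> i
    using that unfolding Upsilon_eq_box mem_box by (force simp: Basis_prod_def)+
  \<comment> \<open>The distances to the faces keep differences of coordinates at least
    \<open>t\<close> away from 2 pi, where 1 - cos would vanish again. \<open>d / 4\<close> leaves
    room for the sum over three coordinates, and 1 is below pi.\<close>
  define t where "t = min (min (Min ((\<lambda>i. \<xi> \<bullet> i) ` Basis)) (Min ((\<lambda>i. 2 * pi - \<xi> \<bullet> i) ` Basis))) (min (d / 4) 1)"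
  have t: "0 < t" "t \<le> 1" "t \<le> d / 4"
    using coord[OF \<xi>] d(1) by (auto simp: t_def)
  have ti: "t \<le> \<xi> \<bullet> i" "t \<le> 2 * pi - \<xi> \<bullet> i" if "i \<in> Basis" for i
    using that by (auto simp: t_def min_le_iff_disj)
  define \<kappa> where "\<kappa> = 1 - cos t"
  have \<kappa>: "0 < \<kappa>"
    using cos_monotone_0_pi[of 0 t] t pi_gt3 by (simp add: \<kappa>_def)
  have key: "\<bar>h \<eta> - h \<xi>\<bar> \<le> e + (\<Sum>i\<in>Basis. 2 * M / \<kappa> * (1 - cos ((\<xi> - \<eta>) \<bullet> i)))" if \<eta>: "\<eta> \<in> Upsilon" for \<eta>
  proof (cases "\<forall>i\<in>Basis. \<bar>(\<xi> - \<eta>) \<bullet> i\<bar> < t")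
    case True
    have "norm (\<xi> - \<eta>) \<le> (\<Sum>i\<in>Basis. \<bar>(\<xi> - \<eta>) \<bullet> i\<bar>)" by (rule norm_le_l1)
    also have "\<dots> \<le> real (card (Basis :: point set)) * t"
      using True by (intro sum_bounded_above) auto
    also have "\<dots> < d" using t d(1) by simp
    finally have "dist \<eta> \<xi> < d" by (simp add: dist_norm norm_minus_commute)
    then have "\<bar>h \<eta> - h \<xi>\<bar> < e" using d(2) by (simp add: dist_real_def)
    moreover have "0 \<le> (\<Sum>i\<in>Basis. 2 * M / \<kappa> * (1 - cos ((\<xi> - \<eta>) \<bullet> i)))"
      using M0 \<kappa> by (intro sum_nonneg mult_nonneg_nonneg) auto
    ultimately show ?thesis by linarith
  next
    case False
    then obtain i where i: "i \<in> Basis" "t \<le> \<bar>(\<xi> - \<eta>) \<bullet> i\<bar>" by force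
    let ?z = "\<bar>(\<xi> - \<eta>) \<bullet> i\<bar>"
    have z: "?z \<le> 2 * pi - t"
      using coord[OF \<eta> i(1)] ti[OF i(1)] by (simp add: inner_diff_left abs_le_iff)
    have "cos ?z \<le> cos t"
    proof (cases "?z \<le> pi")
      case True
      then show ?thesis using i t by (intro cos_monotone_0_pi_le) auto
    next
      case False
      then have "cos (2 * pi - ?z) \<le> cos t" using z t by (intro cos_monotone_0_pi_le) auto
      then show ?thesis by (simp add: cos_diff)
    qed
    then have "\<kappa> \<le> 1 - cos ((\<xi> - \<eta>) \<bullet> i)" by (simp add: \<kappa>_def)
    then have "2 * M / \<kappa> * \<kappa> \<le> 2 * M / \<kappa> * (1 - cos ((\<xi> - \<eta>) \<bullet> i))"
      using M0 \<kappa> by (intro mult_left_mono) auto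
    also have "\<dots> \<le> (\<Sum>i\<in>Basis. 2 * M / \<kappa> * (1 - cos ((\<xi> - \<eta>) \<bullet> i)))"
      using M0 \<kappa> i(1) by (intro member_le_sum) auto
    finally have "2 * M \<le> (\<Sum>i\<in>Basis. 2 * M / \<kappa> * (1 - cos ((\<xi> - \<eta>) \<bullet> i)))" using \<kappa> by simp
    moreover have "\<bar>h \<eta> - h \<xi>\<bar> \<le> 2 * M" using M[of \<eta>] M[of \<xi>] by linarith
    ultimately show ?thesis using e by linarith
  qed
  have hi: "integrable cell h" by (rule integrable_cell_continuous[OF h])
  have bound: "\<bar>fejer_mean n h \<xi> - h \<xi>\<bar> \<le> e + 6 * M / \<kappa> * (1 / real n)" if n: "0 < n" for n
  proof -
    have c: "continuous_on UNIV (\<lambda>\<eta>. fejer n (\<xi> - \<eta>) * (1 - cos ((\<xi> - \<eta>) \<bullet> i)))" for i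
      by (intro continuous_intros)
    have "\<bar>fejer_mean n h \<xi> - h \<xi>\<bar> = \<bar>fejer_mean n (\<lambda>\<eta>. h \<eta> - h \<xi>) \<xi>\<bar>"
      using hi n by (subst fejer_mean_diff) (auto simp: fejer_mean_const)
    also have "\<dots> \<le> fejer_mean n (\<lambda>\<eta>. \<bar>h \<eta> - h \<xi>\<bar>) \<xi>" by (rule fejer_mean_abs)
    also have "\<dots> \<le> fejer_mean n (\<lambda>\<eta>. e + (\<Sum>i\<in>Basis. 2 * M / \<kappa> * (1 - cos ((\<xi> - \<eta>) \<bullet> i)))) \<xi>"
    proof (rule fejer_mean_mono)
      show "AE \<eta> in cell. \<bar>h \<eta> - h \<xi>\<bar> \<le> e + (\<Sum>i\<in>Basis. 2 * M / \<kappa> * (1 - cos ((\<xi> - \<eta>) \<bullet> i)))"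
        using key by (intro AE_I2) simp
    qed (intro integrable_cell_continuous continuous_intros h)+
    also have "\<dots> = (LINT \<eta>|cell. e * fejer n (\<xi> - \<eta>) + (\<Sum>i\<in>Basis. 2 * M / \<kappa> * (fejer n (\<xi> - \<eta>) * (1 - cos ((\<xi> - \<eta>) \<bullet> i)))))"
      unfolding fejer_mean_def
      by (intro Bochner_Integration.integral_cong refl) (simp only: distrib_left sum_distrib_left, simp add: ac_simps)
    also have "\<dots> = (LINT \<eta>|cell. e * fejer n (\<xi> - \<eta>)) + (LINT \<eta>|cell. (\<Sum>i\<in>Basis. 2 * M / \<kappa> * (fejer n (\<xi> - \<eta>) * (1 - cos ((\<xi> - \<eta>) \<bullet> i)))))"
      by (intro Bochner_Integration.integral_add integrable_cell_continuous continuous_intros)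
    also have "(LINT \<eta>|cell. (\<Sum>i\<in>Basis. 2 * M / \<kappa> * (fejer n (\<xi> - \<eta>) * (1 - cos ((\<xi> - \<eta>) \<bullet> i)))))
       = (\<Sum>i\<in>Basis. LINT \<eta>|cell. 2 * M / \<kappa> * (fejer n (\<xi> - \<eta>) * (1 - cos ((\<xi> - \<eta>) \<bullet> i))))"
      by (intro Bochner_Integration.integral_sum integrable_cell_continuous continuous_intros)
    also have "\<dots> = (\<Sum>i\<in>Basis. 2 * M / \<kappa> * (LINT \<eta>|cell. fejer n (\<xi> - \<eta>) * (1 - cos ((\<xi> - \<eta>) \<bullet> i))))"
      by (intro sum.cong refl integral_mult_right_zero)
    also have "(LINT \<eta>|cell. e * fejer n (\<xi> - \<eta>)) = e"
      using integral_fejer(1)[OF n] by simp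
    also have "(\<Sum>i\<in>Basis. 2 * M / \<kappa> * (LINT \<eta>|cell. fejer n (\<xi> - \<eta>) * (1 - cos ((\<xi> - \<eta>) \<bullet> i))))
        \<le> (\<Sum>i\<in>(Basis :: point set). 2 * M / \<kappa> * (1 / real n))"
      using M0 \<kappa> by (intro sum_mono mult_left_mono integral_fejer_cos n) auto
    also have "\<dots> = 6 * M / \<kappa> * (1 / real n)" by simp
    finally show ?thesis by simp
  qed
  have "(\<lambda>n. e + 6 * M / \<kappa> * (1 / real n)) \<longlonglongrightarrow> e + 6 * M / \<kappa> * 0"
    by (intro tendsto_intros lim_1_over_n)
  then have "\<forall>\<^sub>F n in sequentially. e + 6 * M / \<kappa> * (1 / real n) < r"
    by (rule order_tendstoD) (use r in \<open>simp add: e_def\<close>)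
  then obtain N where N: "\<And>n. N \<le> n \<Longrightarrow> e + 6 * M / \<kappa> * (1 / real n) < r"
    unfolding eventually_sequentially by blast
  show "\<exists>N. \<forall>n\<ge>N. norm (fejer_mean n h \<xi> - h \<xi>) < r"
  proof (intro exI[of _ "Suc N"] allI impI)
    fix n assume "Suc N \<le> n"
    then show "norm (fejer_mean n h \<xi> - h \<xi>) < r"
      using bound[of n] N[of n] by simp
  qed
qed

lemma fejer_mean_bounded:
  assumes "0 < n" "integrable cell h" "\<And>\<eta>. \<bar>h \<eta>\<bar> \<le> M"
  shows "\<bar>fejer_mean n h \<xi>\<bar> \<le> M"
proof -
  have "\<bar>fejer_mean n h \<xi>\<bar> \<le> fejer_mean n (\<lambda>\<eta>. \<bar>h \<eta>\<bar>) \<xi>" by (rule fejer_mean_abs)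
  also have "\<dots> \<le> fejer_mean n (\<lambda>\<eta>. M) \<xi>"
    by (rule fejer_mean_mono) (use assms in auto)
  finally show ?thesis using assms(1) by (simp add: fejer_mean_const)
qed

lemma fejer_mean_L1_continuous:
  fixes h :: "point \<Rightarrow> real"
  assumes h: "continuous_on UNIV h" and M: "\<And>\<eta>. \<bar>h \<eta>\<bar> \<le> M"
  shows "(\<lambda>n. LINT \<xi>|cell. \<bar>fejer_mean n h \<xi> - h \<xi>\<bar>) \<longlonglongrightarrow> 0"
proof -
  have hi: "integrable cell h" by (rule integrable_cell_continuous[OF h])
  \<comment> \<open>The shift avoids the kernel of order 0, which is zero and has no unit
    mass.\<close>
  have "(\<lambda>n. LINT \<xi>|cell. \<bar>fejer_mean (Suc n) h \<xi> - h \<xi>\<bar>) \<longlonglongrightarrow> (LINT \<xi>|cell. 0)"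
  proof (rule integral_dominated_convergence)
    show "AE \<xi> in cell. (\<lambda>n. \<bar>fejer_mean (Suc n) h \<xi> - h \<xi>\<bar>) \<longlonglongrightarrow> 0"
    proof (rule AE_I2)
      fix \<xi> assume "\<xi> \<in> space cell"
      then have "(\<lambda>n. fejer_mean n h \<xi>) \<longlonglongrightarrow> h \<xi>"
        using fejer_mean_pointwise[OF h M] by simp
      then have "(\<lambda>n. fejer_mean (Suc n) h \<xi>) \<longlonglongrightarrow> h \<xi>"
        by (rule LIMSEQ_Suc)
      then show "(\<lambda>n. \<bar>fejer_mean (Suc n) h \<xi> - h \<xi>\<bar>) \<longlonglongrightarrow> 0"
        by (intro tendsto_rabs_zero) (simp add: LIM_zero_iff)
    qed
    show "AE \<xi> in cell. norm \<bar>fejer_mean (Suc n) h \<xi> - h \<xi>\<bar> \<le> 2 * M" for n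
    proof (rule AE_I2)
      fix \<xi>
      show "norm \<bar>fejer_mean (Suc n) h \<xi> - h \<xi>\<bar> \<le> 2 * M"
        using fejer_mean_bounded[of "Suc n", OF _ hi M, of \<xi>] M[of \<xi>] by simp
    qed
    show "(\<lambda>\<xi>. \<bar>fejer_mean (Suc n) h \<xi> - h \<xi>\<bar>) \<in> borel_measurable cell" for n
      using integrable_fejer_mean[OF hi] hi by auto
  qed auto
  then show ?thesis
    unfolding integral_zero by (rule LIMSEQ_imp_Suc)
qed

text \<open>The function is first clamped at a high level, then approximated almost everywhere by
  continuous functions clamped at the same level. The common bound makes dominated convergence
  applicable on the finite cell.\<close>

lemma L1_dense_continuous:
  fixes w :: "point \<Rightarrow> real"
  assumes w: "integrable cell w" and e: "0 < e"
  obtains h M where "continuous_on UNIV h" "\<And>\<eta>. \<bar>h \<eta>\<bar> \<le> M" "(LINT \<eta>|cell. \<bar>w \<eta> - h \<eta>\<bar>) < e"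
proof -
  define cl where "cl K x = max (- K) (min K x)" for K x :: real
  have cl_le: "\<bar>cl K x\<bar> \<le> K" if "0 \<le> K" for K x using that by (auto simp: cl_def)
  have cl_cont: "continuous_on UNIV (cl K)" for K unfolding cl_def by (intro continuous_intros)
  have [measurable]: "cl K \<in> borel_measurable borel" for K
    using cl_cont by (rule borel_measurable_continuous_onI)
  have wm [measurable]: "w \<in> borel_measurable cell" using w by auto
  have "(\<lambda>k. LINT \<eta>|cell. \<bar>w \<eta> - cl (real k) (w \<eta>)\<bar>) \<longlonglongrightarrow> (LINT \<eta>|cell. 0)"
  proof (rule integral_dominated_convergence[where w = "\<lambda>\<eta>. \<bar>w \<eta>\<bar>"])
    have "\<forall>\<^sub>F k in sequentially. \<bar>w \<eta> - cl (real k) (w \<eta>)\<bar> = 0" for \<eta>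
      using eventually_ge_at_top[of "nat \<lceil>\<bar>w \<eta>\<bar>\<rceil>"]
      by eventually_elim (simp add: cl_def min_def max_def, linarith)
    then show "AE \<eta> in cell. (\<lambda>k. \<bar>w \<eta> - cl (real k) (w \<eta>)\<bar>) \<longlonglongrightarrow> 0"
      by (intro AE_I2 tendsto_eventually)
    show "AE \<eta> in cell. norm \<bar>w \<eta> - cl (real k) (w \<eta>)\<bar> \<le> \<bar>w \<eta>\<bar>" for k
      by (intro AE_I2) (auto simp: cl_def)
  qed (use w in auto)
  then have "\<forall>\<^sub>F k in sequentially. (LINT \<eta>|cell. \<bar>w \<eta> - cl (real k) (w \<eta>)\<bar>) < e / 2"
    by (rule order_tendstoD) (use e in simp)
  then obtain k where k: "(LINT \<eta>|cell. \<bar>w \<eta> - cl (real k) (w \<eta>)\<bar>) < e / 2"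
    by (auto simp: eventually_sequentially)
  have "w \<in> borel_measurable (lebesgue_on Upsilon)"
  proof -
    have "(\<lambda>x. indicator Upsilon x *\<^sub>R w x) \<in> borel_measurable lborel"
      using wm unfolding cell_def by (subst (asm) borel_measurable_restrict_space_iff) auto
    then have "(\<lambda>x. indicator Upsilon x *\<^sub>R w x) \<in> borel_measurable lebesgue"
      by (intro measurable_completion)
    then show ?thesis
      by (subst borel_measurable_restrict_space_iff) auto
  qed
  then have "w measurable_on Upsilon"
    by (subst measurable_on_iff_borel_measurable) auto
  then obtain N g where N: "negligible N" and g: "\<And>j. continuous_on UNIV (g j)"
    and lim: "\<And>x. x \<notin> N \<Longrightarrow> (\<lambda>j. g j x) \<longlonglongrightarrow> (if x \<in> Upsilon then w x else 0)"
    unfolding measurable_on_def by blast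
  have cg: "continuous_on UNIV (\<lambda>x. cl (real k) (g j x))" for j
    by (rule continuous_on_compose2[OF cl_cont g]) simp
  have "(\<lambda>j. LINT \<eta>|cell. \<bar>cl (real k) (w \<eta>) - cl (real k) (g j \<eta>)\<bar>) \<longlonglongrightarrow> (LINT \<eta>|cell. 0)"
  proof (rule integral_dominated_convergence[where w = "\<lambda>\<eta>. 2 * real k"])
    have "AE x in lebesgue. x \<notin> N"
      using N by (intro AE_not_in) (simp add: negligible_iff_null_sets)
    then have "AE x in lborel. x \<notin> N"
      by (subst (asm) AE_completion_iff) 
    then show "AE \<eta> in cell. (\<lambda>j. \<bar>cl (real k) (w \<eta>) - cl (real k) (g j \<eta>)\<bar>) \<longlonglongrightarrow> 0"
      unfolding AE_cell
    proof eventually_elim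
      case (elim x)
      show ?case
      proof
        assume "x \<in> Upsilon"
        with lim[OF elim] have "(\<lambda>j. g j x) \<longlonglongrightarrow> w x" by simp
        from continuous_on_tendsto_compose[OF cl_cont this]
        have "(\<lambda>j. cl (real k) (g j x)) \<longlonglongrightarrow> cl (real k) (w x)"
          by simp
        from tendsto_rabs[OF tendsto_diff[OF tendsto_const[of "cl (real k) (w x)"] this]]
        show "(\<lambda>j. \<bar>cl (real k) (w x) - cl (real k) (g j x)\<bar>) \<longlonglongrightarrow> 0" by simp
      qed
    qed
    show "AE \<eta> in cell. norm \<bar>cl (real k) (w \<eta>) - cl (real k) (g j \<eta>)\<bar> \<le> 2 * real k" for j
    proof (rule AE_I2)
      fix \<eta>
      show "norm \<bar>cl (real k) (w \<eta>) - cl (real k) (g j \<eta>)\<bar> \<le> 2 * real k"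
        using cl_le[of "real k" "w \<eta>"] cl_le[of "real k" "g j \<eta>"] by simp
    qed
    show "(\<lambda>\<eta>. \<bar>cl (real k) (w \<eta>) - cl (real k) (g j \<eta>)\<bar>) \<in> borel_measurable cell" for j
      using measurable_cell_continuous[OF cg[of j]] by measurable
  qed auto
  then have "\<forall>\<^sub>F j in sequentially. (LINT \<eta>|cell. \<bar>cl (real k) (w \<eta>) - cl (real k) (g j \<eta>)\<bar>) < e / 2"
    by (rule order_tendstoD) (use e in simp)
  then obtain j where j: "(LINT \<eta>|cell. \<bar>cl (real k) (w \<eta>) - cl (real k) (g j \<eta>)\<bar>) < e / 2"
    by (auto simp: eventually_sequentially)
  have i1: "integrable cell (\<lambda>\<eta>. cl (real k) (w \<eta>))"
    by (rule cell.integrable_const_bound[where B = "real k"]) (auto simp: cl_le)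
  have i2: "integrable cell (\<lambda>\<eta>. cl (real k) (g j \<eta>))"
    by (rule integrable_cell_continuous[OF cg])
  have "(LINT \<eta>|cell. \<bar>w \<eta> - cl (real k) (g j \<eta>)\<bar>)
      \<le> (LINT \<eta>|cell. \<bar>w \<eta> - cl (real k) (w \<eta>)\<bar> + \<bar>cl (real k) (w \<eta>) - cl (real k) (g j \<eta>)\<bar>)"
    using w i1 i2 by (intro integral_mono) auto
  also have "\<dots> < e"
    using w i1 i2 k j by simp
  finally have "(LINT \<eta>|cell. \<bar>w \<eta> - cl (real k) (g j \<eta>)\<bar>) < e" .
  then show ?thesis by (intro that[OF cg cl_le]) simp_all
qed

lemma fejer_mean_L1_limit:
  assumes w: "integrable cell w"
  shows "(\<lambda>n. LINT \<xi>|cell. \<bar>fejer_mean n w \<xi> - w \<xi>\<bar>) \<longlonglongrightarrow> 0"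
proof (rule LIMSEQ_I)
  fix r :: real assume r: "0 < r"
  obtain h M where h: "continuous_on UNIV h" "\<And>\<eta>. \<bar>h \<eta>\<bar> \<le> M" "(LINT \<eta>|cell. \<bar>w \<eta> - h \<eta>\<bar>) < r / 3"
    using L1_dense_continuous[OF w, of "r / 3"] r by auto
  have hi: "integrable cell h" by (rule integrable_cell_continuous[OF h(1)])
  have "\<forall>\<^sub>F n in sequentially. (LINT \<xi>|cell. \<bar>fejer_mean n h \<xi> - h \<xi>\<bar>) < r / 3"
    by (rule order_tendstoD[OF fejer_mean_L1_continuous[OF h(1,2)]]) (use r in simp)
  then obtain N where N: "\<And>n. N \<le> n \<Longrightarrow> (LINT \<xi>|cell. \<bar>fejer_mean n h \<xi> - h \<xi>\<bar>) < r / 3"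
    unfolding eventually_sequentially by blast
  show "\<exists>N. \<forall>n\<ge>N. norm ((LINT \<xi>|cell. \<bar>fejer_mean n w \<xi> - w \<xi>\<bar>) - 0) < r"
  proof (intro exI[of _ "Suc N"] allI impI)
    fix n assume n: "Suc N \<le> n"
    note i = integrable_fejer_mean[OF w, of n] integrable_fejer_mean[OF hi, of n] w hi
    have i': "integrable cell (fejer_mean n (\<lambda>\<eta>. w \<eta> - h \<eta>))"
      using i by (intro integrable_fejer_mean) auto
    have "(LINT \<xi>|cell. \<bar>fejer_mean n w \<xi> - w \<xi>\<bar>)
       \<le> (LINT \<xi>|cell. \<bar>fejer_mean n (\<lambda>\<eta>. w \<eta> - h \<eta>) \<xi>\<bar> + \<bar>fejer_mean n h \<xi> - h \<xi>\<bar> + \<bar>w \<xi> - h \<xi>\<bar>)"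
      using i i' by (intro integral_mono) (auto simp: fejer_mean_diff)
    also have "\<dots> = (LINT \<xi>|cell. \<bar>fejer_mean n (\<lambda>\<eta>. w \<eta> - h \<eta>) \<xi>\<bar>) + (LINT \<xi>|cell. \<bar>fejer_mean n h \<xi> - h \<xi>\<bar>) + (LINT \<xi>|cell. \<bar>w \<xi> - h \<xi>\<bar>)"
      using i i' by simp
    also have "(LINT \<xi>|cell. \<bar>fejer_mean n (\<lambda>\<eta>. w \<eta> - h \<eta>) \<xi>\<bar>) \<le> (LINT \<xi>|cell. \<bar>w \<xi> - h \<xi>\<bar>)"
      using i n by (intro fejer_mean_L1) auto
    finally have "(LINT \<xi>|cell. \<bar>fejer_mean n w \<xi> - w \<xi>\<bar>) < r"
      using h(3) N[of n] n by simp
    then show "norm ((LINT \<xi>|cell. \<bar>fejer_mean n w \<xi> - w \<xi>\<bar>) - 0) < r"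
      by (simp add: integral_nonneg)
  qed
qed

section \<open>Gaussian averages\<close>

interpretation std_normal: prob_space std_normal_distribution
  by (rule prob_space_normal_density) simp

lemma std_normal_integrable_iff:
  fixes f :: "real \<Rightarrow> real"
  assumes "f \<in> borel_measurable borel"
  shows "integrable std_normal_distribution f \<longleftrightarrow> integrable lborel (\<lambda>x. std_normal_density x * f x)"
  using assms by (subst integrable_density) (auto simp: normal_density_nonneg)

lemma std_normal_integral_eq:
  fixes f :: "real \<Rightarrow> real"
  assumes "f \<in> borel_measurable borel"
  shows "(LINT x|std_normal_distribution. f x) = (LINT x|lborel. std_normal_density x * f x)"
  using assms by (subst integral_density) (auto simp: normal_density_nonneg)

lemma std_normal_moments:
  shows integrable_std_normal_abs: "integrable std_normal_distribution (\<lambda>z. \<bar>z\<bar>)"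
    and integrable_std_normal_square: "integrable std_normal_distribution (\<lambda>z. z\<^sup>2)"
    and std_normal_square: "(LINT z|std_normal_distribution. z\<^sup>2) = 1"
    and std_normal_abs_le: "(LINT z|std_normal_distribution. \<bar>z\<bar>) \<le> 1"
proof -
  have "has_bochner_integral lborel (\<lambda>x. std_normal_density x * x ^ (2 * 1)) (fact (2 * 1) / (2 ^ 1 * fact 1))"
    by (rule std_normal_moment_even)
  then have *: "has_bochner_integral lborel (\<lambda>x. std_normal_density x * x\<^sup>2) 1"
    by simp
  then show sq: "integrable std_normal_distribution (\<lambda>z. z\<^sup>2)" "(LINT z|std_normal_distribution. z\<^sup>2) = 1"
    by (simp_all add: std_normal_integrable_iff std_normal_integral_eq has_bochner_integral_iff)
  have le: "\<bar>z\<bar> \<le> (1 + z\<^sup>2) / 2" for z :: real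
    using sum_squares_bound[of 1 "\<bar>z\<bar>"] by simp
  show a: "integrable std_normal_distribution (\<lambda>z. \<bar>z\<bar>)"
    by (rule Bochner_Integration.integrable_bound[of _ "\<lambda>z. (1 + z\<^sup>2) / 2"])
      (use sq le in \<open>auto intro!: AE_I2\<close>)
  have "(LINT z|std_normal_distribution. \<bar>z\<bar>) \<le> (LINT z|std_normal_distribution. (1 + z\<^sup>2) / 2)"
    by (intro integral_mono a) (use sq le in auto)
  also have "\<dots> = 1"
    using sq std_normal.prob_space by simp
  finally show "(LINT z|std_normal_distribution. \<bar>z\<bar>) \<le> 1" .
qed

text \<open>Integration by parts against the Gaussian density, whose derivative is - z times itself.
  A bounded derivative gives \<open>h\<close> at most linear growth, so the boundary terms
  vanish.\<close>

lemma Stein_identity: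
  fixes h h' :: "real \<Rightarrow> real"
  assumes h: "\<And>z. (h has_real_derivative h' z) (at z)"
    and cont: "continuous_on UNIV h'" and bound: "\<And>z. \<bar>h' z\<bar> \<le> B"
  shows "integrable std_normal_distribution (\<lambda>z. z * h z)"
    and "(LINT z|std_normal_distribution. z * h z) = (LINT z|std_normal_distribution. h' z)"
proof -
  have hc: "continuous_on UNIV h"
    using h by (blast intro: continuous_at_imp_continuous_on DERIV_isCont)
  have [measurable]: "h \<in> borel_measurable borel" "h' \<in> borel_measurable borel"
    using hc cont by (auto intro: borel_measurable_continuous_onI)
  have B: "0 \<le> B" using bound[of 0] by simp
  have growth: "\<bar>h z\<bar> \<le> \<bar>h 0\<bar> + B * \<bar>z\<bar>" for z
  proof -
    have "norm (h z - h 0) \<le> B * norm (z - 0)"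
      by (rule field_differentiable_bound[of UNIV h h'])
        (use h bound in \<open>auto intro: has_field_derivative_at_within\<close>)
    then show ?thesis by simp
  qed
  have zh: "integrable std_normal_distribution (\<lambda>z. z * h z)"
  proof (rule Bochner_Integration.integrable_bound)
    show "integrable std_normal_distribution (\<lambda>z. \<bar>h 0\<bar> * \<bar>z\<bar> + B * z\<^sup>2)"
      using integrable_std_normal_abs integrable_std_normal_square by simp
    have "\<bar>z * h z\<bar> \<le> \<bar>h 0\<bar> * \<bar>z\<bar> + B * z\<^sup>2" for z
      using mult_left_mono[OF growth[of z] abs_ge_zero[of z]]
      by (simp add: abs_mult algebra_simps power2_eq_square)
    then show "AE z in std_normal_distribution. norm (z * h z) \<le> norm (\<bar>h 0\<bar> * \<bar>z\<bar> + B * z\<^sup>2)"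
      by (intro AE_I2) (smt (verit) real_norm_def)
  qed measurable
  then show "integrable std_normal_distribution (\<lambda>z. z * h z)" .
  have ih': "integrable std_normal_distribution h'"
    by (rule std_normal.integrable_const_bound[where B = B]) (use bound in auto)
  let ?F = "\<lambda>z. - std_normal_density z * h z"
  let ?f = "\<lambda>z. std_normal_density z * (z * h z) - std_normal_density z * h' z"
  have dn: "(std_normal_density has_real_derivative - z * std_normal_density z) (at z)" for z
    unfolding std_normal_density_def
    by (rule derivative_eq_intros refl | simp)+
  have F: "(?F has_real_derivative ?f z) (at z)" for z
    by (auto intro!: derivative_eq_intros dn h simp: algebra_simps)
  have fint: "integrable lborel ?f"
    using zh ih' by (simp add: std_normal_integrable_iff)
  have dc: "continuous_on UNIV std_normal_density"
    using dn by (blast intro: continuous_at_imp_continuous_on DERIV_isCont)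
  have fc: "isCont ?f z" for z
    using dc hc cont by (intro continuous_intros) (auto simp: continuous_on_eq_continuous_at)
  \<comment> \<open>Decay of the density like z^(-2) already beats linear growth.\<close>
  have small: "\<bar>?F z\<bar> \<le> 2 * \<bar>h 0\<bar> / z\<^sup>2 + 2 * B / \<bar>z\<bar>" if "z \<noteq> 0" for z
  proof -
    have "z\<^sup>2 / 2 \<le> exp (z\<^sup>2 / 2)"
      using exp_ge_add_one_self[of "z\<^sup>2 / 2"] by linarith
    then have "inverse (exp (z\<^sup>2 / 2)) \<le> inverse (z\<^sup>2 / 2)"
      using that by (intro le_imp_inverse_le) auto
    then have e: "exp (- z\<^sup>2 / 2) \<le> 2 / z\<^sup>2"
      by (simp add: exp_minus)
    have "1 / sqrt (2 * pi) \<le> 1"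
      using pi_gt3 by (simp add: real_le_rsqrt)
    then have "std_normal_density z \<le> 1 * (2 / z\<^sup>2)"
      unfolding std_normal_density_def using e by (intro mult_mono) auto
    then have "\<bar>?F z\<bar> \<le> 2 / z\<^sup>2 * (\<bar>h 0\<bar> + B * \<bar>z\<bar>)"
      unfolding abs_mult abs_minus using growth[of z]
      by (intro mult_mono) auto
    also have "\<dots> = 2 * \<bar>h 0\<bar> / z\<^sup>2 + 2 * B / \<bar>z\<bar>"
    proof -
      have "z\<^sup>2 = \<bar>z\<bar> * \<bar>z\<bar>" by (simp add: power2_eq_square)
      then show ?thesis using that by (simp add: field_simps)
    qed
    finally show ?thesis .
  qed
  have lim: "(?F \<longlongrightarrow> 0) at_infinity"
  proof (rule Lim_null_comparison)
    show "\<forall>\<^sub>F z in at_infinity. norm (?F z) \<le> 2 * \<bar>h 0\<bar> / z\<^sup>2 + 2 * B / \<bar>z\<bar>"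
      using eventually_not_equal_at_infinity[of 0] by eventually_elim (use small in auto)
    have "filterlim (\<lambda>z::real. z\<^sup>2) at_infinity at_infinity"
      by (rule filterlim_power_at_infinity) (auto intro: filterlim_ident)
    moreover have "filterlim (\<lambda>z::real. \<bar>z\<bar>) at_infinity at_infinity"
      using filterlim_at_infinity_imp_norm_at_top[OF filterlim_ident[of "at_infinity :: real filter"]]
      by (auto intro: filterlim_at_top_imp_at_infinity)
    ultimately show "((\<lambda>z. 2 * \<bar>h 0\<bar> / z\<^sup>2 + 2 * B / \<bar>z\<bar>) \<longlongrightarrow> 0) at_infinity"
      by (intro tendsto_add_zero tendsto_divide_0[OF tendsto_const])
  qed
  have "(LBINT z=-\<infinity>..\<infinity>. ?f z) = 0 - 0"
  proof (rule interval_integral_FTC_integrable)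
    show "(?F has_vector_derivative ?f x) (at x)" for x
      using F by (simp add: has_real_derivative_iff_has_vector_derivative)
    show "set_integrable lborel (einterval (-\<infinity>) \<infinity>) ?f"
      using fint by (simp add: set_integrable_def)
    show "((?F \<circ> real_of_ereal) \<longlongrightarrow> 0) (at_right (-\<infinity>))" "((?F \<circ> real_of_ereal) \<longlongrightarrow> 0) (at_left \<infinity>)"
      unfolding ereal_tendsto_simps
      by (rule tendsto_mono[OF at_bot_le_at_infinity lim], rule tendsto_mono[OF at_top_le_at_infinity lim])
  qed (use fc in auto)
  then have "(LINT z|lborel. ?f z) = 0"
    by (simp add: interval_lebesgue_integral_def set_lebesgue_integral_def)
  then show "(LINT z|std_normal_distribution. z * h z) = (LINT z|std_normal_distribution. h' z)"
    using zh ih' by (simp add: std_normal_integrable_iff std_normal_integral_eq)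
qed

lemma integrable_std_normal_bounded:
  fixes f :: "real \<Rightarrow> real"
  assumes "f \<in> borel_measurable borel" "\<And>z. \<bar>f z\<bar> \<le> B"
  shows "integrable std_normal_distribution f"
  by (rule std_normal.integrable_const_bound[where B = B]) (use assms in auto)

text \<open>The real part of the characteristic function of the normal distribution, rotated by
  \<open>cis a\<close>.\<close>

lemma std_normal_cos: "(LINT z|std_normal_distribution. cos (a + k * z)) = exp (- k\<^sup>2 / 2) * cos a"
proof -
  have int: "integrable std_normal_distribution (\<lambda>z. iexp (k * z))"
    by (rule std_normal.integrable_const_bound[where B = 1]) auto
  have "(CLINT z|std_normal_distribution. cis a * iexp (k * z)) = cis a * char std_normal_distribution k"
    unfolding char_def by (simp add: int)
  then have "Re (CLINT z|std_normal_distribution. cis a * iexp (k * z)) = exp (- k\<^sup>2 / 2) * cos a"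
    unfolding char_std_normal_distribution by simp
  moreover have "Re (CLINT z|std_normal_distribution. cis a * iexp (k * z)) = (LINT z|std_normal_distribution. cos (a + k * z))"
  proof (subst integral_Re[symmetric])
    show "complex_integrable std_normal_distribution (\<lambda>z. cis a * iexp (k * z))"
      by (rule integrable_mult_right[OF int])
  qed (auto simp: cos_add Re_exp Im_exp cis.sel)
  ultimately show ?thesis by simp
qed

lemma std_normal_sin: "(LINT z|std_normal_distribution. sin (a + k * z)) = exp (- k\<^sup>2 / 2) * sin a"
  using std_normal_cos[of "a - pi / 2" k]
  by (simp add: cos_diff sin_diff cos_add sin_add algebra_simps cong: Bochner_Integration.integral_cong)

lemma std_normal_times_cos:
  "integrable std_normal_distribution (\<lambda>z. z * cos (a + k * z))"
  "(LINT z|std_normal_distribution. z * cos (a + k * z)) = - k * exp (- k\<^sup>2 / 2) * sin a"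
proof -
  have d: "((\<lambda>z. cos (a + k * z)) has_real_derivative - k * sin (a + k * z)) (at z)" for z
    by (auto intro!: derivative_eq_intros)
  have c: "continuous_on UNIV (\<lambda>z. - k * sin (a + k * z))"
    by (intro continuous_intros)
  have b: "\<bar>- k * sin (a + k * z)\<bar> \<le> \<bar>k\<bar>" for z
    by (simp add: abs_mult mult_left_le)
  show "integrable std_normal_distribution (\<lambda>z. z * cos (a + k * z))"
    by (rule Stein_identity(1)[OF d c b])
  show "(LINT z|std_normal_distribution. z * cos (a + k * z)) = - k * exp (- k\<^sup>2 / 2) * sin a"
    using Stein_identity(2)[OF d c b] by (simp add: std_normal_sin)
qed

lemma std_normal_times_sin:
  "integrable std_normal_distribution (\<lambda>z. z * sin (a + k * z))"
  "(LINT z|std_normal_distribution. z * sin (a + k * z)) = k * exp (- k\<^sup>2 / 2) * cos a"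
proof -
  have d: "((\<lambda>z. sin (a + k * z)) has_real_derivative k * cos (a + k * z)) (at z)" for z
    by (auto intro!: derivative_eq_intros)
  have c: "continuous_on UNIV (\<lambda>z. k * cos (a + k * z))"
    by (intro continuous_intros)
  have b: "\<bar>k * cos (a + k * z)\<bar> \<le> \<bar>k\<bar>" for z
    by (simp add: abs_mult mult_left_le)
  show "integrable std_normal_distribution (\<lambda>z. z * sin (a + k * z))"
    by (rule Stein_identity(1)[OF d c b])
  show "(LINT z|std_normal_distribution. z * sin (a + k * z)) = k * exp (- k\<^sup>2 / 2) * cos a"
    using Stein_identity(2)[OF d c b] by (simp add: std_normal_cos)
qed

text \<open>The primitive is monotone and gains the same amount over each period, and a length
  \<open>u\<close> is covered by at most u/(2 pi) + 1 full periods.\<close>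

lemma periodic_primitive_growth:
  fixes G g :: "real \<Rightarrow> real"
  assumes G: "\<And>y. (G has_real_derivative g y) (at y)" and g0: "\<And>y. 0 \<le> g y"
    and per: "\<And>y. g (y + 2 * pi) = g y" and u: "0 \<le> u"
  shows "0 \<le> G (y + u) - G y" "G (y + u) - G y \<le> integral {0..2 * pi} g * (u / (2 * pi) + 1)"
proof -
  have mono: "G a \<le> G b" if "a \<le> b" for a b
    using that G g0 by (intro DERIV_nonneg_imp_nondecreasing[of a b G]) blast+
  show "0 \<le> G (y + u) - G y" using mono[of y "y + u"] u by simp
  let ?I = "integral {0..2 * pi} g"
  have shift: "G (z + 2 * pi) - G z = ?I" for z
  proof -
    have "((\<lambda>y. G (y + 2 * pi)) has_real_derivative g (y + 2 * pi)) (at y)" for y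
      using G DERIV_shift by blast
    from DERIV_diff[OF this G]
    have "((\<lambda>y. G (y + 2 * pi) - G y) has_real_derivative 0) (at y)" for y
      by (simp add: per)
    then have "G (z + 2 * pi) - G z = G (0 + 2 * pi) - G 0"
      by (intro DERIV_isconst_all) auto
    moreover have "(g has_integral G (2 * pi) - G 0) {0..2 * pi}"
      by (rule fundamental_theorem_of_calculus)
        (simp_all add: has_vector_derivative_at_within G[unfolded has_real_derivative_iff_has_vector_derivative])
    ultimately show ?thesis by (simp add: integral_unique)
  qed
  have I0: "0 \<le> ?I" using shift[of 0] mono[of 0 "2 * pi"] by simp
  have many: "G (z + 2 * pi * real n) - G z = real n * ?I" for z n
  proof (induction n)
    case (Suc n)
    have "G (z + 2 * pi * real n + 2 * pi) - G (z + 2 * pi * real n) = ?I" by (rule shift)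
    with Suc show ?case by (simp add: algebra_simps)
  qed simp
  define n where "n = nat \<lceil>u / (2 * pi)\<rceil>"
  have n: "u / (2 * pi) \<le> real n" "real n \<le> u / (2 * pi) + 1"
    using u by (simp_all add: n_def)
  have "u \<le> 2 * pi * real n" using n(1) by (simp add: divide_le_eq mult.commute)
  then have "G (y + u) - G y \<le> real n * ?I" using mono[of "y + u" "y + 2 * pi * real n"] many[of y n] by simp
  also have "\<dots> \<le> (u / (2 * pi) + 1) * ?I" using n(2) I0 by (rule mult_right_mono)
  finally show "G (y + u) - G y \<le> ?I * (u / (2 * pi) + 1)" by (simp add: mult.commute)
qed

text \<open>Stein's identity applied to a primitive of \<open>g\<close> replaces a bound on the periodised Gaussian.\<close>

lemma std_normal_periodic_le:
  fixes g :: "real \<Rightarrow> real"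
  assumes cont: "continuous_on UNIV g" and g0: "\<And>y. 0 \<le> g y" and gB: "\<And>y. g y \<le> B"
    and per: "\<And>y. g (y + 2 * pi) = g y" and s: "0 < s"
  shows "(LINT z|std_normal_distribution. g (\<theta> + s * z)) \<le> (1 / s + 1) * integral {0..2 * pi} g"
proof -
  let ?I = "integral {0..2 * pi} g"
  have "\<exists>F. \<forall>x. - \<infinity> < ereal x \<longrightarrow> ereal x < \<infinity> \<longrightarrow> (F has_vector_derivative g x) (at x)"
    by (rule einterval_antiderivative) (use cont in \<open>auto simp: continuous_on_eq_continuous_at\<close>)
  then obtain G where G: "\<And>y. (G has_real_derivative g y) (at y)"
    by (auto simp: has_real_derivative_iff_has_vector_derivative)
  note gr = periodic_primitive_growth[OF G g0 per]
  have I0: "0 \<le> ?I" by (rule integral_nonneg) (auto intro!: integrable_continuous_real continuous_on_subset[OF cont] g0)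
  have absG: "\<bar>G (\<theta> + v) - G \<theta>\<bar> \<le> ?I * (\<bar>v\<bar> / (2 * pi) + 1)" for v
  proof (cases "0 \<le> v")
    case True
    then show ?thesis using gr[of v \<theta>] by simp
  next
    case False
    then show ?thesis using gr[of "- v" "\<theta> + v"] by simp
  qed
  \<comment> \<open>Normalised so that its derivative is \<open>g (\<theta> + s * z)\<close>. It
    grows at most like ?I (|z| / (2 pi) + 1 / s), so that z h(z) is controlled by the second and the
    first absolute moment.\<close>
  define h where "h z = (G (\<theta> + s * z) - G \<theta>) / s" for z
  have "((\<lambda>z. G (\<theta> + s * z)) has_real_derivative g (\<theta> + s * z) * s) (at z)" for z
    by (rule DERIV_chain2[OF G]) (auto intro!: derivative_eq_intros)
  then have h: "(h has_real_derivative g (\<theta> + s * z)) (at z)" for z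
    unfolding h_def using DERIV_cdivide[OF DERIV_diff[OF _ DERIV_const[of "G \<theta>"]], of "\<lambda>z. G (\<theta> + s * z)" _ z UNIV s] s
    by fastforce
  have c: "continuous_on UNIV (\<lambda>z. g (\<theta> + s * z))"
    by (rule continuous_on_compose2[OF cont]) (auto intro!: continuous_intros)
  have b: "\<bar>g (\<theta> + s * z)\<bar> \<le> B" for z using g0 gB by simp
  note st = Stein_identity[OF h c b]
  have "(LINT z|std_normal_distribution. g (\<theta> + s * z)) = (LINT z|std_normal_distribution. z * h z)"
    by (rule st(2)[symmetric])
  also have "\<dots> \<le> (LINT z|std_normal_distribution. ?I * (z\<^sup>2 / (2 * pi)) + ?I / s * \<bar>z\<bar>)"
  proof (rule integral_mono[OF st(1)])
    show "integrable std_normal_distribution (\<lambda>z. ?I * (z\<^sup>2 / (2 * pi)) + ?I / s * \<bar>z\<bar>)"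
      using integrable_std_normal_abs integrable_std_normal_square by simp
    fix z
    have "z * h z \<le> \<bar>z\<bar> * \<bar>h z\<bar>" by (simp add: abs_mult[symmetric])
    also have "\<bar>h z\<bar> \<le> ?I * (\<bar>s * z\<bar> / (2 * pi) + 1) / s"
      unfolding h_def abs_divide using absG[of "s * z"] s by (simp add: divide_right_mono)
    also have "\<bar>z\<bar> * (?I * (\<bar>s * z\<bar> / (2 * pi) + 1) / s) = ?I * (\<bar>z\<bar> * \<bar>z\<bar> / (2 * pi)) + ?I / s * \<bar>z\<bar>"
      using s by (simp add: abs_mult field_simps)
    also have "\<bar>z\<bar> * \<bar>z\<bar> = z\<^sup>2" by (simp add: power2_eq_square)
    finally show "z * h z \<le> ?I * (z\<^sup>2 / (2 * pi)) + ?I / s * \<bar>z\<bar>"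
      by (simp add: mult_left_mono)
  qed
  also have "\<dots> = ?I / (2 * pi) + ?I / s * (LINT z|std_normal_distribution. \<bar>z\<bar>)"
    using integrable_std_normal_abs integrable_std_normal_square by (simp add: std_normal_square)
  also have "\<dots> \<le> ?I + ?I / s * 1"
  proof (rule add_mono)
    have "?I * 1 \<le> ?I * (2 * pi)"
      using I0 pi_gt3 by (intro mult_left_mono) auto
    then show "?I / (2 * pi) \<le> ?I"
      by (simp add: divide_le_eq)
    show "?I / s * (LINT z|std_normal_distribution. \<bar>z\<bar>) \<le> ?I / s * 1"
      using I0 s by (intro mult_left_mono std_normal_abs_le) auto
  qed
  finally show ?thesis by (simp add: algebra_simps)
qed

text \<open>The weight z costs nothing because the first absolute moment is at most 1. By
  \<open>trig_poly_gauss_gradient\<close> the weighted average is a derivative, so the second bound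
  becomes the gradient bound of the heat flow.\<close>

lemma std_normal_abs_integral_le:
  fixes R :: "real \<Rightarrow> real"
  assumes [measurable]: "R \<in> borel_measurable borel" and K: "\<And>z. \<bar>R z\<bar> \<le> K"
  shows "\<bar>LINT z|std_normal_distribution. R z\<bar> \<le> K"
    and "\<bar>LINT z|std_normal_distribution. z * R z\<bar> \<le> K"
proof -
  have K0: "0 \<le> K" using K[of 0] by simp
  have "\<bar>LINT z|std_normal_distribution. R z\<bar> \<le> (LINT z|std_normal_distribution. \<bar>R z\<bar>)"
    by (rule integral_abs_bound)
  also have "\<dots> \<le> (LINT z|std_normal_distribution. K)"
    by (intro integral_mono integrable_std_normal_bounded[of _ K]) (use K K0 in auto)
  also have "\<dots> = K" using std_normal.prob_space by simp
  finally show "\<bar>LINT z|std_normal_distribution. R z\<bar> \<le> K" .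
  have Kz: "\<bar>z * R z\<bar> \<le> K * \<bar>z\<bar>" for z
    using mult_left_mono[OF K[of z] abs_ge_zero[of z]] by (simp add: abs_mult mult.commute)
  have int: "integrable std_normal_distribution (\<lambda>z. K * \<bar>z\<bar>)"
    using integrable_std_normal_abs by simp
  have "\<bar>LINT z|std_normal_distribution. z * R z\<bar> \<le> (LINT z|std_normal_distribution. \<bar>z * R z\<bar>)"
    by (rule integral_abs_bound)
  also have "\<dots> \<le> (LINT z|std_normal_distribution. K * \<bar>z\<bar>)"
  proof (rule integral_mono[OF _ int Kz])
    show "integrable std_normal_distribution (\<lambda>z. \<bar>z * R z\<bar>)"
      by (rule Bochner_Integration.integrable_bound[OF int]) (use Kz K0 in \<open>auto simp: abs_mult intro!: AE_I2\<close>)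
  qed
  also have "\<dots> = K * (LINT z|std_normal_distribution. \<bar>z\<bar>)"
    by simp
  also have "\<dots> \<le> K * 1"
    by (rule mult_left_mono[OF std_normal_abs_le K0])
  finally show "\<bar>LINT z|std_normal_distribution. z * R z\<bar> \<le> K" by simp
qed

section \<open>Non-negativity\<close>

text \<open>Taking the negative part is 1-Lipschitz and so preserves continuity into L^2.\<close>

lemma C_L2_negative_part:
  assumes f: "C_L2 T f"
  shows "C_L2 T (\<lambda>t \<xi>. max 0 (- f t \<xi>))"
  unfolding C_L2_def
proof (intro ballI conjI)
  fix t assume t: "t \<in> {0..T}"
  have Lp: "(\<lambda>\<xi>. max 0 (- f s \<xi>)) \<in> L2_per" if "s \<in> {0..T}" for s
  proof -
    note d = L2_perD[OF C_L2_D(1)[OF f that]]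
    have "periodic_ae (f s)" using C_L2_D(1)[OF f that] by (simp add: L2_per_def)
    then have "periodic_ae (\<lambda>\<xi>. max 0 (- f s \<xi>))"
      unfolding periodic_ae_def by (auto elim: eventually_mono)
    moreover have "integrable cell (\<lambda>\<xi>. (norm (max 0 (- f s \<xi>)))\<^sup>2)"
    proof (rule Bochner_Integration.integrable_bound[OF d(3)])
      show "(\<lambda>\<xi>. (norm (max 0 (- f s \<xi>)))\<^sup>2) \<in> borel_measurable cell" using d(2) by measurable
      show "AE \<xi> in cell. norm ((norm (max 0 (- f s \<xi>)))\<^sup>2) \<le> norm ((f s \<xi>)\<^sup>2)"
        by (intro AE_I2) (auto simp: max_def)
    qed
    ultimately show ?thesis
      using d(1) by (auto simp: L2_per_def set_integrable_Upsilon)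
  qed
  then show "(\<lambda>\<xi>. max 0 (- f t \<xi>)) \<in> L2_per" using t by blast
  show "((\<lambda>s. L2_norm (\<lambda>\<xi>. max 0 (- f s \<xi>) - max 0 (- f t \<xi>))) \<longlongrightarrow> 0) (at t within {0..T})"
  proof (rule Lim_null_comparison[OF _ C_L2_D(2)[OF f t]])
    show "\<forall>\<^sub>F s in at t within {0..T}. norm (L2_norm (\<lambda>\<xi>. max 0 (- f s \<xi>) - max 0 (- f t \<xi>)))
        \<le> L2_norm (\<lambda>\<xi>. f s \<xi> - f t \<xi>)"
      unfolding eventually_at_topological
    proof (intro exI[of _ UNIV] conjI ballI impI)
      fix s assume s: "s \<in> {0..T}"
      have "(LINT \<xi>|cell. (max 0 (- f s \<xi>) - max 0 (- f t \<xi>))\<^sup>2) \<le> (LINT \<xi>|cell. (f s \<xi> - f t \<xi>)\<^sup>2)"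
      proof (rule integral_mono)
        show "integrable cell (\<lambda>\<xi>. (max 0 (- f s \<xi>) - max 0 (- f t \<xi>))\<^sup>2)"
          by (rule L2_perD(3)[OF L2_per_diff[OF Lp[OF s] Lp[OF t]]])
        show "integrable cell (\<lambda>\<xi>. (f s \<xi> - f t \<xi>)\<^sup>2)"
          by (rule L2_perD(3)[OF L2_per_diff[OF C_L2_D(1)[OF f s] C_L2_D(1)[OF f t]]])
        fix \<xi>
        have "\<bar>max 0 (- f s \<xi>) - max 0 (- f t \<xi>)\<bar> \<le> \<bar>f s \<xi> - f t \<xi>\<bar>" by linarith
        then show "(max 0 (- f s \<xi>) - max 0 (- f t \<xi>))\<^sup>2 \<le> (f s \<xi> - f t \<xi>)\<^sup>2"
          by (rule abs_le_square_iff[THEN iffD1])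
      qed
      then show "norm (L2_norm (\<lambda>\<xi>. max 0 (- f s \<xi>) - max 0 (- f t \<xi>))) \<le> L2_norm (\<lambda>\<xi>. f s \<xi> - f t \<xi>)"
        by (simp add: L2_norm_eq)
    qed auto
  qed
qed

lemma C_L2_fejer_mean_continuous:
  assumes f: "C_L2 T f"
  shows "continuous_on {0..T} (\<lambda>t. fejer_mean n (f t) \<xi>)"
    and "continuous_on UNIV b \<Longrightarrow> (\<And>\<theta>. \<bar>b \<theta>\<bar> \<le> 1) \<Longrightarrow> continuous_on {0..T} (\<lambda>t. fejer_mean n (flux (f t) b) \<xi>)"
proof -
  have k: "(\<lambda>\<eta>. fejer n (\<xi> - \<eta>)) \<in> borel_measurable cell"
    by (intro measurable_cell_continuous continuous_intros)
  have K: "\<bar>fejer n (\<xi> - \<eta>)\<bar> \<le> real n ^ 3 / (2 * pi) ^ 3" for \<eta>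
    using fejer_le fejer_nonneg by simp
  have "continuous_on {0..T} (\<lambda>t. LINT \<eta>|cell. f t \<eta> * fejer n (\<xi> - \<eta>))"
    by (rule L1_continuous_kernel[OF _ C_L2_L1_limit[OF f] k K]) (auto intro: L2_perD(4)[OF C_L2_D(1)[OF f]])
  then show "continuous_on {0..T} (\<lambda>t. fejer_mean n (f t) \<xi>)"
    by (simp add: fejer_mean_def mult.commute)
  assume b: "continuous_on UNIV b" "\<And>\<theta>. \<bar>b \<theta>\<bar> \<le> 1"
  have "continuous_on {0..T} (\<lambda>t. LINT \<eta>|cell. flux (f t) b \<eta> * fejer n (\<xi> - \<eta>))"
    by (rule L1_continuous_kernel[OF _ C_L2_flux_limit[OF f _ b] k K]) (auto intro: flux_L1(1)[OF C_L2_D(1)[OF f] b])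
  then show "continuous_on {0..T} (\<lambda>t. fejer_mean n (flux (f t) b) \<xi>)"
    by (simp add: fejer_mean_def mult.commute)
qed

text \<open>Jensen's inequality for the kernel as a probability density, proved by Cauchy-Schwarz
  with the kernel split into two square roots.\<close>

lemma fejer_mean_square_le:
  assumes n: "0 < n" and w [measurable]: "w \<in> borel_measurable cell" and w2: "integrable cell (\<lambda>\<eta>. (w \<eta>)\<^sup>2)"
  shows "(fejer_mean n w \<xi>)\<^sup>2 \<le> fejer_mean n (\<lambda>\<eta>. (w \<eta>)\<^sup>2) \<xi>"
proof -
  have [measurable]: "(\<lambda>\<eta>. fejer n (\<xi> - \<eta>)) \<in> borel_measurable cell"
    by (intro measurable_cell_continuous continuous_intros)
  have fi: "integrable cell (\<lambda>\<eta>. fejer n (\<xi> - \<eta>))"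
    by (intro integrable_cell_continuous continuous_intros)
  have sq: "(sqrt (fejer n (\<xi> - \<eta>)))\<^sup>2 = fejer n (\<xi> - \<eta>)" for \<eta> by (simp add: fejer_nonneg)
  have "(LINT \<eta>|cell. \<bar>sqrt (fejer n (\<xi> - \<eta>)) * (sqrt (fejer n (\<xi> - \<eta>)) * w \<eta>)\<bar>)
      \<le> sqrt (LINT \<eta>|cell. (sqrt (fejer n (\<xi> - \<eta>)))\<^sup>2) * sqrt (LINT \<eta>|cell. (sqrt (fejer n (\<xi> - \<eta>)) * w \<eta>)\<^sup>2)"
    by (rule Cauchy_Schwarz_integral(2)) (auto simp: power_mult_distrib sq fi integrable_fejer_mult w2)
  also have "\<dots> = sqrt (fejer_mean n (\<lambda>\<eta>. (w \<eta>)\<^sup>2) \<xi>)"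
    by (simp add: power_mult_distrib sq integral_fejer n fejer_mean_def)
  also have "(LINT \<eta>|cell. \<bar>sqrt (fejer n (\<xi> - \<eta>)) * (sqrt (fejer n (\<xi> - \<eta>)) * w \<eta>)\<bar>) = fejer_mean n (\<lambda>\<eta>. \<bar>w \<eta>\<bar>) \<xi>"
    unfolding fejer_mean_def
    by (intro Bochner_Integration.integral_cong refl) (simp add: abs_mult fejer_nonneg flip: mult.assoc)
  finally have "\<bar>fejer_mean n w \<xi>\<bar> \<le> sqrt (fejer_mean n (\<lambda>\<eta>. (w \<eta>)\<^sup>2) \<xi>)"
    using fejer_mean_abs order_trans by blast
  then have "\<bar>fejer_mean n w \<xi>\<bar>\<^sup>2 \<le> (sqrt (fejer_mean n (\<lambda>\<eta>. (w \<eta>)\<^sup>2) \<xi>))\<^sup>2"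
    by (intro power_mono) auto
  moreover have "0 \<le> fejer_mean n (\<lambda>\<eta>. (w \<eta>)\<^sup>2) \<xi>"
    unfolding fejer_mean_def by (intro integral_nonneg_AE AE_I2 mult_nonneg_nonneg fejer_nonneg) simp
  ultimately show ?thesis by simp
qed

lemma fejer_mean_L2:
  assumes n: "0 < n" and w: "w \<in> borel_measurable cell" and w2: "integrable cell (\<lambda>\<eta>. (w \<eta>)\<^sup>2)"
  shows "(LINT \<xi>|cell. (fejer_mean n w \<xi>)\<^sup>2) \<le> (LINT \<eta>|cell. (w \<eta>)\<^sup>2)"
proof -
  have w1: "integrable cell w" by (rule cell.square_integrable_imp_integrable[OF w w2])
  have "(LINT \<xi>|cell. (fejer_mean n w \<xi>)\<^sup>2) \<le> (LINT \<xi>|cell. \<bar>fejer_mean n (\<lambda>\<eta>. (w \<eta>)\<^sup>2) \<xi>\<bar>)"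
  proof (rule integral_mono)
    show "integrable cell (\<lambda>\<xi>. (fejer_mean n w \<xi>)\<^sup>2)"
      by (intro integrable_cell_continuous continuous_on_power fejer_mean_continuous w1)
    show "integrable cell (\<lambda>\<xi>. \<bar>fejer_mean n (\<lambda>\<eta>. (w \<eta>)\<^sup>2) \<xi>\<bar>)"
      by (intro integrable_abs integrable_fejer_mean w2)
    show "(fejer_mean n w \<xi>)\<^sup>2 \<le> \<bar>fejer_mean n (\<lambda>\<eta>. (w \<eta>)\<^sup>2) \<xi>\<bar>" for \<xi>
      using fejer_mean_square_le[OF n w w2, of \<xi>] by linarith
  qed
  also have "\<dots> \<le> (LINT \<xi>|cell. \<bar>(w \<xi>)\<^sup>2\<bar>)" by (rule fejer_mean_L1[OF n w2])
  finally show ?thesis by simp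
qed

text \<open>The set where the continuous function is negative is open, and an open null set is
  empty. Constraints on the density, known for almost every time, thus hold for the averages at
  every time.\<close>

lemma AE_time_continuous_nonneg:
  fixes g :: "real \<Rightarrow> real"
  assumes g: "continuous_on {0<..<T} g" and ae: "AE t in lborel. t \<in> {0<..<T} \<longrightarrow> 0 \<le> g t"
    and t: "0 < t" "t < T"
  shows "0 \<le> g t"
proof (rule ccontr)
  assume "\<not> 0 \<le> g t"
  let ?N = "{0<..<T} \<inter> g -` {..<0}"
  have op: "open ?N"
    by (rule continuous_on_open_vimage[THEN iffD1, rule_format, OF _ g open_lessThan, unfolded Int_commute[of "g -` _"]]) simp
  have "?N \<in> null_sets lborel"
  proof (rule AE_iff_null_sets[THEN iffD2])
    show "?N \<in> sets lborel" using op by simp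
    show "AE x in lborel. x \<notin> ?N" using ae by eventually_elim auto
  qed
  then have "?N \<in> null_sets lebesgue" by (rule null_sets_completionI)
  then have "negligible ?N" by (simp add: negligible_iff_null_sets)
  then have "?N = {}" using open_not_negligible[OF op] by blast
  then show False using t \<open>\<not> 0 \<le> g t\<close> by auto
qed

text \<open>A \<open>C\<^sup>2\<close> substitute for the squared negative part; \<open>penalty \<delta> u = v\<^sup>3 / (\<delta> + v)\<close> for \<open>v = - u > 0\<close>.\<close>

definition penalty :: "real \<Rightarrow> real \<Rightarrow> real" where
  "penalty \<delta> u = (if u < 0 then (- u) ^ 3 / (\<delta> - u) else 0)"

definition penalty' :: "real \<Rightarrow> real \<Rightarrow> real" where
  "penalty' \<delta> u = (if u < 0 then - (u\<^sup>2 * (3 * \<delta> - 2 * u) / (\<delta> - u)\<^sup>2) else 0)"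

text \<open>The \<open>min\<close> merges both branches: for non-negative \<open>u\<close> the
  quotient is 1 and the value 0, so continuity is immediate. The upper bound 2 is the second
  derivative of the squared negative part.\<close>

definition penalty'' :: "real \<Rightarrow> real \<Rightarrow> real" where
  "penalty'' \<delta> u = 2 - 2 * (\<delta> / (\<delta> - min u 0)) ^ 3"

lemma penalty_deriv:
  assumes d: "0 < \<delta>"
  shows "(penalty \<delta> has_real_derivative penalty' \<delta> u) (at u)"
    and "(penalty' \<delta> has_real_derivative penalty'' \<delta> u) (at u)"
proof -
  consider "u < 0" | "u = 0" | "0 < u" by linarith
  then show "(penalty \<delta> has_real_derivative penalty' \<delta> u) (at u)"
  proof cases
    case 1
    have "((\<lambda>u. (- u) ^ 3 / (\<delta> - u)) has_real_derivative penalty' \<delta> u) (at u)"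
      using 1 d by (auto intro!: derivative_eq_intros simp: penalty'_def field_simps power2_eq_square power3_eq_cube)
    moreover have "\<forall>\<^sub>F x in nhds u. (- x) ^ 3 / (\<delta> - x) = penalty \<delta> x"
      using eventually_nhds_in_open[of "{..<0}" u] 1 by (auto elim!: eventually_mono simp: penalty_def)
    ultimately show ?thesis by (subst (asm) DERIV_cong_ev[OF refl _ refl]) auto
  next
    case 2
    have "\<bar>penalty \<delta> x - penalty \<delta> u\<bar> \<le> 1 * (x - u)\<^sup>2" for x
    proof (cases "x < 0")
      case True
      have "(- x) ^ 3 \<le> x\<^sup>2 * (\<delta> - x)"
        using d True by (simp add: power2_eq_square power3_eq_cube algebra_simps)
      then have "(- x) ^ 3 / (\<delta> - x) \<le> x\<^sup>2"
        using True d by (subst pos_divide_le_eq) auto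
      moreover have "0 \<le> (- x) ^ 3 / (\<delta> - x)"
        using True d by (intro divide_nonneg_pos zero_le_power) auto
      ultimately have "\<bar>penalty \<delta> x\<bar> \<le> x\<^sup>2"
        using True by (simp only: penalty_def if_True abs_of_nonneg)
      moreover have "penalty \<delta> u = 0" by (simp add: penalty_def 2)
      ultimately show ?thesis by (simp add: 2)
    qed (simp add: penalty_def 2)
    from DERIV_zero_of_quadratic[OF this] show ?thesis using 2 by (simp add: penalty'_def)
  next
    case 3
    have "\<forall>\<^sub>F x in nhds u. 0 = penalty \<delta> x"
      using eventually_nhds_in_open[of "{0<..}" u] 3 by (auto elim!: eventually_mono simp: penalty_def)
    then have "((\<lambda>x. 0) has_real_derivative 0) (at u) = (penalty \<delta> has_real_derivative 0) (at u)"
      by (rule DERIV_cong_ev[OF refl _ refl])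
    then show ?thesis using 3 by (simp add: penalty'_def)
  qed
  consider "u < 0" | "u = 0" | "0 < u" by linarith
  then show "(penalty' \<delta> has_real_derivative penalty'' \<delta> u) (at u)"
  proof cases
    case 1
    \<comment> \<open>Division with remainder; in this form the derivative is 2 - 2 (\<delta> /
      (\<delta> - x))^3 at sight.\<close>
    have eq: "- (x\<^sup>2 * (3 * \<delta> - 2 * x) / (\<delta> - x)\<^sup>2) = 2 * x + \<delta> - \<delta> ^ 3 / (\<delta> - x)\<^sup>2" if "x < 0" for x
    proof -
      have "(2 * x + \<delta>) * (\<delta> - x)\<^sup>2 - \<delta> ^ 3 = - (x\<^sup>2 * (3 * \<delta> - 2 * x))"
        by (simp add: power2_eq_square power3_eq_cube algebra_simps)
      moreover have "2 * x + \<delta> - \<delta> ^ 3 / (\<delta> - x)\<^sup>2 = ((2 * x + \<delta>) * (\<delta> - x)\<^sup>2 - \<delta> ^ 3) / (\<delta> - x)\<^sup>2"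
        using that d by (simp add: diff_divide_distrib)
      ultimately show ?thesis by simp
    qed
    have inv: "((\<lambda>x. inverse (\<delta> - x)) has_real_derivative (inverse (\<delta> - u))\<^sup>2) (at u)"
      using 1 d by (auto intro!: derivative_eq_intros simp: power2_eq_square)
    have "((\<lambda>x. 2 * x + \<delta> - \<delta> ^ 3 * (inverse (\<delta> - x))\<^sup>2) has_real_derivative
        2 - \<delta> ^ 3 * (2 * (inverse (\<delta> - u))\<^sup>2 * inverse (\<delta> - u))) (at u)"
      by (rule derivative_eq_intros inv refl | simp)+
    then have "((\<lambda>x. 2 * x + \<delta> - \<delta> ^ 3 / (\<delta> - x)\<^sup>2) has_real_derivative penalty'' \<delta> u) (at u)"
      using 1 by (simp add: penalty''_def divide_inverse power_mult_distrib power_inverse power3_eq_cube power2_eq_square mult.assoc mult.left_commute)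
    moreover have "\<forall>\<^sub>F x in nhds u. 2 * x + \<delta> - \<delta> ^ 3 / (\<delta> - x)\<^sup>2 = penalty' \<delta> x"
      using eventually_nhds_in_open[of "{..<0}" u] 1 by (auto elim!: eventually_mono simp: penalty'_def eq)
    ultimately show ?thesis by (subst (asm) DERIV_cong_ev[OF refl _ refl]) auto
  next
    case 2
    have "\<bar>penalty' \<delta> x - penalty' \<delta> u\<bar> \<le> 3 / \<delta> * (x - u)\<^sup>2" for x
    proof (cases "x < 0")
      case True
      have "x\<^sup>2 * (3 * \<delta> - 2 * x) \<le> x\<^sup>2 * (3 * (\<delta> - x))" using True by (intro mult_left_mono) auto
      also have "\<dots> \<le> x\<^sup>2 * (3 * (\<delta> - x)) * ((\<delta> - x) / \<delta>)"
      proof -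
        have "1 \<le> (\<delta> - x) / \<delta>" using True d by simp
        from mult_left_mono[OF this, of "x\<^sup>2 * (3 * (\<delta> - x))"] show ?thesis
          using True d by (simp only: mult_1_right) simp
      qed
      also have "\<dots> = 3 / \<delta> * x\<^sup>2 * (\<delta> - x)\<^sup>2" by (simp add: power2_eq_square)
      finally have "x\<^sup>2 * (3 * \<delta> - 2 * x) / (\<delta> - x)\<^sup>2 \<le> 3 / \<delta> * x\<^sup>2"
        using True d by (subst pos_divide_le_eq) auto
      moreover have "0 \<le> x\<^sup>2 * (3 * \<delta> - 2 * x) / (\<delta> - x)\<^sup>2" using True d by simp
      ultimately show ?thesis using True d 2 by (simp add: penalty'_def)
    qed (use d in \<open>simp add: penalty'_def 2\<close>)
    from DERIV_zero_of_quadratic[OF this] show ?thesis using 2 d by (simp add: penalty''_def)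
  next
    case 3
    have "\<forall>\<^sub>F x in nhds u. 0 = penalty' \<delta> x"
      using eventually_nhds_in_open[of "{0<..}" u] 3 by (auto elim!: eventually_mono simp: penalty'_def)
    then have "((\<lambda>x. 0) has_real_derivative 0) (at u) = (penalty' \<delta> has_real_derivative 0) (at u)"
      by (rule DERIV_cong_ev[OF refl _ refl])
    then show ?thesis using 3 d by (simp add: penalty''_def)
  qed
qed

lemma penalty''_bounds:
  assumes "0 < \<delta>"
  shows "0 \<le> penalty'' \<delta> u" "penalty'' \<delta> u \<le> 2" "0 \<le> u \<Longrightarrow> penalty'' \<delta> u = 0"
proof -
  have "0 \<le> \<delta> / (\<delta> - min u 0)" "\<delta> / (\<delta> - min u 0) \<le> 1"
    using assms by (auto simp: divide_le_eq min_def)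
  then have "0 \<le> (\<delta> / (\<delta> - min u 0)) ^ 3" "(\<delta> / (\<delta> - min u 0)) ^ 3 \<le> 1"
    by (auto intro: power_le_one)
  then show "0 \<le> penalty'' \<delta> u" "penalty'' \<delta> u \<le> 2"
    unfolding penalty''_def by linarith+
  show "0 \<le> u \<Longrightarrow> penalty'' \<delta> u = 0" using assms by (simp add: penalty''_def)
qed

lemma continuous_on_penalty:
  assumes d: "0 < \<delta>"
  shows "continuous_on S (penalty \<delta>)" "continuous_on S (penalty' \<delta>)" "continuous_on S (penalty'' \<delta>)"
proof -
  show "continuous_on S (penalty \<delta>)" "continuous_on S (penalty' \<delta>)"
    using penalty_deriv[OF d] by (blast intro: continuous_at_imp_continuous_on DERIV_isCont)+
  show "continuous_on S (penalty'' \<delta>)"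
    unfolding penalty''_def using d by (intro continuous_intros) (auto simp: min_def)
qed

text \<open>With v = - u > 0, the product (v^2 - \<delta> v) (v + \<delta>) equals v^3 - \<delta>^2
  v, which is below v^3. The loss is linear in \<delta>.\<close>

lemma penalty_lower:
  assumes "0 < \<delta>"
  shows "(max 0 (- u))\<^sup>2 - \<delta> * max 0 (- u) \<le> penalty \<delta> u"
proof (cases "u < 0")
  case True
  have "(u\<^sup>2 + \<delta> * u) * (\<delta> - u) \<le> (- u) ^ 3"
  proof -
    have "(u\<^sup>2 + \<delta> * u) * (\<delta> - u) = (- u) ^ 3 + \<delta>\<^sup>2 * u"
      by (simp add: power2_eq_square power3_eq_cube algebra_simps)
    moreover have "\<delta>\<^sup>2 * u \<le> 0" using True by (simp add: mult_nonneg_nonpos)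
    ultimately show ?thesis by simp
  qed
  then have "u\<^sup>2 + \<delta> * u \<le> (- u) ^ 3 / (\<delta> - u)"
    using True assms by (subst pos_le_divide_eq) auto
  then show ?thesis using True by (simp add: penalty_def)
qed (simp add: penalty_def)

section \<open>Fourier coefficients and means of a global solution\<close>

locale global_solution =
  fixes Pe De :: real and f0 :: "point \<Rightarrow> real" and f :: "real \<Rightarrow> point \<Rightarrow> real"
  assumes De: "0 < De"
    and f0_Linf: "f0 \<in> Linf_per"
    and f0_nonneg: "AE \<xi> in lborel. 0 \<le> f0 \<xi>"
    and sol: "global_weak_solution Pe De f0 f"
begin

lemma weak: "0 < T \<Longrightarrow> weak_solution Pe De f0 T f"
  using sol by (simp add: global_weak_solution_def)

lemma CL2: "0 < T \<Longrightarrow> C_L2 T f"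
  using weak[of T] unfolding weak_solution_def Let_def by blast

lemma f_L2: "0 \<le> t \<Longrightarrow> f t \<in> L2_per"
  using C_L2_D(1)[OF CL2[of "t + 1"], of t] by simp

lemmas f_integrable = L2_perD(4)[OF f_L2]

lemma flux_integrable:
  assumes "0 \<le> t"
  shows "integrable cell (flux (f t) cos)" "integrable cell (flux (f t) sin)"
  by (intro flux_L1(1) f_L2 assms continuous_on_cos continuous_on_sin continuous_on_id; simp)+

lemma f0_bound:
  "AE \<xi> in cell. 0 \<le> f0 \<xi> \<and> f0 \<xi> \<le> enn2real (Linf_norm Upsilon f0)"
proof -
  have m [measurable]: "f0 \<in> borel_measurable cell"
    using f0_Linf by (auto simp: Linf_per_def intro: measurable_cell)
  have fin: "Linf_norm Upsilon f0 < \<infinity>" using f0_Linf by (simp add: Linf_per_def)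
  have "AE \<xi> in cell. ennreal \<bar>f0 \<xi>\<bar> \<le> esssup cell (\<lambda>x. ennreal \<bar>f0 x\<bar>)"
    by (rule esssup_AE)
  moreover have "AE \<xi> in cell. 0 \<le> f0 \<xi>"
    using f0_nonneg unfolding AE_cell by eventually_elim simp
  ultimately show ?thesis
  proof eventually_elim
    case (elim \<xi>)
    then have "ennreal \<bar>f0 \<xi>\<bar> \<le> ennreal (enn2real (Linf_norm Upsilon f0))"
      using fin by (simp add: Linf_norm_def cell_def less_top)
    then show ?case using elim by (subst (asm) ennreal_le_iff) auto
  qed
qed

lemma f0_L2: "f0 \<in> L2_per"
proof -
  have m: "f0 \<in> borel_measurable lborel" "periodic_ae f0"
    using f0_Linf by (auto simp: Linf_per_def)
  have "integrable cell (\<lambda>\<xi>. (f0 \<xi>)\<^sup>2)"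
  proof (rule cell.integrable_const_bound)
    show "AE \<xi> in cell. norm ((f0 \<xi>)\<^sup>2) \<le> (enn2real (Linf_norm Upsilon f0))\<^sup>2"
      using f0_bound by eventually_elim (auto intro: power_mono)
    show "(\<lambda>\<xi>. (f0 \<xi>)\<^sup>2) \<in> borel_measurable cell" using measurable_cell[OF m(1)] by measurable
  qed
  then show ?thesis using m by (simp add: L2_per_def set_integrable_Upsilon)
qed

text \<open>As t tends to 0, \<open>f t\<close> converges in L^2 both to \<open>f0\<close> and to
  \<open>f 0\<close>. The coefficients, continuous up to time 0, therefore start from those of the
  initial datum.\<close>

lemma initial: "AE \<xi> in cell. f 0 \<xi> = f0 \<xi>"
proof -
  have l0: "((\<lambda>t. L2_norm (\<lambda>\<xi>. f t \<xi> - f0 \<xi>)) \<longlongrightarrow> 0) (at_right 0)"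
    using weak[of 1] unfolding weak_solution_def Let_def by simp
  have "((\<lambda>s. L2_norm (\<lambda>\<xi>. f s \<xi> - f 0 \<xi>)) \<longlongrightarrow> 0) (at 0 within {0..1})"
    using C_L2_D(2)[OF CL2[of 1], of 0] by simp
  then have l1: "((\<lambda>s. L2_norm (\<lambda>\<xi>. f s \<xi> - f 0 \<xi>)) \<longlongrightarrow> 0) (at_right 0)"
    by (simp add: at_within_Icc_at_right)
  have "L2_norm (\<lambda>\<xi>. f 0 \<xi> - f0 \<xi>) \<le> 0 + 0"
  proof (rule tendsto_lowerbound[OF tendsto_add[OF l0 l1]])
    have "L2_norm (\<lambda>\<xi>. f 0 \<xi> - f0 \<xi>) \<le> L2_norm (\<lambda>\<xi>. f t \<xi> - f0 \<xi>) + L2_norm (\<lambda>\<xi>. f t \<xi> - f 0 \<xi>)" if "0 < t" for t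
    proof -
      have "L2_norm (\<lambda>\<xi>. f 0 \<xi> - f0 \<xi>)
          \<le> L2_norm (\<lambda>\<xi>. f t \<xi> - f0 \<xi>) + L2_norm (\<lambda>\<xi>. (f 0 \<xi> - f0 \<xi>) - (f t \<xi> - f0 \<xi>))"
        using that by (intro L2_norm_triangle L2_per_diff f_L2 f0_L2) auto
      also have "L2_norm (\<lambda>\<xi>. (f 0 \<xi> - f0 \<xi>) - (f t \<xi> - f0 \<xi>)) = L2_norm (\<lambda>\<xi>. f t \<xi> - f 0 \<xi>)"
        by (simp add: L2_norm_eq power2_commute)
      finally show ?thesis .
    qed
    then show "\<forall>\<^sub>F t in at_right 0. L2_norm (\<lambda>\<xi>. f 0 \<xi> - f0 \<xi>) \<le> L2_norm (\<lambda>\<xi>. f t \<xi> - f0 \<xi>) + L2_norm (\<lambda>\<xi>. f t \<xi> - f 0 \<xi>)"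
      by (auto simp: eventually_at_right_less intro: eventually_mono[OF eventually_at_right_less])
  qed simp
  then have "(LINT \<xi>|cell. (f 0 \<xi> - f0 \<xi>)\<^sup>2) = 0"
    by (simp add: L2_norm_eq order_antisym)
  moreover have "integrable cell (\<lambda>\<xi>. (f 0 \<xi> - f0 \<xi>)\<^sup>2)"
    by (intro L2_perD(3) L2_per_diff f_L2 f0_L2) simp
  ultimately have "AE \<xi> in cell. (f 0 \<xi> - f0 \<xi>)\<^sup>2 = 0"
    by (subst (asm) integral_nonneg_eq_0_iff_AE) auto
  then show ?thesis by eventually_elim simp
qed

text \<open>These are the phases 0 and - pi/2 of \<open>weak_solution_coeff_deriv\<close>. The
  second turns cos into sin and sin into - cos, whence the opposite signs in front of
  \<open>Pe\<close>.\<close>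

lemma coeff_deriv:
  assumes t: "0 < t" and p: "p \<in> freqs n"
  shows "((\<lambda>t. cos_coeff n (f t) p) has_real_derivative
      - decay De (freq p) * cos_coeff n (f t) p - Pe * (fst (fst (freq p)) * sin_coeff n (flux (f t) cos) p
        + snd (fst (freq p)) * sin_coeff n (flux (f t) sin) p)) (at t)"
    and "((\<lambda>t. sin_coeff n (f t) p) has_real_derivative
      - decay De (freq p) * sin_coeff n (f t) p + Pe * (fst (fst (freq p)) * cos_coeff n (flux (f t) cos) p
        + snd (fst (freq p)) * cos_coeff n (flux (f t) sin) p)) (at t)"
proof -
  let ?N = "(2 * pi) ^ 3 * real n ^ 3"
  have W: "((\<lambda>t. LINT \<eta>|cell. f t \<eta> * cos (freq p \<bullet> \<eta> + a)) has_real_derivative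
    - decay De (freq p) * (LINT \<eta>|cell. f t \<eta> * cos (freq p \<bullet> \<eta> + a)) - Pe * flux_coeff (f t) (freq p) a) (at t)" for a
    by (rule weak_solution_coeff_deriv[OF weak[of "t + 1"] freq_lattice[OF p] t]) (use t in simp_all)
  have alg: "(- l * C - Pe * (a * x + b * y)) / N = - l * (C / N) - Pe * (a * (x / N) + b * (y / N))"
    for l C a b x y N :: real
    by (simp add: divide_inverse algebra_simps)
  show "((\<lambda>t. cos_coeff n (f t) p) has_real_derivative
      - decay De (freq p) * cos_coeff n (f t) p - Pe * (fst (fst (freq p)) * sin_coeff n (flux (f t) cos) p
        + snd (fst (freq p)) * sin_coeff n (flux (f t) sin) p)) (at t)"
    unfolding cos_coeff_def sin_coeff_def
    by (rule DERIV_cong[OF DERIV_cdivide[OF W[of 0, unfolded add_0_right], of ?N] alg])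
  have s: "cos (x + - (pi / 2)) = sin x" "sin (x + - (pi / 2)) = - cos x" for x :: real
    by (simp_all add: cos_diff sin_diff flip: diff_conv_add_uminus)
  have alg2: "(- l * C - Pe * (- (a * x) + - (b * y))) / N = - l * (C / N) + Pe * (a * (x / N) + b * (y / N))"
    for l C a b x y N :: real
    by (simp add: divide_inverse algebra_simps)
  show "((\<lambda>t. sin_coeff n (f t) p) has_real_derivative
      - decay De (freq p) * sin_coeff n (f t) p + Pe * (fst (fst (freq p)) * cos_coeff n (flux (f t) cos) p
        + snd (fst (freq p)) * cos_coeff n (flux (f t) sin) p)) (at t)"
    unfolding cos_coeff_def sin_coeff_def
    by (rule DERIV_cong[OF DERIV_cdivide[OF W[of "- (pi / 2)", unfolded s mult_minus_right Bochner_Integration.integral_minus], of ?N] alg2])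
qed

lemma coeff_continuous:
  assumes T: "0 < T"
  shows "continuous_on {0..T} (\<lambda>t. cos_coeff n (f t) p)" "continuous_on {0..T} (\<lambda>t. sin_coeff n (f t) p)"
    and "continuous_on {0..T} (\<lambda>t. cos_coeff n (flux (f t) cos) p)" "continuous_on {0..T} (\<lambda>t. sin_coeff n (flux (f t) cos) p)"
    and "continuous_on {0..T} (\<lambda>t. cos_coeff n (flux (f t) sin) p)" "continuous_on {0..T} (\<lambda>t. sin_coeff n (flux (f t) sin) p)"
proof -
  have k: "(\<lambda>\<eta>. cos (freq p \<bullet> \<eta>)) \<in> borel_measurable cell" "(\<lambda>\<eta>. sin (freq p \<bullet> \<eta>)) \<in> borel_measurable cell"
    by (intro measurable_cell_continuous continuous_intros)+
  note C = CL2[OF T]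
  have cc: "continuous_on UNIV (cos :: real \<Rightarrow> real)" "continuous_on UNIV (sin :: real \<Rightarrow> real)"
    by (intro continuous_on_cos continuous_on_sin continuous_on_id)+
  have i: "t \<in> {0..T} \<Longrightarrow> integrable cell (f t)" "t \<in> {0..T} \<Longrightarrow> integrable cell (flux (f t) cos)"
    "t \<in> {0..T} \<Longrightarrow> integrable cell (flux (f t) sin)" for t
    using f_integrable[of t] flux_integrable[of t] by auto
  note fl = C_L2_flux_limit[OF C _ cc(1) abs_cos_le_one] C_L2_flux_limit[OF C _ cc(2) abs_sin_le_one]
  have L: "continuous_on {0..T} (\<lambda>t. (LINT \<eta>|cell. f t \<eta> * k \<eta>) * N)"
    "continuous_on {0..T} (\<lambda>t. (LINT \<eta>|cell. flux (f t) cos \<eta> * k \<eta>) * N)"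
    "continuous_on {0..T} (\<lambda>t. (LINT \<eta>|cell. flux (f t) sin \<eta> * k \<eta>) * N)"
    if "k \<in> borel_measurable cell" "\<And>\<eta>. \<bar>k \<eta>\<bar> \<le> 1" for k N
    by (rule continuous_on_mult_right, rule L1_continuous_kernel[OF i(1) C_L2_L1_limit[OF C] that],
        assumption, assumption,
        rule continuous_on_mult_right, rule L1_continuous_kernel[OF i(2) fl(1) that],
        assumption, assumption,
        rule continuous_on_mult_right, rule L1_continuous_kernel[OF i(3) fl(2) that])
  note L1 = L[OF k(1) abs_cos_le_one] and L2 = L[OF k(2) abs_sin_le_one]
  show "continuous_on {0..T} (\<lambda>t. cos_coeff n (f t) p)" "continuous_on {0..T} (\<lambda>t. sin_coeff n (f t) p)"
    "continuous_on {0..T} (\<lambda>t. cos_coeff n (flux (f t) cos) p)" "continuous_on {0..T} (\<lambda>t. sin_coeff n (flux (f t) cos) p)"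
    "continuous_on {0..T} (\<lambda>t. cos_coeff n (flux (f t) sin) p)" "continuous_on {0..T} (\<lambda>t. sin_coeff n (flux (f t) sin) p)"
    by (simp_all only: cos_coeff_def sin_coeff_def divide_inverse L1 L2)
qed

text \<open>The occupied fraction lies in \<open>[0, 1]\<close> only for almost every time, but the averages are continuous in time.\<close>

lemma vacancy_AE:
  "AE t in lborel. 0 < t \<longrightarrow> (AE \<eta> in cell. 0 \<le> angular_int (f t) (fst \<eta>) \<and> angular_int (f t) (fst \<eta>) \<le> 1)"
proof -
  \<comment> \<open>The constraint is given on bounded time intervals; countably many of them
    exhaust the half-line, so that one null set of times remains.\<close>
  have "AE t in lborel. t \<in> {0<..<real (Suc N)} \<longrightarrow> (AE \<eta> in cell. 0 \<le> angular_int (f t) (fst \<eta>) \<and> angular_int (f t) (fst \<eta>) \<le> 1)" for N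
  proof -
    have "AE p in lborel \<Otimes>\<^sub>M lborel. p \<in> {0<..<real (Suc N)} \<times> Omega \<longrightarrow>
        0 \<le> angular_int (f (fst p)) (snd p) \<and> angular_int (f (fst p)) (snd p) \<le> 1"
      using weak[of "real (Suc N)"] unfolding weak_solution_def Let_def lborel_prod by simp
    from lborel_pair.AE_pair[OF this]
    show ?thesis
    proof eventually_elim
      case (elim t)
      show ?case
      proof
        assume "t \<in> {0<..<real (Suc N)}"
        with elim have *: "AE x in lborel. x \<in> Omega \<longrightarrow> 0 \<le> angular_int (f t) x \<and> angular_int (f t) x \<le> 1"
          by (auto elim: eventually_mono)
        show "AE \<eta> in cell. 0 \<le> angular_int (f t) (fst \<eta>) \<and> angular_int (f t) (fst \<eta>) \<le> 1"
        proof (rule AE_fst_cell)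
          have "AE x in restrict_space lborel Omega. P x" if "AE x in lborel. x \<in> Omega \<longrightarrow> P x" for P
            using that by (subst AE_restrict_space_iff) simp_all
          from this[OF *]
          show "AE x in restrict_space lborel Omega. 0 \<le> angular_int (f t) x \<and> angular_int (f t) x \<le> 1" .
        qed
      qed
    qed
  qed
  then have "AE t in lborel. \<forall>N. t \<in> {0<..<real (Suc N)} \<longrightarrow> (AE \<eta> in cell. 0 \<le> angular_int (f t) (fst \<eta>) \<and> angular_int (f t) (fst \<eta>) \<le> 1)"
    by (subst AE_all_countable) blast
  then show ?thesis
  proof eventually_elim
    case (elim t)
    obtain N where "t < real N" using reals_Archimedean2 by blast
    then have "t < real (Suc N)" by simp
    then show ?case using elim by (auto simp del: of_nat_Suc)
  qed
qed

text \<open>At almost every time the vacancy has modulus at most 1 and the kernel is non-negative;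
  both sides are continuous in time. The right-hand side has |f| inside the mean because the sign of
  \<open>f\<close> is still open, and its continuity follows from |f| = f + 2 max(0, - f).\<close>

lemma fejer_mean_flux_le:
  assumes t: "0 < t" and a: "continuous_on UNIV a" "\<And>\<theta>. \<bar>a \<theta>\<bar> \<le> 1"
  shows "\<bar>fejer_mean n (flux (f t) a) \<xi>\<bar> \<le> fejer_mean n (\<lambda>\<eta>. \<bar>f t \<eta>\<bar>) \<xi>"
proof -
  have T: "0 < t + 1" using t by simp
  have Cabs: "continuous_on {0..t + 1} (\<lambda>s. fejer_mean n (\<lambda>\<eta>. \<bar>f s \<eta>\<bar>) \<xi>)"
  proof -
    have c1: "continuous_on {0..t + 1} (\<lambda>s. fejer_mean n (\<lambda>\<eta>. max 0 (- f s \<eta>)) \<xi>)"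
      by (rule C_L2_fejer_mean_continuous(1)[OF C_L2_negative_part[OF CL2[OF T]]])
    have eq: "fejer_mean n (\<lambda>\<eta>. \<bar>f s \<eta>\<bar>) \<xi> = fejer_mean n (f s) \<xi> - (- 2) * fejer_mean n (\<lambda>\<eta>. max 0 (- f s \<eta>)) \<xi>"
      if "s \<in> {0..t + 1}" for s
    proof -
      have i: "integrable cell (f s)" "integrable cell (\<lambda>\<eta>. max 0 (- f s \<eta>))"
        using that f_integrable[of s] by auto
      have "(\<lambda>\<eta>. \<bar>f s \<eta>\<bar>) = (\<lambda>\<eta>. f s \<eta> - (- 2) * max 0 (- f s \<eta>))" by (auto simp: fun_eq_iff max_def)
      then have "fejer_mean n (\<lambda>\<eta>. \<bar>f s \<eta>\<bar>) \<xi> = fejer_mean n (\<lambda>\<eta>. f s \<eta> - (- 2) * max 0 (- f s \<eta>)) \<xi>" by simp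
      also have "\<dots> = fejer_mean n (f s) \<xi> - fejer_mean n (\<lambda>\<eta>. (- 2) * max 0 (- f s \<eta>)) \<xi>"
        using i by (intro fejer_mean_diff) auto
      also have "fejer_mean n (\<lambda>\<eta>. (- 2) * max 0 (- f s \<eta>)) \<xi> = (- 2) * fejer_mean n (\<lambda>\<eta>. max 0 (- f s \<eta>)) \<xi>"
        unfolding fejer_mean_def by (subst integral_mult_right_zero[symmetric]) (simp add: mult.left_commute)
      finally show ?thesis .
    qed
    have "continuous_on {0..t + 1} (\<lambda>s. fejer_mean n (f s) \<xi> - (- 2) * fejer_mean n (\<lambda>\<eta>. max 0 (- f s \<eta>)) \<xi>)"
      by (intro continuous_on_diff continuous_on_mult_left c1 C_L2_fejer_mean_continuous(1)[OF CL2[OF T]])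
    moreover have "continuous_on {0..t + 1} (\<lambda>s. fejer_mean n (\<lambda>\<eta>. \<bar>f s \<eta>\<bar>) \<xi>)
        \<longleftrightarrow> continuous_on {0..t + 1} (\<lambda>s. fejer_mean n (f s) \<xi> - (- 2) * fejer_mean n (\<lambda>\<eta>. max 0 (- f s \<eta>)) \<xi>)"
      by (rule continuous_on_cong[OF refl eq])
    ultimately show ?thesis by (simp only:)
  qed
  have "0 \<le> fejer_mean n (\<lambda>\<eta>. \<bar>f t \<eta>\<bar>) \<xi> - \<bar>fejer_mean n (flux (f t) a) \<xi>\<bar>"
  proof (rule AE_time_continuous_nonneg[where T = "t + 1" and t = t
        and g = "\<lambda>s. fejer_mean n (\<lambda>\<eta>. \<bar>f s \<eta>\<bar>) \<xi> - \<bar>fejer_mean n (flux (f s) a) \<xi>\<bar>"])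
    show "continuous_on {0<..<t + 1} (\<lambda>s. fejer_mean n (\<lambda>\<eta>. \<bar>f s \<eta>\<bar>) \<xi> - \<bar>fejer_mean n (flux (f s) a) \<xi>\<bar>)"
      by (rule continuous_on_subset[of "{0..t + 1}"])
        (auto intro!: continuous_on_diff continuous_on_rabs Cabs C_L2_fejer_mean_continuous(2)[OF CL2[OF T] a])
    show "AE s in lborel. s \<in> {0<..<t + 1} \<longrightarrow> 0 \<le> fejer_mean n (\<lambda>\<eta>. \<bar>f s \<eta>\<bar>) \<xi> - \<bar>fejer_mean n (flux (f s) a) \<xi>\<bar>"
      using vacancy_AE
    proof eventually_elim
      case (elim s)
      show ?case
      proof
        assume s: "s \<in> {0<..<t + 1}"
        then have ae: "AE \<eta> in cell. 0 \<le> angular_int (f s) (fst \<eta>) \<and> angular_int (f s) (fst \<eta>) \<le> 1"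
          using elim by simp
        have i: "integrable cell (flux (f s) a)" "integrable cell (f s)"
          using s by (auto intro!: flux_L1(1) f_L2 a f_integrable)
        have "fejer_mean n (\<lambda>\<eta>. \<bar>flux (f s) a \<eta>\<bar>) \<xi> \<le> fejer_mean n (\<lambda>\<eta>. \<bar>f s \<eta>\<bar>) \<xi>"
        proof (rule fejer_mean_mono)
          show "AE \<eta> in cell. \<bar>flux (f s) a \<eta>\<bar> \<le> \<bar>f s \<eta>\<bar>"
            using ae
          proof eventually_elim
            case (elim \<eta>)
            have "\<bar>1 - angular_int (f s) (fst \<eta>)\<bar> * \<bar>f s \<eta>\<bar> * \<bar>a (snd \<eta>)\<bar> \<le> 1 * \<bar>f s \<eta>\<bar> * 1"
              using elim a(2)[of "snd \<eta>"] by (intro mult_mono) auto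
            then show ?case by (simp add: flux_def abs_mult)
          qed
        qed (use i in auto)
        then show "0 \<le> fejer_mean n (\<lambda>\<eta>. \<bar>f s \<eta>\<bar>) \<xi> - \<bar>fejer_mean n (flux (f s) a) \<xi>\<bar>"
          using fejer_mean_abs[of n "flux (f s) a" \<xi>] by linarith
      qed
    qed
  qed (use t in auto)
  then show ?thesis by simp
qed


section \<open>Energy estimate for the negative part\<close>

definition energy :: "nat \<Rightarrow> real \<Rightarrow> real \<Rightarrow> real" where
  "energy n \<delta> t = integral period_box (\<lambda>\<xi>. penalty \<delta> (fejer_mean n (f t) \<xi>))"

text \<open>The negative part of the solution itself, not of its means: the error that the energy
  estimate leaves.\<close>

definition defect :: "real \<Rightarrow> real" where
  "defect t = (LINT \<xi>|cell. (max 0 (- f t \<xi>))\<^sup>2)"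

abbreviation mean_poly :: "nat \<Rightarrow> (point \<Rightarrow> real) \<Rightarrow> point \<Rightarrow> real" where
  "mean_poly n w \<equiv> trig_poly (freqs n) freq (cos_coeff n w) (sin_coeff n w)"

lemma defect_continuous: "0 < T \<Longrightarrow> continuous_on {0..T} defect"
proof -
  assume T: "0 < T"
  have "continuous_on {0..T} (\<lambda>t. (L2_norm (\<lambda>\<xi>. max 0 (- f t \<xi>)))\<^sup>2)"
    by (intro continuous_on_power C_L2_norm_continuous C_L2_negative_part CL2 T)
  then show ?thesis by (simp add: L2_norm_square defect_def[abs_def])
qed

lemma energy_continuous:
  assumes T: "0 < T" and \<delta>: "0 < \<delta>"
  shows "continuous_on {0..T} (energy n \<delta>)"
proof -
  have "continuous_on {0..T} (\<lambda>t. integral period_box (\<lambda>\<xi>. penalty \<delta> (mean_poly n (f t) \<xi>)))"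
  proof (rule integral_continuous_on_param)
    have "continuous_on ({0..T} \<times> period_box) (\<lambda>x. k (fst x))" if "continuous_on {0..T} k" for k :: "real \<Rightarrow> real"
      by (rule continuous_on_compose2[OF that]) (auto intro!: continuous_intros)
    note c = this[OF coeff_continuous(1)[OF T]] this[OF coeff_continuous(2)[OF T]]
    have "continuous_on ({0..T} \<times> period_box) (\<lambda>x. mean_poly n (f (fst x)) (snd x))"
      unfolding trig_poly_def by (intro continuous_intros c)
    then show "continuous_on ({0..T} \<times> period_box) (\<lambda>(t, \<xi>). penalty \<delta> (mean_poly n (f t) \<xi>))"
      unfolding case_prod_beta
      by (rule continuous_on_compose2[OF continuous_on_penalty(1)[OF \<delta>, of UNIV]]) simp
  qed
  moreover have "energy n \<delta> t = integral period_box (\<lambda>\<xi>. penalty \<delta> (mean_poly n (f t) \<xi>))" if "t \<in> {0..T}" for t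
    unfolding energy_def using that by (subst fejer_mean_eq_trig_poly) (auto intro: f_integrable)
  ultimately show ?thesis
    using continuous_on_cong[OF refl, of "{0..T}" "energy n \<delta>"] by (simp only: mem_Collect_eq)
qed

text \<open>Integration by parts gives the sum over directions of - \<open>penalty''\<close> D (d D
  - Pe Q), where D is the derivative of the mean, Q the mean flux and d the diffusivity. Completing
  the square removes D and leaves \<open>penalty''\<close> Pe^2 Q^2 / (4 De) for each of the two
  x-directions. The factor \<open>penalty''\<close> is at most 2 and vanishes unless the mean is
  negative, where |Q| is at most 2 N with N the mean of the negative part. In total this is at most
  4 Pe^2 N^2 / De, and the L^2 norm of N is bounded by that of the negative part.\<close>

lemma energy_deriv:
  assumes t: "0 < t" and \<delta>: "0 < \<delta>" and n: "0 < n"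
  shows "\<exists>y. (energy n \<delta> has_real_derivative y) (at t) \<and> y \<le> 4 * Pe\<^sup>2 / De * defect t"
proof -
  let ?I = "freqs n" and ?m = freq
  define A B where "A s = cos_coeff n (f s)" and "B s = sin_coeff n (f s)" for s
  define C1 S1 C2 S2 where "C1 s = cos_coeff n (flux (f s) cos)" and "S1 s = sin_coeff n (flux (f s) cos)"
    and "C2 s = cos_coeff n (flux (f s) sin)" and "S2 s = sin_coeff n (flux (f s) sin)" for s
  define A' where "A' s p = - decay De (?m p) * A s p - Pe * (fst (fst (?m p)) * S1 s p + snd (fst (?m p)) * S2 s p)" for s p
  define B' where "B' s p = - decay De (?m p) * B s p + Pe * (fst (fst (?m p)) * C1 s p + snd (fst (?m p)) * C2 s p)" for s p
  define U where "U s = trig_poly ?I ?m (A s) (B s)" for s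
  define U' where "U' s = trig_poly ?I ?m (A' s) (B' s)" for s
  have Ad: "((\<lambda>s. A s p) has_real_derivative A' s p) (at s)" and Bd: "((\<lambda>s. B s p) has_real_derivative B' s p) (at s)"
    if "0 < s" "p \<in> ?I" for s p
    using coeff_deriv[OF that] by (simp_all only: A_def B_def A'_def B'_def C1_def S1_def C2_def S2_def)
  have T: "0 < t + 1" using t by simp
  note cc = coeff_continuous[OF T, where n = n, folded A_def B_def C1_def S1_def C2_def S2_def]
  have Ud: "((\<lambda>s. U s \<xi>) has_real_derivative U' s \<xi>) (at s)" if "0 < s" for s \<xi>
    unfolding U_def U'_def trig_poly_def
    by (intro DERIV_sum) (auto intro!: derivative_eq_intros Ad Bd that)
  have cont0: "continuous_on ({0<..<t + 1} \<times> period_box) (\<lambda>x. k (fst x))" if "continuous_on {0..t + 1} k" for k :: "real \<Rightarrow> real"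
    by (rule continuous_on_compose2[OF that]) (auto intro!: continuous_intros)
  note c0 = cc[THEN cont0]
  have cU: "continuous_on ({0<..<t + 1} \<times> period_box) (\<lambda>x. U (fst x) (snd x))"
    unfolding U_def trig_poly_def by (intro continuous_intros c0)
  have cU': "continuous_on ({0<..<t + 1} \<times> period_box) (\<lambda>x. U' (fst x) (snd x))"
    unfolding U'_def trig_poly_def A'_def B'_def by (intro continuous_intros c0)
  have pc: "continuous_on S (\<lambda>x. penalty \<delta> (k x))" "continuous_on S (\<lambda>x. penalty' \<delta> (k x))" "continuous_on S (\<lambda>x. penalty'' \<delta> (k x))"
    if "continuous_on S k" for S :: "'b::topological_space set" and k
    by (rule continuous_on_compose2[OF continuous_on_penalty(1)[OF \<delta>, of UNIV] that], simp,
        rule continuous_on_compose2[OF continuous_on_penalty(2)[OF \<delta>, of UNIV] that], simp,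
        rule continuous_on_compose2[OF continuous_on_penalty(3)[OF \<delta>, of UNIV] that], simp)
  have Uc: "continuous_on S (U s)" "continuous_on S (U' s)" for S s
    unfolding U_def U'_def using continuous_on_trig_poly[OF continuous_on_id] by (simp_all add: id_def)
  have "((\<lambda>s. integral period_box (\<lambda>\<xi>. penalty \<delta> (U s \<xi>))) has_field_derivative
      integral period_box (\<lambda>\<xi>. penalty' \<delta> (U t \<xi>) * U' t \<xi>)) (at t within {0<..<t + 1})"
  proof (rule leibniz_rule_field_derivative)
    fix s \<xi> assume s: "s \<in> {0<..<t + 1}"
    show "((\<lambda>s. penalty \<delta> (U s \<xi>)) has_field_derivative penalty' \<delta> (U s \<xi>) * U' s \<xi>) (at s within {0<..<t + 1})"
      by (rule has_field_derivative_at_within[OF DERIV_chain2[OF penalty_deriv(1)[OF \<delta>] Ud]]) (use s in simp)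
    show "(\<lambda>\<xi>. penalty \<delta> (U s \<xi>)) integrable_on period_box"
      by (intro integrable_continuous pc Uc)
  next
    show "continuous_on ({0<..<t + 1} \<times> period_box) (\<lambda>(s, \<xi>). penalty' \<delta> (U s \<xi>) * U' s \<xi>)"
      unfolding case_prod_beta by (intro continuous_on_mult pc cU cU')
  qed (use t in auto)
  then have "((\<lambda>s. integral period_box (\<lambda>\<xi>. penalty \<delta> (U s \<xi>))) has_real_derivative
      integral period_box (\<lambda>\<xi>. penalty' \<delta> (U t \<xi>) * U' t \<xi>)) (at t)"
    using t by (subst (asm) at_within_open) auto
  moreover have "\<forall>\<^sub>F s in nhds t. integral period_box (\<lambda>\<xi>. penalty \<delta> (U s \<xi>)) = energy n \<delta> s"
  proof (rule eventually_mono[OF eventually_nhds_in_open[of "{0<..}" t]])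
    fix s :: real assume "s \<in> {0<..}"
    then show "integral period_box (\<lambda>\<xi>. penalty \<delta> (U s \<xi>)) = energy n \<delta> s"
      unfolding energy_def U_def A_def B_def by (subst fejer_mean_eq_trig_poly) (auto intro: f_integrable)
  qed (use t in auto)
  ultimately have der: "(energy n \<delta> has_real_derivative integral period_box (\<lambda>\<xi>. penalty' \<delta> (U t \<xi>) * U' t \<xi>)) (at t)"
    by (subst (asm) DERIV_cong_ev[OF refl _ refl]) auto
  define D where "D i = trig_poly ?I ?m (\<lambda>p. (?m p \<bullet> i) * B t p) (\<lambda>p. - (?m p \<bullet> i) * A t p)" for i
  define Q1 Q2 where "Q1 = trig_poly ?I ?m (C1 t) (S1 t)" and "Q2 = trig_poly ?I ?m (C2 t) (S2 t)"
  \<comment> \<open>A common notation for the three directions: diffusivity \<open>De\<close> and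
    fluxes \<open>Q1\<close>, \<open>Q2\<close> in x, diffusivity 1 and no flux in \<theta>.\<close>
  define d :: "point \<Rightarrow> real" where "d i = (if i = ((0, 0), 1) then 1 else De)" for i
  define Q where "Q i = (if i = ((1, 0), 0) then Q1 else if i = ((0, 1), 0) then Q2 else (\<lambda>\<xi>. 0))" for i :: point
  define QA where "QA i p = (if i = ((1, 0), 0) then C1 t p else if i = ((0, 1), 0) then C2 t p else 0)" for i :: point and p
  define QB where "QB i p = (if i = ((1, 0), 0) then S1 t p else if i = ((0, 1), 0) then S2 t p else 0)" for i :: point and p
  have Qtp: "Q i = trig_poly ?I ?m (QA i) (QB i)" for i
    by (auto simp: Q_def Q1_def Q2_def QA_def QB_def trig_poly_def fun_eq_iff)
  \<comment> \<open>The derivative along \<open>i\<close> of \<open>d i * D i - Pe * Q i\<close>, so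
    that the equation for the mean is in divergence form.\<close>
  define DP where "DP i \<xi> = d i * trig_poly ?I ?m (\<lambda>p. - ((?m p \<bullet> i) * (?m p \<bullet> i)) * A t p) (\<lambda>p. - ((?m p \<bullet> i) * (?m p \<bullet> i)) * B t p) \<xi>
     - Pe * trig_poly ?I ?m (\<lambda>p. (?m p \<bullet> i) * QB i p) (\<lambda>p. - (?m p \<bullet> i) * QA i p) \<xi>" for i \<xi>
  have U'_eq: "U' t \<xi> = (\<Sum>i\<in>Basis. DP i \<xi>)" for \<xi>
    by (simp add: DP_def U'_def trig_poly_def Basis_prod_def A'_def B'_def d_def QA_def QB_def inner_prod_def zero_prod_def
        sum_distrib_left algebra_simps power2_eq_square flip: sum.distrib sum_subtractf)
  have tpc: "continuous_on S (trig_poly ?I ?m a b)" for S a b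
    using continuous_on_trig_poly[OF continuous_on_id] by (simp add: id_def)
  have Dc: "continuous_on S (D i)" "continuous_on S (Q i)" "continuous_on S (DP i)" for S i
    unfolding D_def Qtp DP_def by (intro continuous_intros tpc)+
  have lat: "?m p \<in> lattice" if "p \<in> ?I" for p using freq_lattice[OF that] .
  have parts: "(LINT \<xi>|cell. penalty' \<delta> (U t \<xi>) * DP i \<xi>)
      = - (LINT \<xi>|cell. penalty'' \<delta> (U t \<xi>) * D i \<xi> * (d i * D i \<xi> - Pe * Q i \<xi>))" if i: "i \<in> Basis" for i
  proof -
    let ?g = "\<lambda>\<xi>. penalty' \<delta> (U t \<xi>) * (d i * D i \<xi> - Pe * Q i \<xi>)"
    let ?dg = "\<lambda>\<xi>. penalty'' \<delta> (U t \<xi>) * D i \<xi> * (d i * D i \<xi> - Pe * Q i \<xi>) + penalty' \<delta> (U t \<xi>) * DP i \<xi>"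
    have "(LINT \<xi>|cell. ?dg \<xi>) = 0"
    proof (rule integral_cell_periodic_deriv[OF i, where g = ?g])
      fix \<xi>
      have u: "((\<lambda>s. U t (\<xi> + s *\<^sub>R i)) has_real_derivative D i \<xi>) (at 0)"
        unfolding U_def D_def by (rule trig_poly_deriv)
      have p: "((\<lambda>s. penalty' \<delta> (U t (\<xi> + s *\<^sub>R i))) has_real_derivative penalty'' \<delta> (U t \<xi>) * D i \<xi>) (at 0)"
        by (rule DERIV_chain2[where f = "penalty' \<delta>", OF _ u]) (simp add: penalty_deriv(2)[OF \<delta>])
      have q: "((\<lambda>s. d i * D i (\<xi> + s *\<^sub>R i) - Pe * Q i (\<xi> + s *\<^sub>R i)) has_real_derivative DP i \<xi>) (at 0)"
        unfolding D_def Qtp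
        by (rule DERIV_cong[OF DERIV_diff[OF DERIV_cmult[OF trig_poly_deriv] DERIV_cmult[OF trig_poly_deriv]]])
          (simp add: DP_def mult.assoc)
      show "((\<lambda>s. ?g (\<xi> + s *\<^sub>R i)) has_real_derivative ?dg \<xi>) (at 0)"
        by (rule DERIV_cong[OF DERIV_mult[OF p q]]) (simp add: algebra_simps)
      show "?g (\<xi> + (2 * pi) *\<^sub>R i) = ?g \<xi>"
        unfolding U_def D_def Qtp by (simp only: trig_poly_periodic[OF lat i])
    qed (intro continuous_intros pc Uc Dc)
    moreover have "integrable cell (\<lambda>\<xi>. penalty'' \<delta> (U t \<xi>) * D i \<xi> * (d i * D i \<xi> - Pe * Q i \<xi>))"
      "integrable cell (\<lambda>\<xi>. penalty' \<delta> (U t \<xi>) * DP i \<xi>)"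
      by (intro integrable_cell_continuous continuous_intros pc Uc Dc)+
    ultimately show ?thesis by simp
  qed
  define N where "N = fejer_mean n (\<lambda>\<eta>. max 0 (- f t \<eta>))"
  have fi: "integrable cell (f t)" "integrable cell (\<lambda>\<eta>. max 0 (- f t \<eta>))"
    using f_integrable[of t] t by auto
  have Nc: "continuous_on S N" for S unfolding N_def by (rule fejer_mean_continuous[OF fi(2)])
  have U_mean: "U t = fejer_mean n (f t)"
    unfolding U_def A_def B_def using fejer_mean_eq_trig_poly[OF fi(1)] by simp
  have Q_mean: "Q1 = fejer_mean n (flux (f t) cos)" "Q2 = fejer_mean n (flux (f t) sin)"
    unfolding Q1_def Q2_def C1_def C2_def S1_def S2_def
    using fejer_mean_eq_trig_poly[OF flux_integrable(1)] fejer_mean_eq_trig_poly[OF flux_integrable(2)] t by simp_all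
  have abs_mean: "fejer_mean n (\<lambda>\<eta>. \<bar>f t \<eta>\<bar>) \<xi> = U t \<xi> + 2 * N \<xi>" for \<xi>
  proof -
    \<comment> \<open>The decomposition |f| = f + 2 max(0, - f), written as a difference to fit
      \<open>fejer_mean_diff\<close>.\<close>
    have "(\<lambda>\<eta>. \<bar>f t \<eta>\<bar>) = (\<lambda>\<eta>. f t \<eta> - (- 2) * max 0 (- f t \<eta>))" by (auto simp: fun_eq_iff max_def)
    then have "fejer_mean n (\<lambda>\<eta>. \<bar>f t \<eta>\<bar>) \<xi> = fejer_mean n (\<lambda>\<eta>. f t \<eta> - (- 2) * max 0 (- f t \<eta>)) \<xi>" by simp
    also have "\<dots> = fejer_mean n (f t) \<xi> - fejer_mean n (\<lambda>\<eta>. (- 2) * max 0 (- f t \<eta>)) \<xi>"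
      using fi by (intro fejer_mean_diff) auto
    also have "fejer_mean n (\<lambda>\<eta>. (- 2) * max 0 (- f t \<eta>)) \<xi> = (- 2) * fejer_mean n (\<lambda>\<eta>. max 0 (- f t \<eta>)) \<xi>"
      unfolding fejer_mean_def by (subst integral_mult_right_zero[symmetric]) (simp add: mult.left_commute)
    finally show ?thesis by (simp add: U_mean N_def)
  qed
  have cs: "continuous_on UNIV (cos :: real \<Rightarrow> real)" "continuous_on UNIV (sin :: real \<Rightarrow> real)"
    by (intro continuous_on_cos continuous_on_sin continuous_on_id)+
  have Qle: "\<bar>Q1 \<xi>\<bar> \<le> U t \<xi> + 2 * N \<xi>" "\<bar>Q2 \<xi>\<bar> \<le> U t \<xi> + 2 * N \<xi>" for \<xi>
    using fejer_mean_flux_le[OF t cs(1) abs_cos_le_one, of n \<xi>] fejer_mean_flux_le[OF t cs(2) abs_sin_le_one, of n \<xi>]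
    by (simp_all add: Q_mean abs_mean)
  have square: "- (k * x * (e * x - Pe * q)) \<le> k * (Pe\<^sup>2 / (4 * e) * q\<^sup>2)" if "0 \<le> k" "0 < e" for k x e q :: real
  proof -
    have "0 \<le> k * (e * (x - Pe * q / (2 * e))\<^sup>2)" using that by simp
    also have "\<dots> = k * (Pe\<^sup>2 / (4 * e) * q\<^sup>2) + k * x * (e * x - Pe * q)"
      using that by (simp add: power2_eq_square field_simps)
    finally show ?thesis by linarith
  qed
  have pointwise: "(\<Sum>i\<in>Basis. - (penalty'' \<delta> (U t \<xi>) * D i \<xi> * (d i * D i \<xi> - Pe * Q i \<xi>))) \<le> 4 * Pe\<^sup>2 / De * (N \<xi>)\<^sup>2" for \<xi>
  proof -
    note pb = penalty''_bounds[OF \<delta>, of "U t \<xi>"]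
    have "(\<Sum>i\<in>Basis. - (penalty'' \<delta> (U t \<xi>) * D i \<xi> * (d i * D i \<xi> - Pe * Q i \<xi>)))
        \<le> (\<Sum>i\<in>Basis. penalty'' \<delta> (U t \<xi>) * (Pe\<^sup>2 / (4 * d i) * (Q i \<xi>)\<^sup>2))"
      using pb De by (intro sum_mono square) (auto simp: d_def)
    also have "\<dots> = penalty'' \<delta> (U t \<xi>) * (Pe\<^sup>2 / (4 * De) * ((Q1 \<xi>)\<^sup>2 + (Q2 \<xi>)\<^sup>2))"
      by (simp add: Basis_prod_def d_def Q_def zero_prod_def algebra_simps)
    also have "\<dots> \<le> 4 * Pe\<^sup>2 / De * (N \<xi>)\<^sup>2"
    proof (cases "U t \<xi> < 0")
      case True
      have "(Q1 \<xi>)\<^sup>2 \<le> (2 * N \<xi>)\<^sup>2" "(Q2 \<xi>)\<^sup>2 \<le> (2 * N \<xi>)\<^sup>2"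
        using Qle[of \<xi>] True by (intro abs_le_square_iff[THEN iffD1]; simp)+
      then have "penalty'' \<delta> (U t \<xi>) * (Pe\<^sup>2 / (4 * De) * ((Q1 \<xi>)\<^sup>2 + (Q2 \<xi>)\<^sup>2))
          \<le> 2 * (Pe\<^sup>2 / (4 * De) * ((2 * N \<xi>)\<^sup>2 + (2 * N \<xi>)\<^sup>2))"
        using pb De by (intro mult_mono add_mono) auto
      also have "\<dots> = 4 * Pe\<^sup>2 / De * (N \<xi>)\<^sup>2" by (simp add: power_mult_distrib)
      finally show ?thesis .
    next
      case False
      then show ?thesis using pb(3) De by simp
    qed
    finally show ?thesis .
  qed
  have "integral period_box (\<lambda>\<xi>. penalty' \<delta> (U t \<xi>) * U' t \<xi>) = (LINT \<xi>|cell. penalty' \<delta> (U t \<xi>) * U' t \<xi>)"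
    by (rule integral_cell_continuous[symmetric]) (intro continuous_intros pc Uc)
  also have "\<dots> = (LINT \<xi>|cell. (\<Sum>i\<in>Basis. penalty' \<delta> (U t \<xi>) * DP i \<xi>))"
    by (simp only: U'_eq sum_distrib_left)
  also have "\<dots> = (\<Sum>i\<in>Basis. LINT \<xi>|cell. penalty' \<delta> (U t \<xi>) * DP i \<xi>)"
    by (intro Bochner_Integration.integral_sum integrable_cell_continuous continuous_intros pc Uc Dc)
  also have "\<dots> = (\<Sum>i\<in>Basis. LINT \<xi>|cell. - (penalty'' \<delta> (U t \<xi>) * D i \<xi> * (d i * D i \<xi> - Pe * Q i \<xi>)))"
    by (intro sum.cong refl) (simp only: parts Bochner_Integration.integral_minus)
  also have "\<dots> = (LINT \<xi>|cell. (\<Sum>i\<in>Basis. - (penalty'' \<delta> (U t \<xi>) * D i \<xi> * (d i * D i \<xi> - Pe * Q i \<xi>))))"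
    by (intro Bochner_Integration.integral_sum[symmetric] integrable_cell_continuous continuous_intros pc Uc Dc)
  also have "\<dots> \<le> (LINT \<xi>|cell. 4 * Pe\<^sup>2 / De * (N \<xi>)\<^sup>2)"
    by (intro integral_mono pointwise integrable_cell_continuous continuous_intros pc Uc Dc Nc)
  also have "\<dots> = 4 * Pe\<^sup>2 / De * (LINT \<xi>|cell. (N \<xi>)\<^sup>2)" by simp
  also have "\<dots> \<le> 4 * Pe\<^sup>2 / De * defect t"
  proof (intro mult_left_mono)
    have "(\<lambda>\<xi>. max 0 (- f t \<xi>)) \<in> L2_per"
      using C_L2_D(1)[OF C_L2_negative_part[OF CL2[OF T]], of t] t by simp
    from fejer_mean_L2[OF n L2_perD(2,3)[OF this]]
    show "(LINT \<xi>|cell. (N \<xi>)\<^sup>2) \<le> defect t" by (simp add: N_def defect_def)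
  qed (use De in simp)
  finally show ?thesis using der by blast
qed


lemma initial_nonneg: "0 \<le> fejer_mean n (f 0) \<xi>"
proof -
  have "fejer_mean n (\<lambda>\<eta>. 0) \<xi> \<le> fejer_mean n (f 0) \<xi>"
  proof (rule fejer_mean_mono)
    show "AE \<eta> in cell. 0 \<le> f 0 \<eta>"
      using initial f0_bound by eventually_elim simp
  qed (auto intro: f_integrable)
  then show ?thesis by (simp add: fejer_mean_def)
qed

lemma initial_le:
  assumes "0 < n"
  shows "fejer_mean n (f 0) \<xi> \<le> enn2real (Linf_norm Upsilon f0)"
proof -
  have "fejer_mean n (f 0) \<xi> \<le> fejer_mean n (\<lambda>\<eta>. enn2real (Linf_norm Upsilon f0)) \<xi>"
  proof (rule fejer_mean_mono)
    show "AE \<eta> in cell. f 0 \<eta> \<le> enn2real (Linf_norm Upsilon f0)"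
      using initial f0_bound by eventually_elim simp
  qed (auto intro: f_integrable)
  then show ?thesis using assms by (simp add: fejer_mean_const)
qed

text \<open>The energy starts from zero because the means of a non-negative initial datum are
  non-negative; then its derivative is integrated.\<close>

lemma energy_le:
  assumes t: "0 < t" and \<delta>: "0 < \<delta>" and n: "0 < n"
  shows "energy n \<delta> t \<le> 4 * Pe\<^sup>2 / De * integral {0..t} defect"
proof -
  let ?K = "4 * Pe\<^sup>2 / De"
  let ?Z = "\<lambda>s. integral {0..s} defect"
  note dc = defect_continuous[OF t]
  have Zd: "(?Z has_real_derivative defect s) (at s within {0..t})" if "s \<in> {0..t}" for s
    by (rule integral_has_real_derivative[OF dc that])
  have "energy n \<delta> 0 - ?K * ?Z 0 \<ge> energy n \<delta> t - ?K * ?Z t"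
  proof (rule DERIV_nonpos_imp_decreasing_open[where f = "\<lambda>s. energy n \<delta> s - ?K * ?Z s"])
    show "0 \<le> t" using t by simp
    fix s assume s: "0 < s" "s < t"
    obtain y where y: "(energy n \<delta> has_real_derivative y) (at s)" "y \<le> ?K * defect s"
      using energy_deriv[OF s(1) \<delta> n] by blast
    have "(?Z has_real_derivative defect s) (at s)"
      using Zd[of s] s at_within_Icc_at[of 0 s t] by simp
    then have "((\<lambda>s. energy n \<delta> s - ?K * ?Z s) has_real_derivative y - ?K * defect s) (at s)"
      by (intro DERIV_diff y(1) DERIV_cmult)
    then show "\<exists>y. ((\<lambda>s. energy n \<delta> s - ?K * ?Z s) has_real_derivative y) (at s) \<and> y \<le> 0"
      using y(2) by (intro exI[of _ "y - ?K * defect s"]) simp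
  next
    have "continuous_on {0..t} ?Z"
      unfolding continuous_on_eq_continuous_within using DERIV_continuous[OF Zd] by blast
    then show "continuous_on {0..t} (\<lambda>s. energy n \<delta> s - ?K * ?Z s)"
      by (intro continuous_on_diff continuous_on_mult continuous_on_const energy_continuous[OF t \<delta>])
  qed
  moreover have "energy n \<delta> 0 = 0"
  proof -
    have "penalty \<delta> (fejer_mean n (f 0) \<xi>) = 0" for \<xi>
      using initial_nonneg[of n \<xi>] by (simp add: penalty_def)
    then show ?thesis by (simp add: energy_def)
  qed
  ultimately show ?thesis by simp
qed

lemma negative_mean_le:
  assumes t: "0 < t" and n: "0 < n"
  shows "(LINT \<xi>|cell. (max 0 (- fejer_mean n (f t) \<xi>))\<^sup>2) \<le> 4 * Pe\<^sup>2 / De * integral {0..t} defect"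
proof (rule field_le_epsilon)
  fix e :: real assume e: "0 < e"
  let ?u = "\<lambda>\<xi>. max 0 (- fejer_mean n (f t) \<xi>)"
  have fc: "continuous_on UNIV (fejer_mean n (f t))"
    using t by (intro fejer_mean_continuous f_integrable) simp
  have u: "continuous_on UNIV ?u"
    by (intro continuous_intros fc)
  note ui = integrable_cell_continuous[OF u]
  have u2: "integrable cell (\<lambda>\<xi>. (?u \<xi>)\<^sup>2)"
    by (intro integrable_cell_continuous continuous_on_power u)
  define L where "L = (LINT \<xi>|cell. ?u \<xi>)"
  have L: "0 \<le> L" unfolding L_def by (rule integral_nonneg_AE) simp
  \<comment> \<open>The loss \<delta> L in \<open>penalty_lower\<close> is then at most
    \<open>e\<close>; the summand 1 allows for \<open>L = 0\<close>.\<close>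
  define \<delta> where "\<delta> = e / (L + 1)"
  have \<delta>: "0 < \<delta>" "\<delta> * L \<le> e"
  proof -
    show "0 < \<delta>" using e L by (simp add: \<delta>_def)
    then have "\<delta> * L \<le> \<delta> * (L + 1)" by (intro mult_left_mono) auto
    also have "\<dots> = e" using L by (simp add: \<delta>_def)
    finally show "\<delta> * L \<le> e" .
  qed
  have pc: "continuous_on UNIV (\<lambda>\<xi>. penalty \<delta> (fejer_mean n (f t) \<xi>))"
    by (rule continuous_on_compose2[OF continuous_on_penalty(1)[OF \<delta>(1), of UNIV] fc]) simp
  have "(LINT \<xi>|cell. (?u \<xi>)\<^sup>2) - \<delta> * L = (LINT \<xi>|cell. (?u \<xi>)\<^sup>2 - \<delta> * ?u \<xi>)"
    unfolding L_def using u2 ui by simp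
  also have "\<dots> \<le> (LINT \<xi>|cell. penalty \<delta> (fejer_mean n (f t) \<xi>))"
    using u2 ui by (intro integral_mono integrable_cell_continuous[OF pc] penalty_lower[OF \<delta>(1)]) auto
  also have "\<dots> = energy n \<delta> t"
    unfolding energy_def by (rule integral_cell_continuous[OF pc])
  also have "\<dots> \<le> 4 * Pe\<^sup>2 / De * integral {0..t} defect"
    by (rule energy_le[OF t \<delta>(1) n])
  finally show "(LINT \<xi>|cell. (?u \<xi>)\<^sup>2) \<le> 4 * Pe\<^sup>2 / De * integral {0..t} defect + e"
    using \<delta>(2) by linarith
qed

text \<open>The means converge in L^1 only, while the quantity is quadratic. Truncated at level R,
  the squared negative part is 2R-Lipschitz, so the limit in n is taken at fixed R and R goes to
  infinity afterwards by dominated convergence.\<close>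

lemma defect_le:
  assumes t: "0 < t"
  shows "defect t \<le> 4 * Pe\<^sup>2 / De * integral {0..t} defect"
proof -
  let ?X = "4 * Pe\<^sup>2 / De * integral {0..t} defect"
  note fi = f_integrable[OF less_imp_le[OF t]] and fL = f_L2[OF less_imp_le[OF t]]
  have [measurable]: "f t \<in> borel_measurable cell" using fi by auto
  have trunc: "(LINT \<xi>|cell. (min (real R) (max 0 (- f t \<xi>)))\<^sup>2) \<le> ?X" for R :: nat
  proof -
    have i1: "integrable cell (\<lambda>\<xi>. (min (real R) (max 0 (- f t \<xi>)))\<^sup>2)"
      by (rule cell.integrable_const_bound[where B = "(real R)\<^sup>2"]) (auto intro!: AE_I2 power_mono)
    have bnd: "(LINT \<xi>|cell. (min (real R) (max 0 (- f t \<xi>)))\<^sup>2)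
        \<le> ?X + 2 * real R * (LINT \<xi>|cell. \<bar>fejer_mean n (f t) \<xi> - f t \<xi>\<bar>)" if n: "0 < n" for n
    proof -
      let ?u = "fejer_mean n (f t)"
      have ui: "integrable cell ?u" by (rule integrable_fejer_mean[OF fi])
      have u2: "integrable cell (\<lambda>\<xi>. (max 0 (- ?u \<xi>))\<^sup>2)"
        by (intro integrable_cell_continuous continuous_intros fejer_mean_continuous[OF fi])
      have pw: "(min r (max 0 (- a)))\<^sup>2 \<le> (max 0 (- b))\<^sup>2 + 2 * r * \<bar>b - a\<bar>" if "0 \<le> r" for r a b :: real
      proof -
        let ?x = "min r (max 0 (- a))" and ?y = "min r (max 0 (- b))"
        have x: "0 \<le> ?x" "?x \<le> r" "0 \<le> ?y" "?y \<le> r" using that by auto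
        have d: "\<bar>?x - ?y\<bar> \<le> \<bar>b - a\<bar>" by linarith
        have "?x\<^sup>2 - ?y\<^sup>2 = (?x + ?y) * (?x - ?y)" by (simp add: power2_eq_square algebra_simps)
        also have "\<dots> \<le> (?x + ?y) * \<bar>b - a\<bar>"
          using x by (intro mult_left_mono order_trans[OF abs_ge_self d] add_nonneg_nonneg)
        also have "\<dots> \<le> (2 * r) * \<bar>b - a\<bar>"
        proof (rule mult_right_mono)
          show "?x + ?y \<le> 2 * r" using add_mono[OF x(2) x(4)] by (simp only: mult_2)
        qed simp
        finally have "?x\<^sup>2 \<le> ?y\<^sup>2 + 2 * r * \<bar>b - a\<bar>" by simp
        moreover have "?y\<^sup>2 \<le> (max 0 (- b))\<^sup>2" using x by (intro power_mono) auto
        ultimately show ?thesis by linarith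
      qed
      have "(LINT \<xi>|cell. (min (real R) (max 0 (- f t \<xi>)))\<^sup>2)
          \<le> (LINT \<xi>|cell. (max 0 (- ?u \<xi>))\<^sup>2 + 2 * real R * \<bar>?u \<xi> - f t \<xi>\<bar>)"
        using ui fi u2 by (intro integral_mono i1 pw Bochner_Integration.integrable_add integrable_mult_right integrable_abs Bochner_Integration.integrable_diff) auto
      also have "\<dots> = (LINT \<xi>|cell. (max 0 (- ?u \<xi>))\<^sup>2) + 2 * real R * (LINT \<xi>|cell. \<bar>?u \<xi> - f t \<xi>\<bar>)"
        using ui fi u2 by simp
      finally show ?thesis using negative_mean_le[OF t n] by linarith
    qed
    have "(\<lambda>n. ?X + 2 * real R * (LINT \<xi>|cell. \<bar>fejer_mean n (f t) \<xi> - f t \<xi>\<bar>)) \<longlonglongrightarrow> ?X + 2 * real R * 0"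
      by (intro tendsto_add tendsto_mult tendsto_const fejer_mean_L1_limit[OF fi])
    then have "(LINT \<xi>|cell. (min (real R) (max 0 (- f t \<xi>)))\<^sup>2) \<le> ?X + 2 * real R * 0"
    proof (rule LIMSEQ_le_const)
      show "\<exists>N. \<forall>n\<ge>N. (LINT \<xi>|cell. (min (real R) (max 0 (- f t \<xi>)))\<^sup>2)
          \<le> ?X + 2 * real R * (LINT \<xi>|cell. \<bar>fejer_mean n (f t) \<xi> - f t \<xi>\<bar>)"
        by (intro exI[of _ 1] allI impI bnd) simp
    qed
    then show ?thesis by simp
  qed
  have "(\<lambda>R. LINT \<xi>|cell. (min (real R) (max 0 (- f t \<xi>)))\<^sup>2) \<longlonglongrightarrow> defect t"
    unfolding defect_def
  proof (rule integral_dominated_convergence[where w = "\<lambda>\<xi>. (f t \<xi>)\<^sup>2"])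
    have "\<forall>\<^sub>F R in sequentially. (min (real R) (max 0 (- f t \<xi>)))\<^sup>2 = (max 0 (- f t \<xi>))\<^sup>2" for \<xi>
      using eventually_ge_at_top[of "nat \<lceil>max 0 (- f t \<xi>)\<rceil>"]
    proof eventually_elim
      case (elim R)
      then have "max 0 (- f t \<xi>) \<le> real R" by linarith
      then show ?case by (simp add: min_absorb2)
    qed
    then show "AE \<xi> in cell. (\<lambda>R. (min (real R) (max 0 (- f t \<xi>)))\<^sup>2) \<longlonglongrightarrow> (max 0 (- f t \<xi>))\<^sup>2"
      by (intro AE_I2 tendsto_eventually)
    show "AE \<xi> in cell. norm ((min (real R) (max 0 (- f t \<xi>)))\<^sup>2) \<le> (f t \<xi>)\<^sup>2" for R
    proof (rule AE_I2)
      fix \<xi>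
      have "\<bar>min (real R) (max 0 (- f t \<xi>))\<bar> \<le> \<bar>f t \<xi>\<bar>" by linarith
      from abs_le_square_iff[THEN iffD1, OF this]
      show "norm ((min (real R) (max 0 (- f t \<xi>)))\<^sup>2) \<le> (f t \<xi>)\<^sup>2"
        by simp
    qed
  qed (use L2_perD(3)[OF fL] in auto)
  then show ?thesis by (rule LIMSEQ_le_const2) (use trunc in auto)
qed

text \<open>Gronwall's argument: the time integral of the defect, damped by exp(- K t), is
  non-increasing and starts from zero.\<close>

lemma defect_zero:
  assumes t: "0 < t"
  shows "defect t = 0"
proof -
  let ?K = "4 * Pe\<^sup>2 / De"
  let ?Z = "\<lambda>s. integral {0..s} defect"
  note dc = defect_continuous[OF t]
  have Zd: "(?Z has_real_derivative defect s) (at s within {0..t})" if "s \<in> {0..t}" for s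
    by (rule integral_has_real_derivative[OF dc that])
  have "exp (- ?K * 0) * ?Z 0 \<ge> exp (- ?K * t) * ?Z t"
  proof (rule DERIV_nonpos_imp_decreasing_open[where f = "\<lambda>s. exp (- ?K * s) * ?Z s"])
    show "0 \<le> t" using t by simp
    fix s assume s: "0 < s" "s < t"
    have Z: "(?Z has_real_derivative defect s) (at s)"
      using Zd[of s] s at_within_Icc_at[of 0 s t] by simp
    have "((\<lambda>s. exp (- ?K * s)) has_real_derivative - ?K * exp (- ?K * s)) (at s)"
      using De by (auto intro!: derivative_eq_intros)
    from DERIV_mult[OF this Z]
    have "((\<lambda>s. exp (- ?K * s) * ?Z s) has_real_derivative exp (- ?K * s) * (defect s - ?K * ?Z s)) (at s)"
      by (rule DERIV_cong) (simp add: algebra_simps)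
    moreover have "exp (- ?K * s) * (defect s - ?K * ?Z s) \<le> 0"
      using defect_le[OF s(1)] by (intro mult_nonneg_nonpos) auto
    ultimately show "\<exists>y. ((\<lambda>s. exp (- ?K * s) * ?Z s) has_real_derivative y) (at s) \<and> y \<le> 0"
      by blast
  next
    have "continuous_on {0..t} ?Z"
      unfolding continuous_on_eq_continuous_within using DERIV_continuous[OF Zd] by blast
    then show "continuous_on {0..t} (\<lambda>s. exp (- ?K * s) * ?Z s)"
      by (intro continuous_on_mult continuous_on_exp continuous_on_mult_left continuous_on_id)
  qed
  then have "?Z t \<le> 0" by (simp add: mult_le_0_iff)
  then have "?K * ?Z t \<le> 0" using De by (intro mult_nonneg_nonpos) auto
  then have "defect t \<le> 0" using defect_le[OF t] by linarith
  moreover have "0 \<le> defect t" unfolding defect_def by (rule integral_nonneg_AE) simp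
  ultimately show ?thesis by simp
qed

lemma f_nonneg:
  assumes t: "0 < t"
  shows "AE \<xi> in cell. 0 \<le> f t \<xi>"
proof -
  have "(\<lambda>\<xi>. max 0 (- f t \<xi>)) \<in> L2_per"
    using C_L2_D(1)[OF C_L2_negative_part[OF CL2[of t]], of t] t by simp
  note i = L2_perD(3)[OF this]
  have "AE \<xi> in cell. (max 0 (- f t \<xi>))\<^sup>2 = 0"
    using defect_zero[OF t] i unfolding defect_def by (subst (asm) integral_nonneg_eq_0_iff_AE) auto
  then show ?thesis by eventually_elim (simp add: max_def split: if_splits)
qed

lemma mean_nonneg: "0 < t \<Longrightarrow> 0 \<le> fejer_mean n (f t) \<xi>"
  unfolding fejer_mean_def
  by (rule integral_nonneg_AE, rule eventually_mono[OF f_nonneg]) (auto intro: mult_nonneg_nonneg fejer_nonneg)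

text \<open>Once the sign of \<open>f\<close> is known, the mean of |f| is the mean of
  \<open>f\<close>. This is the form of the flux bound on which the sup estimate rests.\<close>

lemma fejer_mean_flux_le_mean:
  assumes t: "0 < t" and a: "continuous_on UNIV a" "\<And>\<theta>. \<bar>a \<theta>\<bar> \<le> 1"
  shows "\<bar>fejer_mean n (flux (f t) a) \<xi>\<bar> \<le> fejer_mean n (f t) \<xi>"
proof -
  have "fejer_mean n (\<lambda>\<eta>. \<bar>f t \<eta>\<bar>) \<xi> \<le> fejer_mean n (f t) \<xi>"
  proof (rule fejer_mean_mono)
    show "AE \<eta> in cell. \<bar>f t \<eta>\<bar> \<le> f t \<eta>" using f_nonneg[OF t] by eventually_elim simp
  qed (use t in \<open>auto intro!: integrable_abs f_integrable\<close>)
  then show ?thesis using fejer_mean_flux_le[OF t a, of n \<xi>] by linarith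
qed

end

section \<open>Angular mass of the means\<close>

lemma integral_angle_continuous:
  fixes g :: "real \<Rightarrow> real"
  assumes "continuous_on UNIV g"
  shows "integrable angle g" "(LINT \<theta>|angle. g \<theta>) = integral {0..2 * pi} g"
proof -
  have "angle = time (2 * pi)" by (simp add: angle_def time_def)
  then show "(LINT \<theta>|angle. g \<theta>) = integral {0..2 * pi} g"
    using integral_time_continuous(1)[of "2 * pi" g, OF continuous_on_subset[OF assms]] by (simp only: subset_UNIV)
  have "compact (g ` {0..2 * pi})"
    by (intro compact_continuous_image continuous_on_subset[OF assms]) auto
  then obtain B where B: "\<And>\<theta>. \<theta> \<in> {0..2 * pi} \<Longrightarrow> norm (g \<theta>) \<le> B"
    using compact_imp_bounded by (force simp: bounded_iff)
  show "integrable angle g"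
  proof (rule angle.integrable_const_bound[where B = B])
    show "AE \<theta> in angle. norm (g \<theta>) \<le> B" using B by (intro AE_I2) simp
    show "g \<in> borel_measurable angle"
      unfolding angle_def by (rule measurable_restrict_space1) (simp add: borel_measurable_continuous_onI assms)
  qed
qed

lemma integral_cos_period:
  assumes k: "k \<in> \<int>"
  shows "integral {0..2 * pi} (\<lambda>\<theta>. cos (a + k * \<theta>)) = (if k = 0 then 2 * pi * cos a else 0)"
proof (cases "k = 0")
  case False
  have "integral (cbox 0 (2 * pi)) (\<lambda>\<theta>. cos (a + k * \<theta>)) = 0"
  proof (rule integral_period_deriv[where h = "\<lambda>\<theta>. sin (a + k * \<theta>) / k"])
    show "((\<lambda>\<theta>. sin (a + k * \<theta>) / k) has_real_derivative cos (a + k * s)) (at s)" for s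
      using False by (auto intro!: derivative_eq_intros)
    show "sin (a + k * (2 * pi)) / k = sin (a + k * 0) / k"
      using cos_int_shift[OF k, of "a - pi / 2"] by (simp add: cos_diff algebra_simps)
  qed
  with False show ?thesis by (simp add: cbox_interval)
qed simp

text \<open>What remains of the kernel after integration over the angle: the frequencies without
  angular part. Its non-negativity is inherited from \<open>fejer\<close> and not read off the
  sum.\<close>

definition fejer_x :: "nat \<Rightarrow> real \<times> real \<Rightarrow> real" where
  "fejer_x n z = (\<Sum>p\<in>freqs n. if snd (freq p) = 0 then 2 * pi * cos (fst (freq p) \<bullet> z) else 0) / ((2 * pi) ^ 3 * real n ^ 3)"

lemma integral_fejer_angle:
  "integral {0..2 * pi} (\<lambda>\<theta>. fejer n ((x, \<theta>) - \<eta>)) = fejer_x n (x - fst \<eta>)"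
proof -
  have "integral {0..2 * pi} (\<lambda>\<theta>. cos (freq p \<bullet> ((x, \<theta>) - \<eta>)))
      = (if snd (freq p) = 0 then 2 * pi * cos (fst (freq p) \<bullet> (x - fst \<eta>)) else 0)" if "p \<in> freqs n" for p
  proof -
    have "((0, 0), 1) \<in> (Basis :: point set)" by (auto simp: Basis_prod_def zero_prod_def)
    then have "freq p \<bullet> ((0, 0), 1) \<in> \<int>"
      using freq_lattice[OF that] unfolding lattice_def by blast
    then have k: "snd (freq p) \<in> \<int>" by (simp add: inner_prod_def)
    have eq: "freq p \<bullet> ((x, \<theta>) - \<eta>) = (fst (freq p) \<bullet> (x - fst \<eta>) - snd (freq p) * snd \<eta>) + snd (freq p) * \<theta>" for \<theta>
      by (simp add: inner_prod_def algebra_simps)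
    show ?thesis unfolding eq integral_cos_period[OF k] by simp
  qed
  then have "(\<Sum>p\<in>freqs n. integral {0..2 * pi} (\<lambda>\<theta>. cos (freq p \<bullet> ((x, \<theta>) - \<eta>))))
      = (\<Sum>p\<in>freqs n. if snd (freq p) = 0 then 2 * pi * cos (fst (freq p) \<bullet> (x - fst \<eta>)) else 0)"
    by (rule sum.cong[OF refl])
  moreover have "integral {0..2 * pi} (\<lambda>\<theta>. \<Sum>p\<in>freqs n. cos (freq p \<bullet> ((x, \<theta>) - \<eta>)))
      = (\<Sum>p\<in>freqs n. integral {0..2 * pi} (\<lambda>\<theta>. cos (freq p \<bullet> ((x, \<theta>) - \<eta>))))"
    by (intro integral_sum integrable_continuous_real continuous_intros) simp
  ultimately show ?thesis
    unfolding fejer_def fejer_x_def integral_divide by (simp only:)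
qed

lemma fejer_x_nonneg: "0 \<le> fejer_x n z"
proof -
  have "0 \<le> integral {0..2 * pi} (\<lambda>\<theta>. fejer n ((z, \<theta>) - 0))"
  proof (rule integral_nonneg)
    show "(\<lambda>\<theta>. fejer n ((z, \<theta>) - 0)) integrable_on {0..2 * pi}"
      by (rule integrable_continuous_real) (intro continuous_intros)
  qed (rule fejer_nonneg)
  then show ?thesis unfolding integral_fejer_angle by simp
qed

lemma fejer_x_continuous: "continuous_on UNIV (\<lambda>\<eta> :: point. fejer_x n (x - fst \<eta>))"
  unfolding fejer_x_def divide_inverse
proof (intro continuous_on_mult_right continuous_on_sum)
  fix p
  have "continuous_on UNIV (\<lambda>\<eta> :: point. 2 * pi * cos (fst (freq p) \<bullet> (x - fst \<eta>)))"
    by (intro continuous_intros)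
  then show "continuous_on UNIV (\<lambda>\<eta> :: point. if snd (freq p) = 0 then 2 * pi * cos (fst (freq p) \<bullet> (x - fst \<eta>)) else 0)"
    by (cases "snd (freq p) = 0") (simp_all only: if_True if_False simp_thms continuous_on_const)
qed

interpretation angle_cell: pair_sigma_finite angle cell
  by standard

text \<open>By Fubini the angle is integrated inside the kernel. The result averages
  \<open>w\<close> with a weight in x alone, hence depends on \<open>w\<close> only through its
  angular integral, and bounds on the density pass to the means.\<close>

lemma integral_fejer_mean_angle:
  assumes w: "integrable cell w" and n: "0 < n"
  shows "integral {0..2 * pi} (\<lambda>\<theta>. fejer_mean n w (x, \<theta>)) = (LINT \<eta>|cell. fejer_x n (x - fst \<eta>) * w \<eta>)"
proof -
  have c: "continuous_on UNIV (\<lambda>\<theta>. fejer n ((x, \<theta>) - \<eta>))" for \<eta> by (intro continuous_intros)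
  have fm: "(\<lambda>p. fejer n ((x, fst p) - snd p)) \<in> borel_measurable (angle \<Otimes>\<^sub>M cell)"
  proof -
    have m1: "(\<lambda>p. fejer n ((x, fst p) - snd p)) \<in> borel_measurable (borel \<Otimes>\<^sub>M borel)"
      unfolding borel_prod by (intro borel_measurable_continuous_onI continuous_intros)
    have m2: "(\<lambda>p. (fst p, snd p)) \<in> measurable (angle \<Otimes>\<^sub>M cell) (borel \<Otimes>\<^sub>M borel)"
    proof (rule measurable_Pair)
      have "(\<lambda>\<theta>. \<theta>) \<in> borel_measurable angle" "(\<lambda>\<eta>. \<eta>) \<in> borel_measurable cell"
        unfolding angle_def cell_def by (rule measurable_restrict_space1; simp)+
      note i = this
      show "fst \<in> borel_measurable (angle \<Otimes>\<^sub>M cell)" by (rule measurable_compose[OF measurable_fst i(1)])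
      show "snd \<in> borel_measurable (angle \<Otimes>\<^sub>M cell)" by (rule measurable_compose[OF measurable_snd i(2)])
    qed
    from measurable_compose[OF m2 m1] show ?thesis by simp
  qed
  have wm: "(\<lambda>p. w (snd p)) \<in> borel_measurable (angle \<Otimes>\<^sub>M cell)"
    using w by (intro measurable_compose[OF measurable_snd]) auto
  let ?g = "\<lambda>(\<theta>, \<eta>). fejer n ((x, \<theta>) - \<eta>) * w \<eta>"
  have gi: "integrable (angle \<Otimes>\<^sub>M cell) ?g"
  proof (rule angle_cell.Fubini_integrable)
    show "?g \<in> borel_measurable (angle \<Otimes>\<^sub>M cell)"
      unfolding case_prod_beta by (intro borel_measurable_times fm wm)
    show "AE \<theta> in angle. integrable cell (\<lambda>\<eta>. ?g (\<theta>, \<eta>))"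
      using integrable_fejer_mult[OF w] by simp
    have "(\<lambda>\<theta>. LINT \<eta>|cell. norm (?g (\<theta>, \<eta>))) = (\<lambda>\<theta>. fejer_mean n (\<lambda>\<eta>. \<bar>w \<eta>\<bar>) (x, \<theta>))"
      by (simp add: fejer_mean_def abs_mult fejer_nonneg)
    moreover have "integrable angle (\<lambda>\<theta>. fejer_mean n (\<lambda>\<eta>. \<bar>w \<eta>\<bar>) (x, \<theta>))"
    proof (rule integral_angle_continuous(1))
      show "continuous_on UNIV (\<lambda>\<theta>. fejer_mean n (\<lambda>\<eta>. \<bar>w \<eta>\<bar>) (x, \<theta>))"
        using w by (intro continuous_on_compose2[OF fejer_mean_continuous[of _ UNIV]] continuous_intros) auto
    qed
    ultimately show "integrable angle (\<lambda>\<theta>. LINT \<eta>|cell. norm (?g (\<theta>, \<eta>)))" by simp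
  qed
  have "integral {0..2 * pi} (\<lambda>\<theta>. fejer_mean n w (x, \<theta>)) = (LINT \<theta>|angle. fejer_mean n w (x, \<theta>))"
    by (rule integral_angle_continuous(2)[symmetric])
      (use w in \<open>intro continuous_on_compose2[OF fejer_mean_continuous[of _ UNIV]] continuous_intros, auto\<close>)
  also have "\<dots> = (LINT \<eta>|cell. LINT \<theta>|angle. fejer n ((x, \<theta>) - \<eta>) * w \<eta>)"
    unfolding fejer_mean_def using angle_cell.Fubini_integral[OF gi] by simp
  also have "\<dots> = (LINT \<eta>|cell. fejer_x n (x - fst \<eta>) * w \<eta>)"
    by (simp add: integral_angle_continuous(2)[OF c] integral_fejer_angle)
  finally show ?thesis .
qed

section \<open>The heat semigroup\<close>

lemma trig_poly_line:
  "trig_poly I m A B (\<xi> + (\<sigma> * z) *\<^sub>R i)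
    = (\<Sum>p\<in>I. A p * cos (m p \<bullet> \<xi> + (\<sigma> * (m p \<bullet> i)) * z) + B p * sin (m p \<bullet> \<xi> + (\<sigma> * (m p \<bullet> i)) * z))"
  unfolding trig_poly_def inner_add_right inner_scaleR_right by (simp add: ac_simps)

text \<open>Averaging along an axis against a Gaussian is a Fourier multiplier; three such averages
  compose to the heat semigroup.\<close>

lemma trig_poly_gauss:
  "(LINT z|std_normal_distribution. trig_poly I m A B (\<xi> + (\<sigma> * z) *\<^sub>R i))
    = trig_poly I m (\<lambda>p. exp (- (\<sigma> * (m p \<bullet> i))\<^sup>2 / 2) * A p) (\<lambda>p. exp (- (\<sigma> * (m p \<bullet> i))\<^sup>2 / 2) * B p) \<xi>"
proof -
  have i: "integrable std_normal_distribution (\<lambda>z. cos (a + k * z))" "integrable std_normal_distribution (\<lambda>z. sin (a + k * z))" for a k :: real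
    by (rule integrable_std_normal_bounded[where B = 1];
        auto intro!: borel_measurable_continuous_onI continuous_intros)+
  have "(LINT z|std_normal_distribution. trig_poly I m A B (\<xi> + (\<sigma> * z) *\<^sub>R i))
      = (\<Sum>p\<in>I. LINT z|std_normal_distribution. A p * cos (m p \<bullet> \<xi> + (\<sigma> * (m p \<bullet> i)) * z) + B p * sin (m p \<bullet> \<xi> + (\<sigma> * (m p \<bullet> i)) * z))"
    unfolding trig_poly_line
    by (intro Bochner_Integration.integral_sum Bochner_Integration.integrable_add integrable_mult_right i)
  also have "\<dots> = (\<Sum>p\<in>I. A p * (exp (- (\<sigma> * (m p \<bullet> i))\<^sup>2 / 2) * cos (m p \<bullet> \<xi>)) + B p * (exp (- (\<sigma> * (m p \<bullet> i))\<^sup>2 / 2) * sin (m p \<bullet> \<xi>)))"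
    by (subst Bochner_Integration.integral_add[OF integrable_mult_right[OF i(1)] integrable_mult_right[OF i(2)]])
      (simp only: integral_mult_right_zero std_normal_cos std_normal_sin)
  finally show ?thesis
    unfolding trig_poly_def by (simp add: ac_simps)
qed

text \<open>By Stein's identity the weight z amounts to differentiation along \<open>i\<close>, up
  to the factor \<open>\<sigma>\<close>. A bound on the weighted average is therefore a gradient
  bound at the cost 1/\<sigma>.\<close>

lemma trig_poly_gauss_gradient:
  "(LINT z|std_normal_distribution. z * trig_poly I m A B (\<xi> + (\<sigma> * z) *\<^sub>R i))
    = \<sigma> * trig_poly I m (\<lambda>p. (m p \<bullet> i) * (exp (- (\<sigma> * (m p \<bullet> i))\<^sup>2 / 2) * B p))
        (\<lambda>p. - (m p \<bullet> i) * (exp (- (\<sigma> * (m p \<bullet> i))\<^sup>2 / 2) * A p)) \<xi>"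
proof -
  note i = std_normal_times_cos(1) std_normal_times_sin(1)
  have gen: "a * (- (\<sigma> * k) * e * x) + b * ((\<sigma> * k) * e * y) = \<sigma> * ((k * (e * b)) * y + (- k * (e * a)) * x)"
    for a b k e x y :: real by (simp add: algebra_simps)
  have "z * trig_poly I m A B (\<xi> + (\<sigma> * z) *\<^sub>R i)
      = (\<Sum>p\<in>I. A p * (z * cos (m p \<bullet> \<xi> + (\<sigma> * (m p \<bullet> i)) * z)) + B p * (z * sin (m p \<bullet> \<xi> + (\<sigma> * (m p \<bullet> i)) * z)))" for z
    unfolding trig_poly_line sum_distrib_left by (intro sum.cong refl) (simp add: algebra_simps)
  then have "(LINT z|std_normal_distribution. z * trig_poly I m A B (\<xi> + (\<sigma> * z) *\<^sub>R i))
      = (LINT z|std_normal_distribution. (\<Sum>p\<in>I. A p * (z * cos (m p \<bullet> \<xi> + (\<sigma> * (m p \<bullet> i)) * z)) + B p * (z * sin (m p \<bullet> \<xi> + (\<sigma> * (m p \<bullet> i)) * z))))"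
    by simp
  also have "\<dots> = (\<Sum>p\<in>I. LINT z|std_normal_distribution. A p * (z * cos (m p \<bullet> \<xi> + (\<sigma> * (m p \<bullet> i)) * z)) + B p * (z * sin (m p \<bullet> \<xi> + (\<sigma> * (m p \<bullet> i)) * z)))"
    by (intro Bochner_Integration.integral_sum Bochner_Integration.integrable_add integrable_mult_right i)
  also have "\<dots> = (\<Sum>p\<in>I. A p * (- (\<sigma> * (m p \<bullet> i)) * exp (- (\<sigma> * (m p \<bullet> i))\<^sup>2 / 2) * sin (m p \<bullet> \<xi>))
      + B p * ((\<sigma> * (m p \<bullet> i)) * exp (- (\<sigma> * (m p \<bullet> i))\<^sup>2 / 2) * cos (m p \<bullet> \<xi>)))"
    by (subst Bochner_Integration.integral_add[OF integrable_mult_right[OF i(1)] integrable_mult_right[OF i(2)]])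
      (simp only: integral_mult_right_zero std_normal_times_cos(2) std_normal_times_sin(2))
  finally show ?thesis
    unfolding trig_poly_def sum_distrib_left by (simp only: gen)
qed

abbreviation "axis1 \<equiv> ((1, 0), 0) :: point"
abbreviation "axis2 \<equiv> ((0, 1), 0) :: point"
abbreviation "axis3 \<equiv> ((0, 0), 1) :: point"

text \<open>The heat kernel at time \<tau> is a Gaussian of variance 2 De \<tau> in each of the two
  x-directions and 2 \<tau> in the angle.\<close>

lemma heat_multiplier:
  assumes "0 < De" "0 \<le> \<tau>"
  shows "exp (- (sqrt (2 * De * \<tau>) * (m \<bullet> axis1))\<^sup>2 / 2) * (exp (- (sqrt (2 * De * \<tau>) * (m \<bullet> axis2))\<^sup>2 / 2)
      * (exp (- (sqrt (2 * \<tau>) * (m \<bullet> axis3))\<^sup>2 / 2) * a)) = exp (- \<tau> * decay De m) * a"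
proof -
  have "- (sqrt (2 * De * \<tau>) * (m \<bullet> axis1))\<^sup>2 / 2 + (- (sqrt (2 * De * \<tau>) * (m \<bullet> axis2))\<^sup>2 / 2 + - (sqrt (2 * \<tau>) * (m \<bullet> axis3))\<^sup>2 / 2)
      = - \<tau> * decay De m"
  proof -
    have a: "m \<bullet> axis1 = fst (fst m)" "m \<bullet> axis2 = snd (fst m)" "m \<bullet> axis3 = snd m"
      by (simp_all add: inner_prod_def)
    have "(sqrt (2 * De * \<tau>))\<^sup>2 = 2 * De * \<tau>" "(sqrt (2 * \<tau>))\<^sup>2 = 2 * \<tau>"
      using assms by simp_all
    then show ?thesis
      unfolding a power_mult_distrib by (simp add: inner_prod_def power2_eq_square algebra_simps)
  qed
  then show ?thesis
    unfolding mult.assoc[symmetric] exp_add[symmetric] by (simp only: add.assoc)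
qed

lemma trig_poly_line_measurable: "(\<lambda>z. trig_poly I m A B (\<xi> + (\<sigma> * z) *\<^sub>R i)) \<in> borel_measurable borel"
  by (intro borel_measurable_continuous_onI continuous_intros)

text \<open>The hypothesis concerns the average over the angle alone, since that is where the
  angular mass enters. The averages in x do not increase a sup norm, and the one that carries the
  weight z becomes the derivative, at the cost 1 / sqrt(2 De \<tau>). It is taken last, so the other
  x-average comes first: \<open>Q2\<close> for \<open>axis1\<close>, \<open>Q1\<close> for
  \<open>axis2\<close>.\<close>

lemma heat_bounds:
  fixes A B :: "'i \<Rightarrow> real"
  assumes De: "0 < De" and \<tau>: "0 < \<tau>"
    and K: "\<And>\<zeta>. \<bar>LINT z|std_normal_distribution. trig_poly I m A B (\<zeta> + (sqrt (2 * \<tau>) * z) *\<^sub>R axis3)\<bar> \<le> K"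
  shows "\<bar>trig_poly I m (\<lambda>p. exp (- \<tau> * decay De (m p)) * A p) (\<lambda>p. exp (- \<tau> * decay De (m p)) * B p) \<xi>\<bar> \<le> K"
    and "i = axis1 \<or> i = axis2 \<Longrightarrow>
      \<bar>trig_poly I m (\<lambda>p. (m p \<bullet> i) * (exp (- \<tau> * decay De (m p)) * B p)) (\<lambda>p. - (m p \<bullet> i) * (exp (- \<tau> * decay De (m p)) * A p)) \<xi>\<bar>
        \<le> K / sqrt (2 * De * \<tau>)"
proof -
  let ?s = "sqrt (2 * De * \<tau>)" and ?r = "sqrt (2 * \<tau>)"
  define e1 e2 e3 where "e1 p = exp (- (?s * (m p \<bullet> axis1))\<^sup>2 / 2)" and "e2 p = exp (- (?s * (m p \<bullet> axis2))\<^sup>2 / 2)"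
    and "e3 p = exp (- (?r * (m p \<bullet> axis3))\<^sup>2 / 2)" for p
  have mult: "e1 p * (e2 p * (e3 p * a)) = exp (- \<tau> * decay De (m p)) * a" "e2 p * (e1 p * (e3 p * a)) = exp (- \<tau> * decay De (m p)) * a" for p a
    using heat_multiplier[OF De less_imp_le[OF \<tau>], of "m p" a] unfolding e1_def e2_def e3_def by (simp_all only: mult.left_commute)
  let ?Q3 = "trig_poly I m (\<lambda>p. e3 p * A p) (\<lambda>p. e3 p * B p)"
  have Q3: "\<bar>?Q3 \<zeta>\<bar> \<le> K" for \<zeta>
    using K[of \<zeta>] unfolding trig_poly_gauss e3_def .
  have Q2: "\<bar>trig_poly I m (\<lambda>p. e2 p * (e3 p * A p)) (\<lambda>p. e2 p * (e3 p * B p)) \<zeta>\<bar> \<le> K" for \<zeta>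
    using std_normal_abs_integral_le(1)[OF trig_poly_line_measurable Q3, of \<zeta> ?s axis2] unfolding trig_poly_gauss e2_def .
  have Q1: "\<bar>trig_poly I m (\<lambda>p. e1 p * (e3 p * A p)) (\<lambda>p. e1 p * (e3 p * B p)) \<zeta>\<bar> \<le> K" for \<zeta>
    using std_normal_abs_integral_le(1)[OF trig_poly_line_measurable Q3, of \<zeta> ?s axis1] unfolding trig_poly_gauss e1_def .
  have "\<bar>trig_poly I m (\<lambda>p. e1 p * (e2 p * (e3 p * A p))) (\<lambda>p. e1 p * (e2 p * (e3 p * B p))) \<xi>\<bar> \<le> K"
    using std_normal_abs_integral_le(1)[OF trig_poly_line_measurable Q2, of \<xi> ?s axis1] unfolding trig_poly_gauss e1_def .
  then show "\<bar>trig_poly I m (\<lambda>p. exp (- \<tau> * decay De (m p)) * A p) (\<lambda>p. exp (- \<tau> * decay De (m p)) * B p) \<xi>\<bar> \<le> K"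
    unfolding mult .
  have s: "0 < ?s" using De \<tau> by simp
  assume "i = axis1 \<or> i = axis2"
  then have "\<bar>?s * trig_poly I m (\<lambda>p. (m p \<bullet> i) * (exp (- \<tau> * decay De (m p)) * B p)) (\<lambda>p. - (m p \<bullet> i) * (exp (- \<tau> * decay De (m p)) * A p)) \<xi>\<bar> \<le> K"
  proof
    assume i: "i = axis1"
    show ?thesis
      using std_normal_abs_integral_le(2)[OF trig_poly_line_measurable Q2, of \<xi> ?s axis1]
      unfolding trig_poly_gauss_gradient e1_def[symmetric] mult i .
  next
    assume i: "i = axis2"
    show ?thesis
      using std_normal_abs_integral_le(2)[OF trig_poly_line_measurable Q1, of \<xi> ?s axis2]
      unfolding trig_poly_gauss_gradient e2_def[symmetric] mult i .
  qed
  then show "\<bar>trig_poly I m (\<lambda>p. (m p \<bullet> i) * (exp (- \<tau> * decay De (m p)) * B p)) (\<lambda>p. - (m p \<bullet> i) * (exp (- \<tau> * decay De (m p)) * A p)) \<xi>\<bar> \<le> K / ?s"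
    using s by (simp add: abs_mult pos_le_divide_eq mult.commute)
qed

context global_solution
begin

text \<open>The left-hand side pairs the density with a non-negative kernel in x. The constant 1/(2
  pi) has density 1 and the same pairing gives it the value 1, so the comparison follows from a
  density of at most 1 at almost every time, and by continuity at every time.\<close>

lemma mean_angle_le_one:
  assumes t: "0 < t" and n: "0 < n"
  shows "integral {0..2 * pi} (\<lambda>\<theta>. fejer_mean n (f t) (x, \<theta>)) \<le> 1"
proof -
  let ?k = "\<lambda>\<eta> :: point. fejer_x n (x - fst \<eta>)"
  have T: "0 < t + 1" using t by simp
  have kc: "continuous_on UNIV ?k" by (rule fejer_x_continuous)
  note km = measurable_cell_continuous[OF kc]
  define C where "C = integral {0..2 * pi} (\<lambda>\<theta>. real n ^ 3 / (2 * pi) ^ 3)"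
  have kC: "\<bar>?k \<eta>\<bar> \<le> C" for \<eta>
  proof -
    have "?k \<eta> \<le> C"
      unfolding C_def integral_fejer_angle[symmetric, of n x \<eta>]
    proof (rule integral_le)
      show "(\<lambda>\<theta>. fejer n ((x, \<theta>) - \<eta>)) integrable_on {0..2 * pi}"
        by (intro integrable_continuous_real continuous_intros)
      show "(\<lambda>\<theta>. real n ^ 3 / (2 * pi) ^ 3) integrable_on {0..2 * pi}"
        by (rule integrable_const_ivl)
      show "fejer n ((x, \<theta>) - \<eta>) \<le> real n ^ 3 / (2 * pi) ^ 3" for \<theta>
        by (rule fejer_le)
    qed
    then show ?thesis using fejer_x_nonneg[of n "x - fst \<eta>"] by simp
  qed
  have one: "(LINT \<eta>|cell. ?k \<eta> * (1 / (2 * pi))) = 1"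
  proof -
    have "integral {0..2 * pi} (\<lambda>\<theta>. fejer_mean n (\<lambda>\<eta>. 1 / (2 * pi)) (x, \<theta>)) = 1"
      using n by (simp add: fejer_mean_const)
    from trans[OF integral_fejer_mean_angle[OF cell.integrable_const n, symmetric] this] show ?thesis .
  qed
  have cont: "continuous_on {0..t + 1} (\<lambda>s. LINT \<eta>|cell. f s \<eta> * ?k \<eta>)"
    by (rule L1_continuous_kernel[OF _ C_L2_L1_limit[OF CL2[OF T]] km kC]) (auto intro: f_integrable)
  have "0 \<le> 1 - (LINT \<eta>|cell. f t \<eta> * ?k \<eta>)"
  proof (rule AE_time_continuous_nonneg[where T = "t + 1" and t = t and g = "\<lambda>s. 1 - (LINT \<eta>|cell. f s \<eta> * ?k \<eta>)"])
    show "continuous_on {0<..<t + 1} (\<lambda>s. 1 - (LINT \<eta>|cell. f s \<eta> * ?k \<eta>))"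
      by (intro continuous_on_diff continuous_on_const continuous_on_subset[OF cont]) auto
    show "AE s in lborel. s \<in> {0<..<t + 1} \<longrightarrow> 0 \<le> 1 - (LINT \<eta>|cell. f s \<eta> * ?k \<eta>)"
      using vacancy_AE
    proof eventually_elim
      case (elim s)
      show ?case
      proof
        assume s: "s \<in> {0<..<t + 1}"
        then have ae: "AE \<eta> in cell. 0 \<le> angular_int (f s) (fst \<eta>) \<and> angular_int (f s) (fst \<eta>) \<le> 1"
          using elim by simp
        have fi: "integrable cell (f s)" using s by (auto intro: f_integrable)
        \<comment> \<open>Its angular integral is the vacancy, which is non-negative almost
          everywhere.\<close>
        let ?w = "\<lambda>\<eta>. 1 / (2 * pi) - f s \<eta>"
        have wi: "integrable cell ?w" using fi by simp
        have kw: "integrable cell (\<lambda>\<eta>. ?k \<eta> * ?w \<eta>)"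
          by (rule integrable_mult_bounded[OF wi km kC])
        have kf: "integrable cell (\<lambda>\<eta>. ?k \<eta> * f s \<eta>)"
          by (rule integrable_mult_bounded[OF fi km kC])
        have aw: "AE \<eta> in cell. angular_int ?w (fst \<eta>) = 1 - angular_int (f s) (fst \<eta>)"
          using angular_int_diff[of "\<lambda>\<eta>. 1 / (2 * pi)" "f s"] fi by (simp add: angular_int_eq)
        have ak: "angular_int (\<lambda>\<eta>. ?k \<eta> * ?w \<eta>) y = fejer_x n (x - y) * angular_int ?w y" for y
          by (simp add: angular_int_eq)
        have "(LINT \<eta>|cell. ?k \<eta> * ?w \<eta>) = (LINT y|restrict_space lborel Omega. fejer_x n (x - y) * angular_int ?w y)"
          unfolding integral_cell_iterated(3)[OF kw] ak ..
        moreover have "integrable (restrict_space lborel Omega) (\<lambda>y. fejer_x n (x - y) * angular_int ?w y)"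
          using integral_cell_iterated(2)[OF kw] unfolding ak[abs_def] .
        note integral_fst_cell(2)[OF this]
        ultimately have "2 * pi * (LINT \<eta>|cell. ?k \<eta> * ?w \<eta>) = (LINT \<eta>|cell. ?k \<eta> * angular_int ?w (fst \<eta>))"
          by simp
        also have "0 \<le> \<dots>"
        proof (rule integral_nonneg_AE)
          show "AE \<eta> in cell. 0 \<le> ?k \<eta> * angular_int ?w (fst \<eta>)"
            using aw ae by eventually_elim (simp add: fejer_x_nonneg)
        qed
        finally have "0 \<le> (LINT \<eta>|cell. ?k \<eta> * ?w \<eta>)"
          using pi_gt_zero by (simp add: zero_le_mult_iff not_le)
        also have "(LINT \<eta>|cell. ?k \<eta> * ?w \<eta>) = (LINT \<eta>|cell. ?k \<eta> * (1 / (2 * pi)) - ?k \<eta> * f s \<eta>)"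
          by (simp only: right_diff_distrib)
        also have "\<dots> = 1 - (LINT \<eta>|cell. ?k \<eta> * f s \<eta>)"
          using integrable_cell_continuous[OF kc] kf one
          by (subst Bochner_Integration.integral_diff) (simp_all only: integrable_mult_left)
        finally show "0 \<le> 1 - (LINT \<eta>|cell. f s \<eta> * ?k \<eta>)" by (simp add: mult.commute)
      qed
    qed
  qed (use t in auto)
  moreover have "integral {0..2 * pi} (\<lambda>\<theta>. fejer_mean n (f t) (x, \<theta>)) = (LINT \<eta>|cell. f t \<eta> * ?k \<eta>)"
    using integral_fejer_mean_angle[OF f_integrable n, of t x] t by (simp add: mult.commute)
  ultimately show ?thesis by simp
qed

text \<open>A crude bound by the maximum of the kernel times the mass. It grows with
  \<open>n\<close>, but is uniform in time and makes the supremum in \<open>mean_le\<close>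
  finite.\<close>

lemma mean_bounded:
  assumes t: "0 < t" and n: "0 < n"
  shows "fejer_mean n (f t) \<xi> \<le> real n ^ 3 / (2 * pi) ^ 3 * (2 * pi)\<^sup>2"
proof -
  note fi = f_integrable[OF less_imp_le[OF t]]
  \<comment> \<open>The kernel of order one is constant, so the angular bound for
    \<open>n = 1\<close> is a bound on the total mass.\<close>
  have "grid 1 = {grid_pt 0 0 0}" unfolding grid_def by (simp add: lessThan_Suc)
  then have "fejer 1 \<zeta> = 1 / (2 * pi) ^ 3" for \<zeta> unfolding fejer_def by simp
  then have "fejer_mean 1 (f t) \<zeta> = (LINT \<eta>|cell. f t \<eta>) / (2 * pi) ^ 3" for \<zeta>
    unfolding fejer_mean_def by simp
  then have "2 * pi * ((LINT \<eta>|cell. f t \<eta>) / (2 * pi) ^ 3) \<le> 1"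
    using mean_angle_le_one[OF t, of 1 0] by simp
  then have mass: "(LINT \<eta>|cell. f t \<eta>) \<le> (2 * pi)\<^sup>2"
    by (simp add: divide_le_eq power2_eq_square power3_eq_cube)
  have "fejer_mean n (f t) \<xi> \<le> (LINT \<eta>|cell. real n ^ 3 / (2 * pi) ^ 3 * f t \<eta>)"
    unfolding fejer_mean_def
    by (rule integral_mono_AE[OF integrable_fejer_mult[OF fi] integrable_mult_right[OF fi]],
        rule eventually_mono[OF f_nonneg[OF t]]) (rule mult_right_mono[OF fejer_le])
  also have "\<dots> = real n ^ 3 / (2 * pi) ^ 3 * (LINT \<eta>|cell. f t \<eta>)" by simp
  also have "\<dots> \<le> real n ^ 3 / (2 * pi) ^ 3 * (2 * pi)\<^sup>2"
    by (intro mult_left_mono mass) simp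
  finally show ?thesis .
qed

text \<open>The second bound comes from the angular mass, which is at most one.\<close>

lemma gauss_angle_bound:
  assumes s: "0 < s" and n: "0 < n" and r: "0 < r"
    and M: "\<And>\<zeta>. fejer_mean n (f s) \<zeta> \<le> M"
    and w: "integrable cell w" and dom: "\<And>\<zeta>. \<bar>fejer_mean n w \<zeta>\<bar> \<le> fejer_mean n (f s) \<zeta>"
  shows "\<bar>LINT z|std_normal_distribution. fejer_mean n w (\<zeta> + (r * z) *\<^sub>R axis3)\<bar> \<le> M"
    and "\<bar>LINT z|std_normal_distribution. fejer_mean n w (\<zeta> + (r * z) *\<^sub>R axis3)\<bar> \<le> 1 / r + 1"
proof -
  note fi = f_integrable[OF less_imp_le[OF s]]
  have lm: "(\<lambda>z. fejer_mean n v (\<zeta> + (r * z) *\<^sub>R axis3)) \<in> borel_measurable borel" if "integrable cell v" for v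
    unfolding fejer_mean_eq_trig_poly[OF that] by (rule trig_poly_line_measurable)
  have dM: "\<bar>fejer_mean n w \<zeta>\<bar> \<le> M" for \<zeta> using dom[of \<zeta>] M[of \<zeta>] by linarith
  show "\<bar>LINT z|std_normal_distribution. fejer_mean n w (\<zeta> + (r * z) *\<^sub>R axis3)\<bar> \<le> M"
    by (rule std_normal_abs_integral_le(1)[OF lm[OF w] dM])
  have "\<bar>LINT z|std_normal_distribution. fejer_mean n w (\<zeta> + (r * z) *\<^sub>R axis3)\<bar>
      \<le> (LINT z|std_normal_distribution. \<bar>fejer_mean n w (\<zeta> + (r * z) *\<^sub>R axis3)\<bar>)"
    by (rule integral_abs_bound)
  also have "\<dots> \<le> (LINT z|std_normal_distribution. fejer_mean n (f s) (\<zeta> + (r * z) *\<^sub>R axis3))"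
  proof (rule integral_mono)
    show "integrable std_normal_distribution (\<lambda>z. \<bar>fejer_mean n w (\<zeta> + (r * z) *\<^sub>R axis3)\<bar>)"
      by (intro integrable_abs integrable_std_normal_bounded[OF lm[OF w] dM])
    show "integrable std_normal_distribution (\<lambda>z. fejer_mean n (f s) (\<zeta> + (r * z) *\<^sub>R axis3))"
      using mean_nonneg[OF s] M by (intro integrable_std_normal_bounded[OF lm[OF fi], of M]) (simp add: abs_of_nonneg)
  qed (rule dom)
  also have "\<dots> = (LINT z|std_normal_distribution. fejer_mean n (f s) (fst \<zeta>, snd \<zeta> + r * z))"
    by (intro Bochner_Integration.integral_cong refl arg_cong[where f = "fejer_mean n (f s)"]) (simp add: prod_eq_iff)
  also have "\<dots> \<le> (1 / r + 1) * integral {0..2 * pi} (\<lambda>\<theta>. fejer_mean n (f s) (fst \<zeta>, \<theta>))"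
  proof (rule std_normal_periodic_le[where g = "\<lambda>\<theta>. fejer_mean n (f s) (fst \<zeta>, \<theta>)" and B = M])
    show "continuous_on UNIV (\<lambda>\<theta>. fejer_mean n (f s) (fst \<zeta>, \<theta>))"
      by (intro continuous_on_compose2[OF fejer_mean_continuous[OF fi, of UNIV]] continuous_intros) auto
    show "fejer_mean n (f s) (fst \<zeta>, y + 2 * pi) = fejer_mean n (f s) (fst \<zeta>, y)" for y
    proof -
      have "axis3 \<in> Basis" unfolding Basis_prod_def zero_prod_def by simp
      have "fejer_mean n (f s) ((fst \<zeta>, y) + (2 * pi) *\<^sub>R axis3) = fejer_mean n (f s) (fst \<zeta>, y)"
        unfolding fejer_mean_eq_trig_poly[OF fi] by (rule trig_poly_periodic[OF freq_lattice \<open>axis3 \<in> Basis\<close>])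
      also have "(fst \<zeta>, y) + (2 * pi) *\<^sub>R axis3 = (fst \<zeta>, y + 2 * pi)"
        by (simp add: prod_eq_iff)
      finally show ?thesis .
    qed
    show "0 \<le> fejer_mean n (f s) (fst \<zeta>, y)" "fejer_mean n (f s) (fst \<zeta>, y) \<le> M" for y
      by (rule mean_nonneg[OF s], rule M)
    show "0 < r" by (rule r)
  qed
  also have "\<dots> \<le> (1 / r + 1) * 1"
    using r by (intro mult_left_mono mean_angle_le_one s n) simp
  finally show "\<bar>LINT z|std_normal_distribution. fejer_mean n w (\<zeta> + (r * z) *\<^sub>R axis3)\<bar> \<le> 1 / r + 1"
    by simp
qed

text \<open>The interpolation in Duhamel's formula: the mean at time \<open>s\<close>, evolved by
  the heat semigroup up to time \<open>t\<close>. The exponential is an integrating factor, so in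
  the derivative with respect to \<open>s\<close> the diffusion cancels and only the flux
  remains.\<close>

definition heat_mean :: "nat \<Rightarrow> real \<Rightarrow> point \<Rightarrow> real \<Rightarrow> real" where
  "heat_mean n t \<xi> s = trig_poly (freqs n) freq (\<lambda>p. exp (- (t - s) * decay De (freq p)) * cos_coeff n (f s) p)
     (\<lambda>p. exp (- (t - s) * decay De (freq p)) * sin_coeff n (f s) p) \<xi>"

lemma heat_mean_end: "0 \<le> t \<Longrightarrow> heat_mean n t \<xi> t = fejer_mean n (f t) \<xi>"
  by (simp add: heat_mean_def fejer_mean_eq_trig_poly f_integrable)

lemma heat_mean_continuous: "0 < t \<Longrightarrow> continuous_on {0..t} (heat_mean n t \<xi>)"
  unfolding heat_mean_def[abs_def] trig_poly_def by (intro continuous_intros coeff_continuous)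

lemma heat_mean_deriv:
  assumes s: "0 < s" "s < t"
  shows "(heat_mean n t \<xi> has_real_derivative
    - Pe * (trig_poly (freqs n) freq (\<lambda>p. (freq p \<bullet> axis1) * (exp (- (t - s) * decay De (freq p)) * sin_coeff n (flux (f s) cos) p))
        (\<lambda>p. - (freq p \<bullet> axis1) * (exp (- (t - s) * decay De (freq p)) * cos_coeff n (flux (f s) cos) p)) \<xi>
      + trig_poly (freqs n) freq (\<lambda>p. (freq p \<bullet> axis2) * (exp (- (t - s) * decay De (freq p)) * sin_coeff n (flux (f s) sin) p))
        (\<lambda>p. - (freq p \<bullet> axis2) * (exp (- (t - s) * decay De (freq p)) * cos_coeff n (flux (f s) sin) p)) \<xi>)) (at s)"
proof -
  have ax: "m \<bullet> axis1 = fst (fst m)" "m \<bullet> axis2 = snd (fst m)" for m by (simp_all add: inner_prod_def)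
  let ?e = "\<lambda>p s. exp (- (t - s) * decay De (freq p))"
  have e: "((\<lambda>s. ?e p s) has_real_derivative ?e p s * decay De (freq p)) (at s)" for p
    by (auto intro!: derivative_eq_intros)
  have c: "((\<lambda>s. ?e p s * cos_coeff n (f s) p) has_real_derivative
      - Pe * ?e p s * (fst (fst (freq p)) * sin_coeff n (flux (f s) cos) p + snd (fst (freq p)) * sin_coeff n (flux (f s) sin) p)) (at s)"
    if "p \<in> freqs n" for p
    by (rule DERIV_cong[OF DERIV_mult[OF e coeff_deriv(1)[OF s(1) that]]]) (simp add: algebra_simps)
  have d: "((\<lambda>s. ?e p s * sin_coeff n (f s) p) has_real_derivative
      Pe * ?e p s * (fst (fst (freq p)) * cos_coeff n (flux (f s) cos) p + snd (fst (freq p)) * cos_coeff n (flux (f s) sin) p)) (at s)"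
    if "p \<in> freqs n" for p
    by (rule DERIV_cong[OF DERIV_mult[OF e coeff_deriv(2)[OF s(1) that]]]) (simp add: algebra_simps)
  have "(heat_mean n t \<xi> has_real_derivative (\<Sum>p\<in>freqs n.
      (- Pe * ?e p s * (fst (fst (freq p)) * sin_coeff n (flux (f s) cos) p + snd (fst (freq p)) * sin_coeff n (flux (f s) sin) p)) * cos (freq p \<bullet> \<xi>)
      + (Pe * ?e p s * (fst (fst (freq p)) * cos_coeff n (flux (f s) cos) p + snd (fst (freq p)) * cos_coeff n (flux (f s) sin) p)) * sin (freq p \<bullet> \<xi>))) (at s)"
    unfolding heat_mean_def[abs_def] trig_poly_def
    by (intro DERIV_sum DERIV_add DERIV_cmult_right c d)
  moreover have "(- Pe * e * (x * S + y * S')) * c + (Pe * e * (x * C + y * C')) * s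
      = - Pe * ((x * (e * S) * c + - x * (e * C) * s) + (y * (e * S') * c + - y * (e * C') * s))"
    for e x y S S' C C' c s :: real by (simp add: algebra_simps)
  ultimately show ?thesis
    unfolding trig_poly_def sum.distrib[symmetric] sum_distrib_left ax by (simp only:)
qed

end

section \<open>Duhamel estimate and the uniform bound\<close>

context global_solution
begin

text \<open>For \<tau> at most 1 the summand 1 of the angular bound is absorbed into 1 / sqrt
  \<tau>, which is why the time intervals have length at most one. The square root comes from
  multiplying the two bounds for the same quantity.\<close>

lemma gauss_angle_bound_sqrt:
  assumes s: "0 < s" and n: "0 < n" and \<tau>: "0 < \<tau>" "\<tau> \<le> 1" and M0: "0 \<le> M"
    and M: "\<And>\<zeta>. fejer_mean n (f s) \<zeta> \<le> M"
    and w: "integrable cell w" and dom: "\<And>\<zeta>. \<bar>fejer_mean n w \<zeta>\<bar> \<le> fejer_mean n (f s) \<zeta>"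
  shows "\<bar>LINT z|std_normal_distribution. trig_poly (freqs n) freq (cos_coeff n w) (sin_coeff n w) (\<zeta> + (sqrt (2 * \<tau>) * z) *\<^sub>R axis3)\<bar>
    \<le> sqrt (M * (2 / sqrt \<tau>))"
proof -
  let ?x = "\<bar>LINT z|std_normal_distribution. fejer_mean n w (\<zeta> + (sqrt (2 * \<tau>) * z) *\<^sub>R axis3)\<bar>"
  have r: "0 < sqrt (2 * \<tau>)" using \<tau> by simp
  note g = gauss_angle_bound[OF s n r M w dom, of \<zeta>]
  have "1 / sqrt (2 * \<tau>) \<le> 1 / sqrt \<tau>"
    using \<tau> by (intro divide_left_mono) auto
  moreover have "1 \<le> 1 / sqrt \<tau>"
    using \<tau> by (simp add: le_divide_eq)
  ultimately have "?x \<le> 2 / sqrt \<tau>"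
    using g(2) by simp
  then have "?x * ?x \<le> M * (2 / sqrt \<tau>)"
    using g(1) M0 by (intro mult_mono) auto
  then have "?x \<le> sqrt (M * (2 / sqrt \<tau>))"
    by (intro real_le_rsqrt) (simp only: power2_eq_square)
  then show ?thesis
    unfolding fejer_mean_eq_trig_poly[OF w] .
qed

lemma heat_mean_deriv_le:
  assumes s: "0 < s" "s < t" "t - s \<le> 1" and n: "0 < n" and M0: "0 \<le> M"
    and M: "\<And>\<zeta>. fejer_mean n (f s) \<zeta> \<le> M"
  obtains y where "(heat_mean n t \<xi> has_real_derivative y) (at s)"
    "y \<le> 2 * \<bar>Pe\<bar> / sqrt De * sqrt M / (sqrt (t - s) * sqrt (sqrt (t - s)))"
proof -
  define \<tau> where "\<tau> = t - s"
  have \<tau>: "0 < \<tau>" "\<tau> \<le> 1" using s by (simp_all add: \<tau>_def)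
  note fl = flux_integrable[OF less_imp_le[OF s(1)]]
  have d: "\<bar>fejer_mean n (flux (f s) cos) \<zeta>\<bar> \<le> fejer_mean n (f s) \<zeta>" "\<bar>fejer_mean n (flux (f s) sin) \<zeta>\<bar> \<le> fejer_mean n (f s) \<zeta>" for \<zeta>
    by (intro fejer_mean_flux_le_mean[OF s(1)] continuous_on_cos continuous_on_sin continuous_on_id abs_cos_le_one abs_sin_le_one)+
  let ?K = "sqrt (M * (2 / sqrt \<tau>))"
  define X where "X = trig_poly (freqs n) freq (\<lambda>p. (freq p \<bullet> axis1) * (exp (- \<tau> * decay De (freq p)) * sin_coeff n (flux (f s) cos) p))
        (\<lambda>p. - (freq p \<bullet> axis1) * (exp (- \<tau> * decay De (freq p)) * cos_coeff n (flux (f s) cos) p)) \<xi>"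
  define Y where "Y = trig_poly (freqs n) freq (\<lambda>p. (freq p \<bullet> axis2) * (exp (- \<tau> * decay De (freq p)) * sin_coeff n (flux (f s) sin) p))
        (\<lambda>p. - (freq p \<bullet> axis2) * (exp (- \<tau> * decay De (freq p)) * cos_coeff n (flux (f s) sin) p)) \<xi>"
  have X: "\<bar>X\<bar> \<le> ?K / sqrt (2 * De * \<tau>)" unfolding X_def
    by (rule heat_bounds(2)[OF De \<tau>(1) gauss_angle_bound_sqrt[OF s(1) n \<tau> M0 M fl(1) d(1)]]) simp
  have Y: "\<bar>Y\<bar> \<le> ?K / sqrt (2 * De * \<tau>)" unfolding Y_def
    by (rule heat_bounds(2)[OF De \<tau>(1) gauss_angle_bound_sqrt[OF s(1) n \<tau> M0 M fl(2) d(2)]]) simp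
  have "- Pe * (X + Y) \<le> \<bar>Pe\<bar> * \<bar>X + Y\<bar>"
    unfolding abs_mult[symmetric] by (rule order_trans[OF abs_ge_self]) (simp add: abs_mult)
  also have "\<dots> \<le> \<bar>Pe\<bar> * (2 * (?K / sqrt (2 * De * \<tau>)))"
    using X Y by (intro mult_left_mono) auto
  \<comment> \<open>The two factors sqrt 2 cancel; the remaining 2 counts the two directions of the
    flux.\<close>
  also have "\<dots> = 2 * \<bar>Pe\<bar> / sqrt De * sqrt M / (sqrt \<tau> * sqrt (sqrt \<tau>))"
    by (simp add: real_sqrt_mult real_sqrt_divide ac_simps)
  finally show ?thesis
    using that[OF heat_mean_deriv[OF s(1,2), of n \<xi>]] unfolding X_def Y_def \<tau>_def by blast
qed

text \<open>The singular bound k (t - s)^(-3/4) is minus the derivative of 4 k (t - s)^(1/4), which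
  is continuous up to s = t. Adding the latter to \<open>heat_mean\<close> gives a non-increasing
  function, and no improper integral occurs. On an interval of length at most one the fourth root is
  at most 1, and 4 k yields the constant 8.\<close>

lemma Duhamel_le:
  assumes t: "0 \<le> t0" "t0 < t" "t \<le> t0 + 1" and n: "0 < n" and M0: "0 \<le> M"
    and M: "\<And>s \<zeta>. 0 < s \<Longrightarrow> fejer_mean n (f s) \<zeta> \<le> M"
  shows "fejer_mean n (f t) \<xi> \<le> heat_mean n t \<xi> t0 + 8 * \<bar>Pe\<bar> / sqrt De * sqrt M"
proof -
  let ?k = "2 * \<bar>Pe\<bar> / sqrt De * sqrt M"
  let ?q = "\<lambda>s. sqrt (sqrt (t - s))"
  have k: "0 \<le> ?k" using M0 De by simp
  have "heat_mean n t \<xi> t + 4 * ?k * ?q t \<le> heat_mean n t \<xi> t0 + 4 * ?k * ?q t0"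
  proof (rule DERIV_nonpos_imp_decreasing_open[where f = "\<lambda>s. heat_mean n t \<xi> s + 4 * ?k * ?q s"])
    show "t0 \<le> t" using t by simp
    show "continuous_on {t0..t} (\<lambda>s. heat_mean n t \<xi> s + 4 * ?k * ?q s)"
      using t by (intro continuous_intros continuous_on_subset[OF heat_mean_continuous[of t]]) auto
    fix s assume s: "t0 < s" "s < t"
    then have s': "0 < s" "t - s \<le> 1" "0 < t - s" using t by simp_all
    obtain y where y: "(heat_mean n t \<xi> has_real_derivative y) (at s)" "y \<le> ?k / (sqrt (t - s) * ?q s)"
      using heat_mean_deriv_le[OF s'(1) s(2) s'(2) n M0 M[OF s'(1)]] by blast
    have "(?q has_real_derivative (- 1) * (inverse (sqrt (t - s)) / 2) * (inverse (?q s) / 2)) (at s)"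
      using s'(3) by (auto intro!: derivative_eq_intros)
    from DERIV_add[OF y(1) DERIV_cmult[OF this, of "4 * ?k"]]
    have "((\<lambda>s. heat_mean n t \<xi> s + 4 * ?k * ?q s) has_real_derivative y - ?k / (sqrt (t - s) * ?q s)) (at s)"
      by (rule DERIV_cong) (simp add: divide_simps)
    then show "\<exists>y. ((\<lambda>s. heat_mean n t \<xi> s + 4 * ?k * ?q s) has_real_derivative y) (at s) \<and> y \<le> 0"
      using y(2) by (intro exI conjI) auto
  qed
  moreover have "4 * ?k * ?q t0 \<le> 4 * ?k * 1"
    using t k by (intro mult_left_mono) (auto simp: real_sqrt_le_1_iff)
  ultimately show ?thesis
    using heat_mean_end[of t n \<xi>] t by simp
qed

abbreviation f0_sup :: real where
  "f0_sup \<equiv> enn2real (Linf_norm Upsilon f0)"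

lemma heat_mean_initial_le:
  assumes t: "0 < t" and n: "0 < n"
  shows "heat_mean n t \<xi> 0 \<le> f0_sup"
proof -
  note fi = f_integrable[of 0, simplified]
  have b: "\<bar>trig_poly (freqs n) freq (cos_coeff n (f 0)) (sin_coeff n (f 0)) \<zeta>\<bar> \<le> f0_sup" for \<zeta>
    using initial_nonneg[of n \<zeta>] initial_le[OF n, of \<zeta>] unfolding fejer_mean_eq_trig_poly[OF fi] by simp
  have "\<bar>heat_mean n t \<xi> 0\<bar> \<le> f0_sup"
    unfolding heat_mean_def diff_zero
    by (rule heat_bounds(1)[OF De t std_normal_abs_integral_le(1)[OF trig_poly_line_measurable b]])
  then show ?thesis by simp
qed

text \<open>After unit time the angular mass alone gives 1 / sqrt 2 + 1, at most 2. The bound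
  involves neither the starting time nor the initial datum, and this makes the final estimate global
  in time.\<close>

lemma heat_mean_unit_le:
  assumes s: "0 < s" and n: "0 < n"
  shows "heat_mean n (s + 1) \<xi> s \<le> 2"
proof -
  note fi = f_integrable[OF less_imp_le[OF s]]
  have r: "0 < sqrt (2 * 1 :: real)" by simp
  have d: "\<bar>fejer_mean n (f s) \<zeta>\<bar> \<le> fejer_mean n (f s) \<zeta>" for \<zeta>
    using mean_nonneg[OF s] by simp
  have "1 / sqrt (2 * 1) + 1 \<le> (2 :: real)" by (simp add: divide_le_eq)
  note le = order_trans[OF gauss_angle_bound(2)[OF s n r mean_bounded[OF s n] fi d] this]
  have b: "\<bar>LINT z|std_normal_distribution. trig_poly (freqs n) freq (cos_coeff n (f s)) (sin_coeff n (f s)) (\<zeta> + (sqrt (2 * 1) * z) *\<^sub>R axis3)\<bar> \<le> 2" for \<zeta>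
    using le[of \<zeta>] unfolding fejer_mean_eq_trig_poly[OF fi] .
  have "\<bar>heat_mean n (s + 1) \<xi> s\<bar> \<le> 2"
    unfolding heat_mean_def add_diff_cancel_left'
    by (rule heat_bounds(1)[OF De zero_less_one b])
  then show ?thesis by simp
qed

text \<open>The Duhamel interval starts at 0 while t is at most 1 and at t - 1 afterwards; the
  maximum covers both starting values.\<close>

lemma mean_le_step:
  assumes t: "0 < t" and n: "0 < n" and M0: "0 \<le> M"
    and M: "\<And>s \<zeta>. 0 < s \<Longrightarrow> fejer_mean n (f s) \<zeta> \<le> M"
  shows "fejer_mean n (f t) \<xi> \<le> max f0_sup 2 + 8 * \<bar>Pe\<bar> / sqrt De * sqrt M"
proof (cases "t \<le> 1")
  case True
  then show ?thesis
    using Duhamel_le[OF _ t _ n M0 M, of \<xi>] heat_mean_initial_le[OF t n, of \<xi>] by simp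
next
  case False
  then show ?thesis
    using Duhamel_le[of "t - 1" t, OF _ _ _ n M0 M, of \<xi>] heat_mean_unit_le[of "t - 1" n \<xi>, OF _ n] by simp
qed

text \<open>\<open>M\<close> is the supremum over all positive times and all points together, so
  both sides of the step inequality contain the same \<open>M\<close> and nothing accumulates in
  time. Being finite, \<open>M\<close> satisfies M at most b + k sqrt M, and this implies that sqrt
  M is at most k + sqrt b.\<close>

lemma mean_le:
  assumes t: "0 < t" and n: "0 < n"
  shows "fejer_mean n (f t) \<xi> \<le> (8 * \<bar>Pe\<bar> / sqrt De + sqrt (max f0_sup 2))\<^sup>2"
proof -
  let ?k = "8 * \<bar>Pe\<bar> / sqrt De" and ?b = "max f0_sup 2"
  let ?S = "(\<lambda>(s, \<zeta>). fejer_mean n (f s) \<zeta>) ` ({0<..} \<times> UNIV)"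
  define M where "M = Sup ?S"
  have bdd: "bdd_above ?S"
    by (rule bdd_aboveI[where M = "real n ^ 3 / (2 * pi) ^ 3 * (2 * pi)\<^sup>2"]) (use mean_bounded[OF _ n] in auto)
  have M: "fejer_mean n (f s) \<zeta> \<le> M" if "0 < s" for s \<zeta>
    unfolding M_def using that by (intro cSup_upper[OF _ bdd] image_eqI[where x = "(s, \<zeta>)"]) auto
  have M0: "0 \<le> M" using mean_nonneg[OF t, of n \<xi>] M[OF t, of \<xi>] by linarith
  have ne: "?S \<noteq> {}" using t by auto
  have "M \<le> ?b + ?k * sqrt M"
    unfolding M_def
  proof (rule cSup_least[OF ne])
    fix x assume "x \<in> ?S"
    then obtain s \<zeta> where "0 < s" "x = fejer_mean n (f s) \<zeta>" by auto
    then show "x \<le> ?b + ?k * sqrt (Sup ?S)"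
      using mean_le_step[OF _ n M0 M] unfolding M_def by simp
  qed
  have k: "0 \<le> ?k" and b: "0 \<le> ?b" using De by auto
  have "sqrt M \<le> ?k + sqrt ?b"
  proof (rule ccontr)
    assume "\<not> sqrt M \<le> ?k + sqrt ?b"
    then have gt: "?k + sqrt ?b < sqrt M" by simp
    have "?b = sqrt ?b * sqrt ?b" using b by simp
    also have "\<dots> \<le> sqrt ?b * sqrt M" using gt k b by (intro mult_left_mono less_imp_le[OF le_less_trans[OF _ gt]]) simp_all
    finally have "?b + ?k * sqrt M \<le> (?k + sqrt ?b) * sqrt M" by (simp only: distrib_right)
    also have "\<dots> < sqrt M * sqrt M"
      using k b by (intro mult_strict_right_mono[OF gt] le_less_trans[OF add_nonneg_nonneg gt]) simp_all
    also have "\<dots> = M" using M0 by simp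
    finally show False using \<open>M \<le> ?b + ?k * sqrt M\<close> by simp
  qed
  then have "(sqrt M)\<^sup>2 \<le> (?k + sqrt ?b)\<^sup>2"
    using M0 by (intro power_mono) auto
  then show ?thesis using M[OF t, of \<xi>] M0 by simp
qed

text \<open>Convergence of the means in L^1 suffices: where \<open>f\<close> exceeds the common
  bound of the means, the excess is at most the distance between \<open>f\<close> and its
  mean.\<close>

lemma f_le:
  assumes t: "0 < t"
  shows "AE \<xi> in cell. \<bar>f t \<xi>\<bar> \<le> (8 * \<bar>Pe\<bar> / sqrt De + sqrt (max f0_sup 2))\<^sup>2"
proof -
  define C where "C = (8 * \<bar>Pe\<bar> / sqrt De + sqrt (max f0_sup 2))\<^sup>2"
  note fi = f_integrable[OF less_imp_le[OF t]]
  have i: "integrable cell (\<lambda>\<xi>. max 0 (f t \<xi> - C))"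
    using fi by (intro integrable_max) auto
  have le: "(LINT \<xi>|cell. max 0 (f t \<xi> - C)) \<le> (LINT \<xi>|cell. \<bar>fejer_mean n (f t) \<xi> - f t \<xi>\<bar>)" if n: "0 < n" for n
  proof (rule integral_mono[OF i])
    show "integrable cell (\<lambda>\<xi>. \<bar>fejer_mean n (f t) \<xi> - f t \<xi>\<bar>)"
      using fi integrable_fejer_mean[OF fi] by simp
    fix \<xi>
    show "max 0 (f t \<xi> - C) \<le> \<bar>fejer_mean n (f t) \<xi> - f t \<xi>\<bar>"
      using mean_le[OF t n, of \<xi>] unfolding C_def[symmetric] by linarith
  qed
  have "(LINT \<xi>|cell. max 0 (f t \<xi> - C)) \<le> 0"
    by (rule LIMSEQ_le_const[OF fejer_mean_L1_limit[OF fi]]) (use le in \<open>auto intro!: exI[of _ 1]\<close>)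
  moreover have "0 \<le> (LINT \<xi>|cell. max 0 (f t \<xi> - C))" by simp
  ultimately have "AE \<xi> in cell. max 0 (f t \<xi> - C) = 0"
    using integral_nonneg_eq_0_iff_AE[OF i] by simp
  then show ?thesis
    using f_nonneg[OF t] unfolding C_def[symmetric] by eventually_elim simp
qed

text \<open>Joint measurability is part of being a weak solution on each bounded time interval, and
  countably many slabs cover the half-line.\<close>

lemma f_measurable: "(\<lambda>(t, \<xi>). f t \<xi>) \<in> borel_measurable (restrict_space lborel ({0<..} \<times> Upsilon))"
proof -
  let ?L = "lborel :: (real \<times> point) measure" and ?A = "{0<..} \<times> Upsilon"
  let ?\<Omega> = "\<lambda>N. {0<..<real (Suc N)} \<times> (UNIV :: point set)"
  have A: "?A \<in> sets ?L"
    unfolding sets_lborel Upsilon_eq_box by (intro borel_open open_Times open_greaterThan open_box)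
  have O: "?\<Omega> N \<in> sets ?L" for N
    unfolding sets_lborel by (intro borel_open open_Times open_greaterThanLessThan open_UNIV)
  show ?thesis
  proof (rule measurable_piecewise_restrict[where C = "range ?\<Omega>"])
    show "countable (range ?\<Omega>)" by simp
    show "space (restrict_space ?L ?A) \<subseteq> \<Union> (range ?\<Omega>)"
    proof
      fix p assume "p \<in> space (restrict_space ?L ?A)"
      then have p: "0 < fst p" by (auto simp: space_restrict_space)
      obtain N where "fst p < real N" using reals_Archimedean2 by blast
      then have "p \<in> ?\<Omega> N" using p by (simp add: mem_Times_iff)
      then show "p \<in> \<Union> (range ?\<Omega>)" by blast
    qed
    fix W assume "W \<in> range ?\<Omega>"
    then obtain N where W: "W = ?\<Omega> N" by blast
    show "W \<inter> space (restrict_space ?L ?A) \<in> sets (restrict_space ?L ?A)"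
      unfolding W sets_restrict_space space_restrict_space space_lborel
      by (rule image_eqI[OF _ O[of N]]) (simp only: space_borel Int_UNIV_left Int_UNIV_right Int_commute)
    obtain G where "L2_H1_grad (real (Suc N)) f G"
      using weak[of "real (Suc N)"] unfolding weak_solution_def Let_def by auto
    then have "(\<lambda>(t, \<xi>). f t \<xi>) \<in> borel_measurable (restrict_space ?L W)"
      unfolding L2_H1_grad_def W by blast
    from measurable_restrict_space1[OF this, of ?A]
    have "(\<lambda>(t, \<xi>). f t \<xi>) \<in> borel_measurable (restrict_space ?L (W \<inter> ?A))"
      using A O[of N] by (subst (asm) restrict_restrict_space) (simp_all only: W space_lborel space_borel Int_UNIV_right)
    then show "(\<lambda>(t, \<xi>). f t \<xi>) \<in> borel_measurable (restrict_space (restrict_space ?L ?A) W)"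
      using A O[of N] by (subst restrict_restrict_space) (simp_all only: W space_lborel space_borel Int_UNIV_left Int_UNIV_right Int_commute)
  qed
qed

text \<open>At each positive time the bound holds off a null set that depends on the time. Joint
  measurability and Fubini combine these into one null set of space-time.\<close>

lemma Linf_bound:
  "Linf_norm ({0<..} \<times> Upsilon) (\<lambda>(t, \<xi>). f t \<xi>) \<le> ennreal ((8 * \<bar>Pe\<bar> / sqrt De + sqrt (max f0_sup 2))\<^sup>2)"
proof -
  define C where "C = (8 * \<bar>Pe\<bar> / sqrt De + sqrt (max f0_sup 2))\<^sup>2"
  let ?R = "restrict_space lborel ({0<..} \<times> Upsilon) :: (real \<times> point) measure"
  let ?T = "restrict_space lborel {0<..} :: real measure"
  note [measurable] = f_measurable
  have eq: "?T \<Otimes>\<^sub>M cell = ?R"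
    unfolding cell_def by (rule restrict_lborel_Times) (simp_all add: Upsilon_eq_box)
  interpret T: sigma_finite_measure ?T
    by (intro sigma_finite_measure_restrict_space lborel.sigma_finite_measure_axioms) simp
  interpret P: pair_sigma_finite ?T cell by standard
  have "AE p in ?T \<Otimes>\<^sub>M cell. \<bar>(\<lambda>(t, \<xi>). f t \<xi>) p\<bar> \<le> C"
  proof (rule P.AE_pair_measure)
    show "{p \<in> space (?T \<Otimes>\<^sub>M cell). \<bar>(\<lambda>(t, \<xi>). f t \<xi>) p\<bar> \<le> C} \<in> sets (?T \<Otimes>\<^sub>M cell)"
      unfolding eq by measurable
    show "AE t in ?T. AE \<xi> in cell. \<bar>(\<lambda>(t, \<xi>). f t \<xi>) (t, \<xi>)\<bar> \<le> C"
      unfolding C_def prod.case by (intro AE_I2 f_le) (simp add: space_restrict_space)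
  qed
  then have "AE p in ?R. ennreal \<bar>(\<lambda>(t, \<xi>). f t \<xi>) p\<bar> \<le> ennreal C"
    unfolding eq by eventually_elim (simp add: ennreal_leI)
  then show ?thesis
    unfolding Linf_norm_def[of "{0<..} \<times> Upsilon"] C_def[symmetric]
    by (intro esssup_I measurable_compose[OF f_measurable, of "\<lambda>y. ennreal \<bar>y\<bar>" borel]) simp_all
qed

end

theorem theorem4:
  shows "\<exists>C :: real \<Rightarrow> real \<Rightarrow> real \<Rightarrow> real.
    \<forall>(Pe :: real) (De :: real) (f0 :: point \<Rightarrow> real) (f :: real \<Rightarrow> point \<Rightarrow> real).
      De > 0 \<longrightarrow>
      f0 \<in> Linf_per \<longrightarrow>
      (AE \<xi> in lborel. 0 \<le> f0 \<xi>) \<longrightarrow>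
      (AE x in lborel. x \<in> Omega \<longrightarrow> 0 \<le> angular_int f0 x \<and> angular_int f0 x \<le> 1) \<longrightarrow>
      global_weak_solution Pe De f0 f \<longrightarrow>
      Linf_norm ({0<..} \<times> Upsilon) (\<lambda>(t, \<xi>). f t \<xi>)
        \<le> ennreal (C Pe De (enn2real (Linf_norm Upsilon f0)))"
  \<comment> \<open>Here \<open>b\<close> is the sup norm of the initial datum, and 2 is the
    starting value of the later Duhamel intervals.\<close>
  by (intro exI[of _ "\<lambda>Pe De b. (8 * \<bar>Pe\<bar> / sqrt De + sqrt (max b 2))\<^sup>2"] allI impI
      global_solution.Linf_bound global_solution.intro)

end
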